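(* Given a fixed parameter $t>0$, let $\{\mathbf{z}^k\}$ be a sequence generated by the inexact full-step generalized Newton scheme (FGN) $$\mathbf{z}^{k+1}\approx\bar{\mathbf{z}}^{k+1}:=\mathcal{P}_{\mathbf{z}^k}\big(\mathbf{z}^k-\nabla^2F(\mathbf{z}^k)^{-1}\nabla F(\mathbf{z}^k);t\big),$$ where $\mathbf{z}^{k+1}$ is a $\delta_k$-approximation to $\bar{\mathbf{z}}^{k+1}$ (at $\mathbf{z}^k$ and $t$). Then: (a) Let $0<\beta<\frac12(3-\sqrt5)$ be a given radius. If $\mathbf{z}^0\in\Omega_t(\beta)$ and the tolerances $\delta_k$ are chosen such that $$\|\mathbf{z}^{k+1}-\bar{\mathbf{z}}^{k+1}\|_{\mathbf{z}^k}\le\delta_k\le\bar\delta_k(\beta):=\frac{\beta(1-3\beta+\beta^2)(1-\beta)^4}{2\beta^3-5\beta^2+3\beta+1},$$ then $\{\mathbf{z}^k\}$ belongs to $\Omega_t(\beta)$. (b) If $\delta_k\le\frac{\lambda_t(\mathbf{z}^k)^2}{1-\lambda_t(\mathbf{z}^k)}$, then, for $k\ge0$ and $\lambda_t(\mathbf{z}^0)<1$, $$\lambda_t(\mathbf{z}^{k+1})\le\left(\frac{2-4\lambda_t(\mathbf{z}^k)+\lambda_t(\mathbf{z}^k)^2}{(1-2\lambda_t(\mathbf{z}^k))^3}\right)\lambda_t(\mathbf{z}^k)^2<1.$$ For any $\beta\in(0,0.18858]$, if $\mathbf{z}^0\in\mathcal{Q}_t(\beta)$, the quadratic convergence region of (FGN),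 then the sequence $\{\mathbf{z}^k\}\subset\mathcal{Q}_t(\beta)$, and $\{\lambda_t(\mathbf{z}^k)\}$ converges quadratically to zero. (c) Let $c:=\frac{2-4\beta+\beta^2}{(1-2\beta)^3}\in(0,1)$ and let $\varepsilon>0$ be a given tolerance, for $\beta\in(0,0.18858]$. If we choose $t:=(1-\epsilon)\big(\sqrt\nu+\epsilon+2\epsilon^2/(1-\epsilon)\big)^{-1}\varepsilon$ for a sufficiently small $\epsilon\in(0,\beta)$, and update $\delta_k:=\frac{2\beta_k^2}{1-\beta_k}$ with $\beta_k:=c^{2^k-1}\beta^{2^k}$, then after at most $k:=\mathcal{O}(\ln(\ln(1/\epsilon)))$ iterations, $\mathbf{z}^k$ is an $\varepsilon$-solution of $0\in\mathcal{A}(\mathbf{z})+\mathcal{N}_{\mathcal{Z}}(\mathbf{z})$.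
   Context: Setting. $\mathcal{Z}\subseteq\mathbb{R}^p$ is nonempty, closed, convex and equipped with a $\nu$-self-concordant barrier $F$; $\mathcal{A}:\mathbb{R}^p\rightrightarrows2^{\mathbb{R}^p}$ is maximally monotone, $\mathrm{int}(\mathcal{Z})\cap\mathrm{dom}(\mathcal{A})\ne\emptyset$, $\mathrm{dom}(\mathcal{A})$ is open or closed; the solution set of $0\in\mathcal{A}(\mathbf{z})+\mathcal{N}_{\mathcal{Z}}(\mathbf{z})$ is nonempty, where $\mathcal{N}_{\mathcal{Z}}(\mathbf{z})=\{\mathbf{w}\mid\langle\mathbf{w},\mathbf{z}-\hat{\mathbf{z}}\rangle\ge0\ \forall\hat{\mathbf{z}}\in\mathcal{Z}\}$ for $\mathbf{z}\in\mathcal{Z}$ (and $\emptyset$ otherwise) is the normal cone. It is also assumed throughout that for any nonzero $\boldsymbol\omega$ in the horizon cone of $\mathrm{int}(\mathcal{Z})\cap\mathrm{dom}(\mathcal{A})$ there are $\hat{\mathbf{z}}\in\mathrm{int}(\mathcal{Z})\cap\mathrm{dom}(\mathcal{A})$ and $\hat{\mathbf{a}}\in\mathcal{A}(\hat{\mathbf{z}})$ with $\langle\hat{\mathbf{a}},\boldsymbol\omega\rangle>0$, where the horizon cone of a convex set $C$ is the set of $\boldsymbol\omega$ with $\mathbf{z}+\tau\boldsymbol\omega\in\mathrm{cl}(C)$ for all $\mathbf{z}\in C$, $\tau>0$. Self-concordance. $F$ is standard self-concordant if each restriction $\varphi(\tau)=F(\mathbf{z}+\tau\mathbf{v})$ is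 $\mathcal{C}^3$, convex and satisfies $|\varphi'''|\le2(\varphi'')^{3/2}$; it is a $\nu$-self-concordant barrier for $\mathcal{Z}$ ($\nu>0$) if in addition $\mathrm{dom}(F)=\mathrm{int}(\mathcal{Z})$, $\sup_{\mathbf{u}}\{2\langle\nabla F(\mathbf{z}),\mathbf{u}\rangle-\|\mathbf{u}\|_{\mathbf{z}}^2\}\le\nu$ for all $\mathbf{z}\in\mathrm{int}(\mathcal{Z})$, and $F(\mathbf{z})\to+\infty$ as $\mathbf{z}$ approaches the boundary of $\mathcal{Z}$. $\nabla^2F(\mathbf{z})\succ0$ on $\mathrm{int}(\mathcal{Z})$. Local norms: $\|\mathbf{u}\|_{\mathbf{z}}=\langle\nabla^2F(\mathbf{z})\mathbf{u},\mathbf{u}\rangle^{1/2}$, $\|\mathbf{v}\|^*_{\mathbf{z}}=\langle\nabla^2F(\mathbf{z})^{-1}\mathbf{v},\mathbf{v}\rangle^{1/2}$. $\mathrm{dist}_{\mathbf{z}}(\boldsymbol{0},S)=\min\{\|\mathbf{e}\|^*_{\mathbf{z}}\mid\mathbf{e}\in S\}$. Scaled resolvent: $\mathcal{P}_{\hat{\mathbf{z}}}(\cdot;t):=(\mathbb{I}+t^{-1}\nabla^2F(\hat{\mathbf{z}})^{-1}\mathcal{A})^{-1}(\cdot)$ for $\hat{\mathbf{z}}\in\mathrm{int}(\mathcal{Z})$, $t>0$ (single-valued, defined on $\mathbb{R}^p$). Generalized Newton decrement: $\lambda_t(\mathbf{z}):=\|\mathbf{z}-\mathcal{P}_{\mathbf{z}}(\mathbf{z}-\nabla^2F(\mathbf{z})^{-1}\nabla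 F(\mathbf{z});t)\|_{\mathbf{z}}$. Inexactness: for $\delta\in[0,1)$, $\mathbf{z}_+$ is a $\delta$-approximation (at $\mathbf{z}$ and $t$) to $\bar{\mathbf{z}}_+:=\mathcal{P}_{\mathbf{z}}(\mathbf{z}-\nabla^2F(\mathbf{z})^{-1}\nabla F(\mathbf{z});t)$, written $\mathbf{z}_+\approx\bar{\mathbf{z}}_+$, if $\mathrm{dist}_{\mathbf{z}}\big(\boldsymbol{0},\,t[\nabla F(\mathbf{z})+\nabla^2F(\mathbf{z})(\mathbf{z}_+-\mathbf{z})]+\mathcal{A}(\mathbf{z}_+)\big)\le t\delta$. Neighborhood: $\Omega_t(\beta):=\{\mathbf{z}\in\mathrm{int}(\mathcal{Z})\mid\lambda_t(\mathbf{z})\le\beta\}$ for $\beta\in(0,1)$. If $\beta\in(0,1)$ can be chosen such that the sequence $\{\mathbf{z}^k\}$ generated by a given generalized Newton scheme starting from $\mathbf{z}^0\in\Omega_t(\beta)$ belongs to $\Omega_t(\beta)$ and the corresponding decrements $\{\lambda_t(\mathbf{z}^k)\}$ converge quadratically to zero, then $\Omega_t(\beta)$ is called a quadratic convergence region of the method and denoted $\mathcal{Q}_t(\beta)$. A point $\tilde{\mathbf{z}}\in\mathrm{int}(\mathcal{Z})$ is an $\varepsilon$-solution of $0\in\mathcal{A}(\mathbf{z})+\mathcal{N}_{\mathcal{Z}}(\mathbf{z})$ if $\mathrm{dist}_{\tilde{\mathbf{z}}}(\boldsymbol{0},\mathcal{A}(\tilde{\mathbf{z}}))\le\varepsilon$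.
   Formalization: In (b) the bound is stated at steps with λ_t(z^k)<1/2, "<1" for λ_t(z^k)≤0.287, and both for all k if λ_t(z^0)≤0.18858, instead of for λ_t(z^0)<1, where they fail; in (c), c∈(0,1), false since c>2, is replaced by c>0 and cβ<1. *)

theory Defs
  imports "HOL-Analysis.Analysis" "HOL-Library.Landau_Symbols"
begin

section \<open>Set-valued operators\<close>

text \<open>A set-valued operator is a function \<open>A\<close> into sets; its graph is \<open>{(x, u). u \<in> A x}\<close>.\<close>

definition op_dom :: "('a \<Rightarrow> 'b set) \<Rightarrow> 'a set" where
  "op_dom A = {x. A x \<noteq> {}}"

definition monotone_op :: "('a::real_inner \<Rightarrow> 'a set) \<Rightarrow> bool" where
  "monotone_op A \<longleftrightarrow> (\<forall>x y. \<forall>u\<in>A x. \<forall>v\<in>A y. 0 \<le> (u - v) \<bullet> (x - y))"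

definition maximally_monotone :: "('a::real_inner \<Rightarrow> 'a set) \<Rightarrow> bool" where
  "maximally_monotone A \<longleftrightarrow>
     monotone_op A \<and> (\<forall>B. monotone_op B \<and> (\<forall>x. A x \<subseteq> B x) \<longrightarrow> B = A)"

definition normal_cone :: "'a::real_inner set \<Rightarrow> 'a \<Rightarrow> 'a set" where
  "normal_cone Z z = (if z \<in> Z then {w. \<forall>y\<in>Z. 0 \<le> w \<bullet> (z - y)} else {})"

definition inclusion_solutions :: "'a::real_inner set \<Rightarrow> ('a \<Rightarrow> 'a set) \<Rightarrow> 'a set" where
  "inclusion_solutions Z A = {z. 0 \<in> {a + w | a w. a \<in> A z \<and> w \<in> normal_cone Z z}}"

definition horizon_cone :: "'a::real_normed_vector set \<Rightarrow> 'a set" where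
  "horizon_cone C = {\<omega>. \<forall>z\<in>C. \<forall>\<tau>>0. z + \<tau> *\<^sub>R \<omega> \<in> closure C}"


section \<open>Derivatives and local norms\<close>

definition grad :: "(real^'p \<Rightarrow> real) \<Rightarrow> real^'p \<Rightarrow> real^'p" where
  "grad F z = (THE g. GDERIV F z :> g)"

definition hess :: "(real^'p \<Rightarrow> real) \<Rightarrow> real^'p \<Rightarrow> real^'p^'p" where
  "hess F z = jacobian (grad F) (at z)"

definition local_norm :: "(real^'p \<Rightarrow> real) \<Rightarrow> real^'p \<Rightarrow> real^'p \<Rightarrow> real" where
  "local_norm F z u = sqrt ((hess F z *v u) \<bullet> u)"

definition dual_norm :: "(real^'p \<Rightarrow> real) \<Rightarrow> real^'p \<Rightarrow> real^'p \<Rightarrow> real" where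
  "dual_norm F z v = sqrt ((matrix_inv (hess F z) *v v) \<bullet> v)"

text \<open>
  The distance is taken in the extended reals, so that the distance to the empty set is
  infinite. All sets it is applied to are translates of values of a maximally monotone
  operator; these are closed, so the infimum is a minimum when they are nonempty.
\<close>

definition dist_zero :: "(real^'p \<Rightarrow> real) \<Rightarrow> real^'p \<Rightarrow> (real^'p) set \<Rightarrow> ereal" where
  "dist_zero F z S = (INF e\<in>S. ereal (dual_norm F z e))"


section \<open>Self-concordant barriers\<close>

text \<open>
  The extended-valued barrier with domain \<open>interior Z\<close> is represented by a total real function
  \<open>F\<close> of which only the values on the open set \<open>interior Z\<close> are used.
\<close>

definition self_concordant_on :: "(real^'p) set \<Rightarrow> (real^'p \<Rightarrow> real) \<Rightarrow> bool" where
  "self_concordant_on U F \<longleftrightarrow>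
     (\<forall>z\<in>U. \<forall>v. let I = {\<tau>. z + \<tau> *\<^sub>R v \<in> U}; \<phi> = (\<lambda>\<tau>. F (z + \<tau> *\<^sub>R v)) in
        convex_on I \<phi> \<and>
        (\<exists>\<phi>1 \<phi>2 \<phi>3.
           (\<forall>\<tau>\<in>I. (\<phi> has_real_derivative \<phi>1 \<tau>) (at \<tau>) \<and>
                  (\<phi>1 has_real_derivative \<phi>2 \<tau>) (at \<tau>) \<and>
                  (\<phi>2 has_real_derivative \<phi>3 \<tau>) (at \<tau>)) \<and>
           continuous_on I \<phi>3 \<and>
           (\<forall>\<tau>\<in>I. \<bar>\<phi>3 \<tau>\<bar> \<le> 2 * \<phi>2 \<tau> powr (3 / 2))))"

text \<open>
  Differentiability of \<open>F\<close> and of its gradient is made explicit, so that \<open>grad\<close> and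
  \<open>hess\<close> denote the actual derivatives.
\<close>

definition self_concordant_barrier ::
    "(real^'p) set \<Rightarrow> (real^'p \<Rightarrow> real) \<Rightarrow> real \<Rightarrow> bool" where
  "self_concordant_barrier Z F \<nu> \<longleftrightarrow>
     0 < \<nu> \<and>
     self_concordant_on (interior Z) F \<and>
     (\<forall>z\<in>interior Z. F differentiable (at z) \<and> grad F differentiable (at z)) \<and>
     (\<forall>z\<in>interior Z. \<forall>u. u \<noteq> 0 \<longrightarrow> 0 < (hess F z *v u) \<bullet> u) \<and>
     (\<forall>z\<in>interior Z. \<forall>u. 2 * (grad F z \<bullet> u) - (local_norm F z u)\<^sup>2 \<le> \<nu>) \<and>
     (\<forall>x\<in>frontier Z. filterlim F at_top (at x within interior Z))"

definition self_concordant_inclusion ::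
    "(real^'p) set \<Rightarrow> (real^'p \<Rightarrow> real) \<Rightarrow> real \<Rightarrow> (real^'p \<Rightarrow> (real^'p) set) \<Rightarrow> bool" where
  "self_concordant_inclusion Z F \<nu> A \<longleftrightarrow>
     Z \<noteq> {} \<and> closed Z \<and> convex Z \<and>
     self_concordant_barrier Z F \<nu> \<and>
     maximally_monotone A \<and>
     interior Z \<inter> op_dom A \<noteq> {} \<and>
     (open (op_dom A) \<or> closed (op_dom A)) \<and>
     inclusion_solutions Z A \<noteq> {} \<and>
     (\<forall>\<omega>\<in>horizon_cone (interior Z \<inter> op_dom A). \<omega> \<noteq> 0 \<longrightarrow>
        (\<exists>z\<in>interior Z \<inter> op_dom A. \<exists>a\<in>A z. 0 < a \<bullet> \<omega>))"


section \<open>Generalized Newton scheme\<close>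

definition scaled_resolvent ::
    "(real^'p \<Rightarrow> real) \<Rightarrow> (real^'p \<Rightarrow> (real^'p) set) \<Rightarrow> real^'p \<Rightarrow> real \<Rightarrow> real^'p \<Rightarrow> real^'p" where
  "scaled_resolvent F A z t u =
     (THE w. \<exists>a\<in>A w. u = w + (1 / t) *\<^sub>R (matrix_inv (hess F z) *v a))"

definition newton_point ::
    "(real^'p \<Rightarrow> real) \<Rightarrow> (real^'p \<Rightarrow> (real^'p) set) \<Rightarrow> real \<Rightarrow> real^'p \<Rightarrow> real^'p" where
  "newton_point F A t z = scaled_resolvent F A z t (z - matrix_inv (hess F z) *v grad F z)"

definition newton_decrement ::
    "(real^'p \<Rightarrow> real) \<Rightarrow> (real^'p \<Rightarrow> (real^'p) set) \<Rightarrow> real \<Rightarrow> real^'p \<Rightarrow> real" where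
  "newton_decrement F A t z = local_norm F z (z - newton_point F A t z)"

definition newton_approx ::
    "(real^'p \<Rightarrow> real) \<Rightarrow> (real^'p \<Rightarrow> (real^'p) set) \<Rightarrow> real \<Rightarrow> real \<Rightarrow> real^'p \<Rightarrow> real^'p \<Rightarrow> bool" where
  "newton_approx F A t \<delta> z z' \<longleftrightarrow>
     dist_zero F z ((\<lambda>a. t *\<^sub>R (grad F z + hess F z *v (z' - z)) + a) ` A z') \<le> ereal (t * \<delta>)"

text \<open>
  The iterates are deliberately not required to stay in \<open>interior Z\<close>: only the starting point
  is assumed to lie there (in the statements about the scheme), the rest has to be proved.
\<close>

definition FGN_sequence ::
    "(real^'p \<Rightarrow> real) \<Rightarrow> (real^'p \<Rightarrow> (real^'p) set) \<Rightarrow> real \<Rightarrow> (nat \<Rightarrow> real) \<Rightarrow> (nat \<Rightarrow> real^'p) \<Rightarrow> bool" where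
  "FGN_sequence F A t \<delta> z \<longleftrightarrow>
     (\<forall>k. 0 \<le> \<delta> k \<and> \<delta> k < 1 \<and> newton_approx F A t (\<delta> k) (z k) (z (Suc k)))"

definition neighborhood ::
    "(real^'p) set \<Rightarrow> (real^'p \<Rightarrow> real) \<Rightarrow> (real^'p \<Rightarrow> (real^'p) set) \<Rightarrow> real \<Rightarrow> real \<Rightarrow> (real^'p) set" where
  "neighborhood Z F A t \<beta> = {z \<in> interior Z. newton_decrement F A t z \<le> \<beta>}"

definition converges_quadratically_to_zero :: "(nat \<Rightarrow> real) \<Rightarrow> bool" where
  "converges_quadratically_to_zero l \<longleftrightarrow>
     l \<longlonglongrightarrow> 0 \<and> (\<exists>C. \<forall>k. \<bar>l (Suc k)\<bar> \<le> C * \<bar>l k\<bar>\<^sup>2)"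

text \<open>\<open>S\<close> is the set of all sequences generated by the scheme, for arbitrary starting points.\<close>

definition quadratic_convergence_region ::
    "(nat \<Rightarrow> real^'p) set \<Rightarrow> (real^'p) set \<Rightarrow> (real^'p \<Rightarrow> real) \<Rightarrow> (real^'p \<Rightarrow> (real^'p) set) \<Rightarrow>
     real \<Rightarrow> real \<Rightarrow> bool" where
  "quadratic_convergence_region S Z F A t \<beta> \<longleftrightarrow>
     0 < \<beta> \<and> \<beta> < 1 \<and>
     (\<forall>z\<in>S. z 0 \<in> neighborhood Z F A t \<beta> \<longrightarrow>
        (\<forall>k. z k \<in> neighborhood Z F A t \<beta>) \<and>
        converges_quadratically_to_zero (\<lambda>k. newton_decrement F A t (z k)))"

definition eps_solution ::
    "(real^'p) set \<Rightarrow> (real^'p \<Rightarrow> real) \<Rightarrow> (real^'p \<Rightarrow> (real^'p) set) \<Rightarrow> real \<Rightarrow> real^'p \<Rightarrow> bool" where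
  "eps_solution Z F A \<epsilon> z \<longleftrightarrow> z \<in> interior Z \<and> dist_zero F z (A z) \<le> ereal \<epsilon>"


section \<open>Constants\<close>

definition delta_max :: "real \<Rightarrow> real" where
  "delta_max \<beta> = \<beta> * (1 - 3 * \<beta> + \<beta>\<^sup>2) * (1 - \<beta>) ^ 4 / (2 * \<beta> ^ 3 - 5 * \<beta>\<^sup>2 + 3 * \<beta> + 1)"

definition newton_rate :: "real \<Rightarrow> real" where
  "newton_rate r = (2 - 4 * r + r\<^sup>2) / (1 - 2 * r) ^ 3"

text \<open>\<open>\<beta>\<^sub>k\<close> and the corresponding tolerance \<open>\<delta>\<^sub>k\<close>, with \<open>c = newton_rate \<beta>\<close>.\<close>

definition beta_seq :: "real \<Rightarrow> nat \<Rightarrow> real" where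
  "beta_seq \<beta> k = newton_rate \<beta> ^ (2 ^ k - 1) * \<beta> ^ (2 ^ k)"

definition delta_seq :: "real \<Rightarrow> nat \<Rightarrow> real" where
  "delta_seq \<beta> k = 2 * (beta_seq \<beta> k)\<^sup>2 / (1 - beta_seq \<beta> k)"

definition t_choice :: "real \<Rightarrow> real \<Rightarrow> real \<Rightarrow> real" where
  "t_choice \<nu> e \<epsilon> = (1 - e) * inverse (sqrt \<nu> + e + 2 * e\<^sup>2 / (1 - e)) * \<epsilon>"

end

theory Submission
  imports Defs
begin

text \<open>
  The scheme is a Newton method for \<open>0 \<in> t \<nabla>F(z) + A(z)\<close>, and all three claims rest on two facts
  about a self-concordant \<open>F\<close>. If \<open>r = \<parallel>y - x\<parallel>\<^sub>x < 1\<close>, then \<open>y\<close> lies in the interior of \<open>Z\<close> and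
  \<open>(1 - r)\<^sup>2 H(x) \<le> H(y) \<le> (1 - r)\<^sup>-\<^sup>2 H(x)\<close> for the Hessian \<open>H\<close>; and the linearisation error of the
  gradient from \<open>x\<close> to \<open>y\<close> has dual norm at most \<open>r\<^sup>2 / (1 - r)\<close>. If \<open>y\<close> solves the inclusion
  linearised at \<open>x\<close> up to a residual of dual norm \<open>\<delta>\<close>, then testing monotonicity of \<open>A\<close> at \<open>y\<close> and at
  the exact Newton point of \<open>y\<close> gives the new decrement at most
  \<open>\<delta> / (1 - s) + (s / (1 - s))\<^sup>2\<close> with \<open>s = \<lambda>(x) + \<delta>\<close>. Claims (a) and (b) are this inequality
  with the prescribed tolerances.

  Self-concordance is only a condition on restrictions of \<open>F\<close> to lines, whereas the comparison of
  Hessians needs the mixed inequality \<open>\<bar>D\<^sup>3F[h, v, v]\<bar> \<le> 2 \<parallel>h\<parallel> \<parallel>v\<parallel>\<^sup>2\<close> with the sharp constant. For a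
  symmetric trilinear form this is Banach's theorem that the norm is attained on the diagonal. Here
  \<open>F\<close> need not have a third derivative in the Frechet sense, so \<open>D\<^sup>3F[u, v, w]\<close> is replaced by the best
  Lipschitz constant of \<open>\<langle>H v, w\<rangle>\<close> in the direction \<open>u\<close>. This quantity is still symmetric in its
  three arguments (\<open>third_le_exchange\<close>), subadditive, and finite (\<open>third_le_crude_square\<close>), which is
  enough for Banach's argument (\<open>diagonal_bound_suffices\<close>). The Hessian is then only locally
  Lipschitz along a segment, and the comparison follows from a one-sided growth condition
  (\<open>nonincreasing_from_right_increments\<close>) rather than from a differential inequality.

  The Newton point exists because \<open>A\<close> is maximally monotone (\<open>Minty_surjectivity\<close>). In finite
  dimension this follows from compactness once every finite monotone set has an extension, and such
  an extension is read off from the minimum of a quadratic over a convex hull.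

  In claim (c) the tolerances are so large, about \<open>2 \<beta>\<^sub>k\<^sup>2\<close>, that the one-step bound for the decrement
  does not give \<open>\<lambda>(z\<^sub>k) \<le> \<beta>\<^sub>k\<close>, and for \<open>\<beta>\<close> close to \<open>0.18858\<close> it does not even keep the decrements
  bounded. The distance to the point \<open>z*\<close> of the central path, \<open>-t \<nabla>F(z*) \<in> A(z*)\<close>, measured in the
  fixed norm at \<open>z*\<close>, behaves better: after one step it is at most \<open>0.18\<close>, it stays there, and it
  satisfies \<open>\<rho>\<^sub>k\<^sub>+\<^sub>1 \<le> 2 \<delta>\<^sub>k + 2 \<rho>\<^sub>k\<^sup>2\<close>. Since \<open>\<beta>\<^sub>k\<^sub>+\<^sub>1 = c \<beta>\<^sub>k\<^sup>2\<close> as well, the maximum of both decays doubly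
  exponentially from an index that depends on \<open>\<beta>\<close> alone. The point \<open>z*\<close> itself is the limit of
  exact Newton steps. Finally, if the last step has local length at most \<open>e\<close>, the residual that
  defines the approximation exhibits an element of \<open>A\<close> of small dual norm, and \<open>t\<close> is chosen
  precisely so that this norm is at most \<open>\<epsilon>\<close>.
\<close>

section \<open>Inner products and symmetric trilinear bounds\<close>

text \<open>
  Norms of Hessian forms vary from point to point, so inner products are handled as bilinear
  functions \<open>b\<close> on a vector space instead of through the type class.
\<close>

definition form_norm :: "('a \<Rightarrow> 'a \<Rightarrow> real) \<Rightarrow> 'a \<Rightarrow> real" where
  "form_norm b x = sqrt (b x x)"

locale inner_form =
  fixes b :: "'a::real_vector \<Rightarrow> 'a \<Rightarrow> real"
  assumes add_left: "b (x + y) z = b x z + b y z"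
    and scale_left: "b (c *\<^sub>R x) y = c * b x y"
    and sym: "b x y = b y x"
    and pos: "x \<noteq> 0 \<Longrightarrow> 0 < b x x"
begin

abbreviation nrm :: "'a \<Rightarrow> real" where "nrm \<equiv> form_norm b"

lemma add_right: "b z (x + y) = b z x + b z y"
  by (metis add_left sym)

lemma scale_right: "b y (c *\<^sub>R x) = c * b y x"
  by (metis scale_left sym)

lemma zero_left [simp]: "b 0 x = 0"
  using scale_left[of 0 0 x] by simp

lemma zero_right [simp]: "b x 0 = 0"
  by (simp add: sym[of x 0])

lemma minus_left: "b (- x) y = - b x y"
  using scale_left[of "-1" x y] by simp

lemma minus_right: "b y (- x) = - b y x"
  by (metis minus_left sym)

lemma diff_left: "b (x - y) z = b x z - b y z"
  using add_left[of x "- y" z] by (simp add: minus_left)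

lemma diff_right: "b z (x - y) = b z x - b z y"
  by (metis diff_left sym)

lemmas bilinear = add_left add_right scale_left scale_right minus_left minus_right
  diff_left diff_right

lemma form_nonneg: "0 \<le> b x x"
  using pos[of x] by (cases "x = 0") auto

lemma nrm_nonneg [simp]: "0 \<le> nrm x"
  by (simp add: form_norm_def form_nonneg)

lemma nrm_sq: "(nrm x)\<^sup>2 = b x x"
  by (simp add: form_norm_def form_nonneg)

lemma nrm_zero [simp]: "nrm 0 = 0"
  by (simp add: form_norm_def)

lemma nrm_pos: "x \<noteq> 0 \<Longrightarrow> 0 < nrm x"
  by (simp add: form_norm_def pos)

lemma nrm_scale: "nrm (c *\<^sub>R x) = \<bar>c\<bar> * nrm x"
proof -
  have "b (c *\<^sub>R x) (c *\<^sub>R x) = c\<^sup>2 * b x x"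
    by (simp add: bilinear power2_eq_square)
  then show ?thesis
    by (simp add: form_norm_def real_sqrt_mult)
qed

lemma nrm_minus: "nrm (- x) = nrm x"
  using nrm_scale[of "-1" x] by simp

lemma nrm_minus_commute: "nrm (x - y) = nrm (y - x)"
  using nrm_minus[of "x - y"] by simp

lemma unit_exists: "\<exists>y. nrm y \<le> 1 \<and> x = nrm x *\<^sub>R y \<and> (x \<noteq> 0 \<longrightarrow> nrm y = 1)"
proof (cases "x = 0")
  case True
  then show ?thesis by (intro exI[of _ 0]) auto
next
  case False
  then have "nrm x > 0" by (rule nrm_pos)
  then show ?thesis
    by (intro exI[of _ "(1 / nrm x) *\<^sub>R x"]) (auto simp: nrm_scale)
qed

text \<open>
  Polarisation on the unit sphere: by the parallelogram law the two squares of the polarisation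
  identity have total weight 4. The Cauchy-Schwarz inequality is the case \<open>D = b\<close>.
\<close>

lemma symmetric_form_bound:
  assumes addD: "\<And>x y z. D (x + y) z = D x z + D y z"
    and scaleD: "\<And>c x y. D (c *\<^sub>R x) y = c * D x y"
    and symD: "\<And>x y. D x y = D y x"
    and bound: "\<And>x. \<bar>D x x\<bar> \<le> \<kappa> * b x x"
  shows "\<bar>D x y\<bar> \<le> \<kappa> * nrm x * nrm y"
proof -
  have addR: "D z (x + y) = D z x + D z y" for x y z using addD symD by metis
  have scaleR: "D y (c *\<^sub>R x) = c * D y x" for c x y using scaleD symD by metis
  have minusL: "D (- x) y = - D x y" for x y using scaleD[of "-1" x y] by simp
  have minusR: "D y (- x) = - D y x" for x y using minusL symD by metis
  have diffL: "D (x - y) z = D x z - D y z" for x y z using addD[of x "-y" z] minusL by simp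
  have diffR: "D z (x - y) = D z x - D z y" for x y z using diffL symD by metis
  have unit: "\<bar>D u v\<bar> \<le> \<kappa>" if "nrm u \<le> 1" "nrm v \<le> 1" and k: "0 \<le> \<kappa>" for u v
  proof -
    have "4 * D u v = D (u + v) (u + v) - D (u - v) (u - v)"
      by (simp add: addD addR diffL diffR symD[of v u])
    then have "4 * \<bar>D u v\<bar> \<le> \<bar>D (u + v) (u + v)\<bar> + \<bar>D (u - v) (u - v)\<bar>"
      by linarith
    also have "\<dots> \<le> \<kappa> * b (u + v) (u + v) + \<kappa> * b (u - v) (u - v)"
      using bound[of "u + v"] bound[of "u - v"] by linarith
    also have "\<dots> = \<kappa> * (2 * (nrm u)\<^sup>2 + 2 * (nrm v)\<^sup>2)"
      by (simp add: bilinear nrm_sq algebra_simps sym)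
    also have "\<dots> \<le> \<kappa> * 4"
      using power_le_one[OF nrm_nonneg that(1), of 2] power_le_one[OF nrm_nonneg that(2), of 2] k
      by (intro mult_left_mono) auto
    finally show ?thesis by simp
  qed
  show ?thesis
  proof (cases "x = 0 \<or> y = 0")
    case True
    then show ?thesis using scaleD[of 0 0 y] scaleR[of x 0 0] by auto
  next
    case False
    then have "0 < b x x" using pos by auto
    then have k: "0 \<le> \<kappa>" using bound[of x]
      by (smt (verit) zero_le_mult_iff)
    obtain u v where u: "nrm u \<le> 1" "x = nrm x *\<^sub>R u" and v: "nrm v \<le> 1" "y = nrm y *\<^sub>R v"
      using unit_exists by metis
    have "D x y = nrm x * nrm y * D u v"
      by (subst u(2), subst v(2)) (simp add: scaleD scaleR)
    then have "\<bar>D x y\<bar> = nrm x * nrm y * \<bar>D u v\<bar>"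
      by (simp add: abs_mult)
    also have "\<dots> \<le> nrm x * nrm y * \<kappa>"
      using unit[OF u(1) v(1) k] by (intro mult_left_mono) auto
    finally show ?thesis by (simp add: mult_ac)
  qed
qed

lemma Cauchy_Schwarz_form: "\<bar>b x y\<bar> \<le> nrm x * nrm y"
  using symmetric_form_bound[of b 1 x y] by (simp add: bilinear sym form_nonneg)

lemma nrm_triangle: "nrm (x + y) \<le> nrm x + nrm y"
proof (rule power2_le_imp_le)
  have "(nrm (x + y))\<^sup>2 = (nrm x)\<^sup>2 + 2 * b x y + (nrm y)\<^sup>2"
    by (simp add: nrm_sq bilinear sym)
  also have "\<dots> \<le> (nrm x + nrm y)\<^sup>2"
    using Cauchy_Schwarz_form[of x y] by (simp add: power2_sum)
  finally show "(nrm (x + y))\<^sup>2 \<le> (nrm x + nrm y)\<^sup>2" .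
qed simp

lemma nrm_triangle_diff: "nrm (x - y) \<le> nrm x + nrm y"
  using nrm_triangle[of x "- y"] by (simp add: nrm_minus)

end

text \<open>
  \<open>P u v w K\<close> stands for \<open>\<bar>T[u, v, w]\<bar> \<le> K\<close>, where \<open>T\<close> behaves like a symmetric trilinear form as
  far as upper bounds are concerned but need not exist as a form. Additivity is demanded in one
  slot only; polarisation in the last two slots is a separate axiom, because it combines bounds that
  differ in two slots.
\<close>

locale trilinear_gauge = inner_form b for b :: "'a::real_vector \<Rightarrow> 'a \<Rightarrow> real" +
  fixes P :: "'a \<Rightarrow> 'a \<Rightarrow> 'a \<Rightarrow> real \<Rightarrow> bool" and M C\<^sub>0 :: real
  assumes P_sym12: "P u v w K \<Longrightarrow> P v u w K"
    and P_sym23: "P u v w K \<Longrightarrow> P u w v K"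
    and P_add: "P u v w K \<Longrightarrow> P u v w' K' \<Longrightarrow> P u v (w + w') (K + K')"
    and P_scale: "P u v w K \<Longrightarrow> P u v (c *\<^sub>R w) (\<bar>c\<bar> * K)"
    and P_polarise: "P u (v + w) (v + w) K \<Longrightarrow> P u (v - w) (v - w) K' \<Longrightarrow> P u v w ((K + K') / 4)"
    and P_mono: "P u v w K \<Longrightarrow> K \<le> K' \<Longrightarrow> P u v w K'"
    and P_closed: "(\<And>K'. K < K' \<Longrightarrow> P u v w K') \<Longrightarrow> P u v w K"
    and P_diag: "P u u u (M * nrm u ^ 3)"
    and P_finite: "P u v w (C\<^sub>0 * nrm u * nrm v * nrm w)"
    and M_nonneg: "0 \<le> M" and C0_nonneg: "0 \<le> C\<^sub>0"
begin

lemma P_scale1: "P u v w K \<Longrightarrow> P (c *\<^sub>R u) v w (\<bar>c\<bar> * K)"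
  and P_scale2: "P u v w K \<Longrightarrow> P u (c *\<^sub>R v) w (\<bar>c\<bar> * K)"
  using P_sym12[OF P_sym23[OF P_scale[OF P_sym23[OF P_sym12]]]]
    P_sym23[OF P_scale[OF P_sym23]] by blast+

lemma P_rotate: "P u v w K \<Longrightarrow> P w u v K"
  by (rule P_sym12[OF P_sym23])

lemma P_scale23: "P u v v K \<Longrightarrow> P u (c *\<^sub>R v) (c *\<^sub>R v) (c\<^sup>2 * K)"
  using P_scale[OF P_scale2[of u v v K c], of c]
  by (simp add: power2_eq_square mult.assoc[symmetric])

text \<open>
  Improved bounds are first obtained for \<open>w\<close> close to \<open>p\<close> and then spread to larger angles;
  \<open>c\<close> is the cosine of the angle reached so far.
\<close>

definition near :: "real \<Rightarrow> real \<Rightarrow> bool" where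
  "near c K \<longleftrightarrow> (\<forall>p w. nrm p = 1 \<and> nrm w = 1 \<and> c \<le> b p w \<longrightarrow> P p p w K)"

definition bounded_by :: "real \<Rightarrow> bool" where
  "bounded_by C \<longleftrightarrow> (\<forall>u v w. P u v w (C * nrm u * nrm v * nrm w))"

text \<open>
  Write \<open>T[p, w, p] = (T[p + w, p + w, p] - T[p - w, p - w, p]) / 4\<close>. The first term is at half the
  angle and carries the weight \<open>(1 + c) / 2\<close>, so a gain at the half angle is passed on, at least by
  half of it, to the full angle. The number \<open>sqrt ((1 + c) / 2)\<close> is the cosine of the half angle.
\<close>

lemma near_half_angle:
  assumes C: "bounded_by C" and c: "0 \<le> c" and K: "K \<le> C" and near: "near (sqrt ((1 + c) / 2)) K"
  shows "near c ((1 + c) / 2 * K + (1 - c) / 2 * C)"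
  unfolding near_def
proof (intro allI impI)
  fix p w assume pw: "nrm p = 1 \<and> nrm w = 1 \<and> c \<le> b p w"
  define d where "d = b p w"
  have pp: "b p p = 1" "b w w = 1" using pw nrm_sq[of p] nrm_sq[of w] by auto
  have d: "c \<le> d" using pw by (simp add: d_def)
  define m where "m = nrm (p + w)"
  have m2: "m\<^sup>2 = 2 + 2 * d"
    by (simp add: m_def nrm_sq bilinear pp d_def sym[of w p])
  have "m \<noteq> 0" using m2 c d by auto
  then have m: "m > 0" using nrm_nonneg[of "p + w"] unfolding m_def by linarith
  have l2: "(nrm (p - w))\<^sup>2 = 2 - 2 * d"
    by (simp add: nrm_sq bilinear pp d_def sym[of w p])
  define q where "q = (1 / m) *\<^sub>R (p + w)"
  have q: "nrm q = 1" "p + w = m *\<^sub>R q"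
    using m by (auto simp: q_def nrm_scale m_def[symmetric])
  have "b q p = (1 + d) / m"
    by (simp add: q_def bilinear pp d_def sym[of w p])
  also have "\<dots> = m\<^sup>2 / 2 / m" by (simp add: m2 add_divide_distrib)
  also have "\<dots> = m / 2" using m by (simp add: power2_eq_square)
  also have "\<dots> = sqrt ((1 + d) / 2)"
  proof -
    have "m / 2 = sqrt ((m / 2)\<^sup>2)" using m by simp
    also have "(m / 2)\<^sup>2 = (1 + d) / 2" by (simp add: power_divide m2)
    finally show ?thesis .
  qed
  finally have "sqrt ((1 + c) / 2) \<le> b q p" using d by simp
  then have "P q q p K" using near q pw by (auto simp: near_def)
  then have "P p q q K" by (rule P_rotate)
  then have 1: "P p (p + w) (p + w) (m\<^sup>2 * K)"
    using P_scale23[of p q K m] q(2) by simp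
  have 2: "P p (p - w) (p - w) ((2 - 2 * d) * C)"
  proof -
    have "P p (p - w) (p - w) (C * nrm p * nrm (p - w) * nrm (p - w))"
      using C by (auto simp: bounded_by_def)
    moreover have "C * nrm p * nrm (p - w) * nrm (p - w) = (2 - 2 * d) * C"
      using pw l2 by (simp add: power2_eq_square mult_ac)
    ultimately show ?thesis by simp
  qed
  have "P p p w ((m\<^sup>2 * K + (2 - 2 * d) * C) / 4)"
    by (rule P_polarise[OF 1 2])
  moreover have "(m\<^sup>2 * K + (2 - 2 * d) * C) / 4 \<le> (1 + c) / 2 * K + (1 - c) / 2 * C"
  proof -
    have "0 \<le> (d - c) * (C - K)" using d K by simp
    then show ?thesis by (simp add: m2 field_simps)
  qed
  ultimately show "P p p w ((1 + c) / 2 * K + (1 - c) / 2 * C)"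
    by (rule P_mono)
qed

text \<open>
  Near the diagonal \<open>T[p, p, w] = T[p, p, p] + T[p, p, w - p]\<close> is bounded by almost \<open>M\<close>, which beats
  \<open>C\<close>. Doubling the angle finitely often carries a strict gain to all angles up to a right angle, a
  sign change to all pairs \<open>p\<close>, \<open>w\<close>, and a last polarisation to all triples.
\<close>

lemma bound_improvement:
  assumes C: "bounded_by C" and MC: "M < C"
  shows "\<exists>K. 0 \<le> K \<and> K < C \<and> bounded_by K"
proof -
  \<comment> \<open>cosines of the successively halved right angle\<close>
  define a where "a = rec_nat 0 (\<lambda>_ c. sqrt ((1 + c) / 2))"
  have a0: "a 0 = 0" and aS: "a (Suc n) = sqrt ((1 + a n) / 2)" for n
    by (auto simp: a_def)
  have a01: "0 \<le> a n \<and> a n \<le> 1" for n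
    by (induction n) (auto simp: a0 aS)
  have a_lim: "1 - a n \<le> (1 / 2) ^ n" for n
  proof (induction n)
    case (Suc n)
    have "(1 + a n) / 2 \<le> sqrt ((1 + a n) / 2)"
    proof (rule real_le_rsqrt)
      have "((1 + a n) / 2) * ((1 + a n) / 2) \<le> ((1 + a n) / 2) * 1"
        using a01[of n] by (intro mult_left_mono) auto
      then show "((1 + a n) / 2)\<^sup>2 \<le> (1 + a n) / 2" by (simp add: power2_eq_square)
    qed
    then have "1 - a (Suc n) \<le> (1 - a n) / 2" by (simp add: aS field_simps)
    with Suc show ?case by simp
  qed (simp add: a0)
  have down: "near (a n) K \<Longrightarrow> K < C \<Longrightarrow> \<exists>K'<C. near 0 K'" for n K
  proof (induction n arbitrary: K)
    case 0
    then show ?case using a0 by auto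
  next
    case (Suc n)
    define K' where "K' = (1 + a n) / 2 * K + (1 - a n) / 2 * C"
    have "near (a n) K'"
      unfolding K'_def using Suc.prems a01[of n]
      by (intro near_half_angle[OF C]) (auto simp: aS)
    moreover have "K' < C"
    proof -
      have "C - K' = (1 + a n) / 2 * (C - K)" by (simp add: K'_def field_simps)
      also have "\<dots> > 0" using Suc.prems a01[of n] by (intro mult_pos_pos) auto
      finally show ?thesis by simp
    qed
    ultimately show ?case by (rule Suc.IH)
  qed
  have C0: "0 < C" using MC M_nonneg by linarith
  \<comment> \<open>chosen so that \<open>1 - b p w \<le> \<eta>\<close> makes \<open>C * nrm (w - p)\<close> at most half of the gap \<open>C - M\<close>\<close>
  define \<eta> where "\<eta> = ((C - M) / (2 * C))\<^sup>2 / 2"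
  have "\<eta> > 0" using MC C0 by (simp add: \<eta>_def)
  then obtain n where n: "(1 / 2) ^ n < \<eta>"
    using real_arch_pow_inv[of \<eta> "1/2"] by auto
  have "near (a n) ((M + C) / 2)"
    unfolding near_def
  proof (intro allI impI)
    fix p w assume pw: "nrm p = 1 \<and> nrm w = 1 \<and> a n \<le> b p w"
    have pp: "b p p = 1" "b w w = 1" using pw nrm_sq[of p] nrm_sq[of w] by auto
    have "(nrm (w - p))\<^sup>2 = 2 - 2 * b p w"
      by (simp add: nrm_sq bilinear pp sym[of w p])
    also have "\<dots> \<le> 2 * \<eta>" using pw n a_lim[of n] by simp
    also have "\<dots> = ((C - M) / (2 * C))\<^sup>2" by (simp add: \<eta>_def)
    finally have "nrm (w - p) \<le> (C - M) / (2 * C)"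
      by (rule power2_le_imp_le) (use MC C0 in auto)
    then have le: "C * nrm (w - p) \<le> (C - M) / 2"
      using C0 by (simp add: field_simps)
    have "P p p p M" using P_diag[of p] pw by simp
    moreover have "P p p (w - p) (C * nrm (w - p))"
      using C pw unfolding bounded_by_def by (metis mult.right_neutral)
    ultimately have "P p p (p + (w - p)) (M + C * nrm (w - p))"
      by (rule P_add)
    then have "P p p w (M + C * nrm (w - p))" by simp
    then show "P p p w ((M + C) / 2)"
      by (rule P_mono) (use le in \<open>auto simp: field_simps\<close>)
  qed
  moreover have "(M + C) / 2 < C" using MC by simp
  ultimately obtain K0 where K0: "K0 < C" "near 0 K0" using down by blast
  define K where "K = max K0 0"
  have K: "K < C" "0 \<le> K" using K0 C0 by (auto simp: K_def)
  have unit: "P p p w K" if "nrm p = 1" "nrm w = 1" for p w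
  proof (cases "0 \<le> b p w")
    case True
    then have "P p p w K0" using K0(2) that by (auto simp: near_def)
    then show ?thesis by (rule P_mono) (simp add: K_def)
  next
    case False
    then have "0 \<le> b p (- w)" by (simp add: minus_right)
    then have "P p p (- w) K0" using K0(2) that by (auto simp: near_def nrm_minus)
    from P_scale[OF this, of "-1"] have "P p p w K0" by simp
    then show ?thesis by (rule P_mono) (simp add: K_def)
  qed
  have "P u v w (K * nrm u * nrm v * nrm w)" for u v w
  proof (cases "u = 0 \<or> v = 0 \<or> w = 0")
    case True
    have "P u v w 0"
      using True P_scale[OF P_finite[of u v w], of 0] P_scale2[OF P_finite[of u v w], of 0]
        P_scale1[OF P_finite[of u v w], of 0] by auto
    then show ?thesis using True by auto
  next
    case False
    then obtain u' v' w' where u: "nrm u' = 1" "u = nrm u *\<^sub>R u'"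
      and v: "nrm v' = 1" "v = nrm v *\<^sub>R v'" and w: "nrm w' = 1" "w = nrm w *\<^sub>R w'"
      using unit_exists by metis
    have sq: "P w' x x ((nrm x)\<^sup>2 * K)" for x
    proof -
      obtain x' where x': "nrm x' = 1" "x = nrm x *\<^sub>R x'"
      proof (cases "x = 0")
        case True
        then show ?thesis using that[of u'] u by simp
      next
        case False
        then show ?thesis using that unit_exists[of x] by auto
      qed
      have "P x' x' w' K" by (rule unit) (use x' w in auto)
      then have "P w' x' x' K" by (rule P_rotate)
      from P_scale23[OF this, of "nrm x"] show ?thesis by (simp add: x'(2)[symmetric])
    qed
    have "P w' u' v' (((nrm (u' + v'))\<^sup>2 * K + (nrm (u' - v'))\<^sup>2 * K) / 4)"
      by (rule P_polarise) (rule sq)+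
    also have "((nrm (u' + v'))\<^sup>2 * K + (nrm (u' - v'))\<^sup>2 * K) / 4
        = (2 * (nrm u')\<^sup>2 + 2 * (nrm v')\<^sup>2) * K / 4"
      by (simp add: nrm_sq bilinear sym[of v' u'] algebra_simps)
    finally have "P w' u' v' K" using u v by simp
    then have "P u' v' w' K" by (rule P_rotate[OF P_rotate])
    from P_scale[OF P_scale2[OF P_scale1[OF this, of "nrm u"], of "nrm v"], of "nrm w"]
    show ?thesis by (simp add: u(2)[symmetric] v(2)[symmetric] w(2)[symmetric] mult_ac)
  qed
  then show ?thesis using K by (auto simp: bounded_by_def)
qed

text \<open>
  The least bound exists because \<open>P\<close> is closed in \<open>K\<close>; by the previous lemma it cannot exceed \<open>M\<close>.
\<close>

theorem diagonal_bound_suffices: "P u v w (M * nrm u * nrm v * nrm w)"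
proof -
  define S where "S = {K. 0 \<le> K \<and> bounded_by K}"
  have S: "S \<noteq> {}" "bdd_below S"
    using P_finite C0_nonneg by (auto simp: S_def bounded_by_def bdd_below_def)
  define C where "C = Inf S"
  have C: "bounded_by C"
    unfolding bounded_by_def
  proof (intro allI, rule P_closed)
    fix u v w K' assume K': "C * nrm u * nrm v * nrm w < K'"
    define m where "m = nrm u * nrm v * nrm w"
    have m: "0 \<le> m" by (simp add: m_def)
    have "C * m < K'" using K' by (simp add: m_def mult_ac)
    define \<epsilon> where "\<epsilon> = (K' - C * m) / (m + 1)"
    have e: "\<epsilon> > 0" using \<open>C * m < K'\<close> m by (simp add: \<epsilon>_def)
    obtain K where K: "K \<in> S" "K < C + \<epsilon>"
      using cInf_lessD[OF S(1), of "C + \<epsilon>"] e by (auto simp: C_def)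
    have "K * m \<le> (C + \<epsilon>) * m" using K m by (intro mult_right_mono) auto
    also have "\<dots> = C * m + (K' - C * m) * (m / (m + 1))" by (simp add: \<epsilon>_def algebra_simps)
    also have "\<dots> \<le> C * m + (K' - C * m) * 1"
      using m \<open>C * m < K'\<close> by (intro add_left_mono mult_left_mono) auto
    finally have "K * nrm u * nrm v * nrm w \<le> K'" by (simp add: m_def mult_ac)
    moreover have "P u v w (K * nrm u * nrm v * nrm w)"
      using K(1) by (auto simp: S_def bounded_by_def)
    ultimately show "P u v w K'" using P_mono by blast
  qed
  have "C \<le> M"
  proof (rule ccontr)
    assume "\<not> C \<le> M"
    then obtain K where "0 \<le> K" "K < C" "bounded_by K"
      using bound_improvement[OF C] by auto
    then show False using cInf_lower[of K S] S by (auto simp: S_def C_def)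
  qed
  then have "C * nrm u * nrm v * nrm w \<le> M * nrm u * nrm v * nrm w"
    by (intro mult_right_mono) auto
  moreover have "P u v w (C * nrm u * nrm v * nrm w)"
    using C by (simp add: bounded_by_def)
  ultimately show ?thesis using P_mono by blast
qed

end

section \<open>Third-order bounds for twice differentiable functions\<close>

lemma first_order_comparison:
  fixes h k :: "real \<Rightarrow> real"
  assumes a: "0 \<le> a" and start: "h 0 = k 0"
    and h: "\<And>t. 0 \<le> t \<Longrightarrow> t \<le> a \<Longrightarrow> (h has_real_derivative h' t) (at t)"
    and k: "\<And>t. 0 \<le> t \<Longrightarrow> t \<le> a \<Longrightarrow> (k has_real_derivative k' t) (at t)"
    and le: "\<And>t. 0 \<le> t \<Longrightarrow> t \<le> a \<Longrightarrow> h' t \<le> k' t"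
  shows "h a \<le> k a"
proof -
  have "k 0 - h 0 \<le> k a - h a"
  proof (rule DERIV_nonneg_imp_nondecreasing[OF a])
    fix x assume x: "0 \<le> x" "x \<le> a"
    have "((\<lambda>t. k t - h t) has_real_derivative k' x - h' x) (at x)"
      using x by (intro DERIV_diff h k)
    then show "\<exists>y. ((\<lambda>t. k t - h t) has_real_derivative y) (at x) \<and> 0 \<le> y"
      using le[OF x] by auto
  qed
  then show ?thesis using start by simp
qed

lemma second_order_comparison:
  fixes h h' h'' k k' k'' :: "real \<Rightarrow> real"
  assumes a: "0 \<le> a" and start: "h 0 = k 0" "h' 0 = k' 0"
    and h: "\<And>t. 0 \<le> t \<Longrightarrow> t \<le> a \<Longrightarrow> (h has_real_derivative h' t) (at t)"
      "\<And>t. 0 \<le> t \<Longrightarrow> t \<le> a \<Longrightarrow> (h' has_real_derivative h'' t) (at t)"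
    and k: "\<And>t. 0 \<le> t \<Longrightarrow> t \<le> a \<Longrightarrow> (k has_real_derivative k' t) (at t)"
      "\<And>t. 0 \<le> t \<Longrightarrow> t \<le> a \<Longrightarrow> (k' has_real_derivative k'' t) (at t)"
    and le: "\<And>t. 0 \<le> t \<Longrightarrow> t \<le> a \<Longrightarrow> h'' t \<le> k'' t"
  shows "h a \<le> k a"
proof (rule first_order_comparison[OF a start(1) h(1) k(1)])
  fix t assume t: "0 \<le> t" "t \<le> a"
  show "h' t \<le> k' t"
    by (rule first_order_comparison[OF t(1) start(2) h(2) k(2) le]) (use t in auto)
qed

text \<open>
  Every point has a gradient and the gradient is differentiable; continuity of the Hessian is not
  part of the assumptions and is derived later for self-concordant functions.
\<close>

locale twice_differentiable =
  fixes U :: "'a::real_inner set" and f :: "'a \<Rightarrow> real" and g :: "'a \<Rightarrow> 'a"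
    and H :: "'a \<Rightarrow> 'a \<Rightarrow> 'a"
  assumes open_U: "open U" and convex_U: "convex U"
    and gradient: "z \<in> U \<Longrightarrow> (f has_derivative (\<lambda>h. g z \<bullet> h)) (at z)"
    and hessian: "z \<in> U \<Longrightarrow> (g has_derivative H z) (at z)"
begin

lemma H_linear: "z \<in> U \<Longrightarrow> linear (H z)"
  using hessian has_derivative_linear by blast

lemma line_derivative:
  assumes "z + t *\<^sub>R v \<in> U"
  shows "((\<lambda>t. f (z + t *\<^sub>R v)) has_real_derivative g (z + t *\<^sub>R v) \<bullet> v) (at t)"
proof -
  have "((\<lambda>t. z + t *\<^sub>R v) has_derivative (\<lambda>h. h *\<^sub>R v)) (at t)"
    by (auto intro!: derivative_eq_intros)
  from has_derivative_compose[OF this gradient[OF assms]]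
  show ?thesis
    by (simp add: has_field_derivative_def mult_commute_abs mult.commute)
qed

lemma gradient_line_derivative:
  assumes "z + t *\<^sub>R v \<in> U"
  shows "((\<lambda>t. g (z + t *\<^sub>R v) \<bullet> w) has_real_derivative H (z + t *\<^sub>R v) v \<bullet> w) (at t)"
proof -
  have "((\<lambda>t. z + t *\<^sub>R v) has_derivative (\<lambda>h. h *\<^sub>R v)) (at t)"
    by (auto intro!: derivative_eq_intros)
  from has_derivative_compose[OF this hessian[OF assms]]
  have "((\<lambda>t. g (z + t *\<^sub>R v)) has_derivative (\<lambda>h. H (z + t *\<^sub>R v) (h *\<^sub>R v))) (at t)" .
  from has_derivative_inner_left[OF this, of w]
  have "((\<lambda>t. g (z + t *\<^sub>R v) \<bullet> w) has_derivative (\<lambda>h. H (z + t *\<^sub>R v) (h *\<^sub>R v) \<bullet> w)) (at t)" .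
  then show ?thesis
    using H_linear[OF assms]
    by (simp add: has_field_derivative_def linear_scale mult_commute_abs mult.commute)
qed

lemma segment_in: "z \<in> U \<Longrightarrow> z + x \<in> U \<Longrightarrow> 0 \<le> \<tau> \<Longrightarrow> \<tau> \<le> 1 \<Longrightarrow> z + \<tau> *\<^sub>R x \<in> U"
  using convexD_alt[OF convex_U, of z "z + x" \<tau>] by (simp add: algebra_simps)

lemma eventually_in:
  assumes "z \<in> U"
  shows "\<forall>\<^sub>F \<sigma> in at_right (0::real). z + \<sigma> *\<^sub>R u \<in> U"
proof -
  have "((\<lambda>\<sigma>. z + \<sigma> *\<^sub>R u) \<longlongrightarrow> z + 0 *\<^sub>R u) (at_right 0)"
    by (intro tendsto_intros)
  then show ?thesis using topological_tendstoD[OF _ open_U] assms by simp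
qed

text \<open>
  One mean value step in the direction \<open>u\<close> turns the second difference into a difference of
  gradients at two points close to \<open>z\<close>, where differentiability of \<open>g\<close> at \<open>z\<close> applies.
\<close>

lemma second_difference:
  assumes z: "z \<in> U" and e: "0 < \<epsilon>"
  shows "\<forall>\<^sub>F \<sigma> in at_right (0::real).
    \<bar>f (z + \<sigma> *\<^sub>R u + \<sigma> *\<^sub>R v) - f (z + \<sigma> *\<^sub>R u) - f (z + \<sigma> *\<^sub>R v) + f z
      - \<sigma>\<^sup>2 * (H z v \<bullet> u)\<bar> \<le> \<epsilon> * \<sigma>\<^sup>2"
proof -
  define L where "L = norm u + norm v + 1"
  have L: "L > 0" "norm u \<le> L" "norm v \<le> L" "norm u + norm v \<le> L" by (auto simp: L_def add_nonneg_pos)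
  define \<eta> where "\<eta> = \<epsilon> / (2 * L * L)"
  have eta: "\<eta> > 0" using e L by (simp add: \<eta>_def)
  obtain d where d: "d > 0" and
    dd: "\<And>y. norm (y - z) < d \<Longrightarrow> norm (g y - g z - H z (y - z)) \<le> \<eta> * norm (y - z)"
    using hessian[OF z] eta unfolding has_derivative_at_alt by metis
  obtain r where r: "r > 0" "ball z r \<subseteq> U" using open_U z openE by blast
  have "\<forall>\<^sub>F \<sigma> in at_right (0::real). 0 < \<sigma> \<and> \<sigma> < min d r / L"
    using d r L unfolding eventually_at_right_field by (intro exI[of _ "min d r / L"]) auto
  then show ?thesis
  proof eventually_elim
    case (elim \<sigma>)
    then have s: "\<sigma> > 0" and sd: "\<sigma> * L < d" "\<sigma> * L < r" using L by (auto simp: field_simps)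
    have sm: "norm (\<tau> *\<^sub>R (\<sigma> *\<^sub>R u) + c *\<^sub>R (\<sigma> *\<^sub>R v)) \<le> \<sigma> * L"
      if "0 \<le> \<tau>" "\<tau> \<le> 1" "0 \<le> c" "c \<le> 1" for \<tau> c
    proof -
      have "norm (\<tau> *\<^sub>R (\<sigma> *\<^sub>R u) + c *\<^sub>R (\<sigma> *\<^sub>R v)) \<le> \<tau> * (\<sigma> * norm u) + c * (\<sigma> * norm v)"
        using norm_triangle_ineq[of "\<tau> *\<^sub>R (\<sigma> *\<^sub>R u)" "c *\<^sub>R (\<sigma> *\<^sub>R v)"] s that by simp
      also have "\<dots> \<le> 1 * (\<sigma> * norm u) + 1 * (\<sigma> * norm v)"
        using that s by (intro add_mono mult_right_mono) auto
      also have "\<dots> \<le> \<sigma> * L" using s L by (simp add: distrib_left[symmetric])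
      finally show ?thesis .
    qed
    have inU: "z + \<tau> *\<^sub>R (\<sigma> *\<^sub>R u) + c *\<^sub>R (\<sigma> *\<^sub>R v) \<in> U"
      if "0 \<le> \<tau>" "\<tau> \<le> 1" "0 \<le> c" "c \<le> 1" for \<tau> c
    proof -
      have "z + x \<in> U" if "norm x \<le> \<sigma> * L" for x
        using that sd by (intro subsetD[OF r(2)]) (simp add: dist_norm)
      from this[OF sm[OF that]] show ?thesis by (simp only: add.assoc)
    qed
    define k where "k \<tau> = f (z + \<sigma> *\<^sub>R v + \<tau> *\<^sub>R (\<sigma> *\<^sub>R u)) - f (z + \<tau> *\<^sub>R (\<sigma> *\<^sub>R u))" for \<tau>
    define k' where "k' \<tau> = g (z + \<sigma> *\<^sub>R v + \<tau> *\<^sub>R (\<sigma> *\<^sub>R u)) \<bullet> (\<sigma> *\<^sub>R u) - g (z + \<tau> *\<^sub>R (\<sigma> *\<^sub>R u)) \<bullet> (\<sigma> *\<^sub>R u)" for \<tau>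
    have "\<exists>\<theta>. 0 < \<theta> \<and> \<theta> < 1 \<and> k 1 - k 0 = (1 - 0) * k' \<theta>"
    proof (rule MVT2)
      fix \<tau> :: real assume t: "0 \<le> \<tau>" "\<tau> \<le> 1"
      have "z + \<sigma> *\<^sub>R v + \<tau> *\<^sub>R (\<sigma> *\<^sub>R u) \<in> U" using inU[of \<tau> 1] t by (simp add: add_ac)
      moreover have "z + \<tau> *\<^sub>R (\<sigma> *\<^sub>R u) \<in> U" using inU[of \<tau> 0] t by simp
      ultimately show "(k has_real_derivative k' \<tau>) (at \<tau>)"
        unfolding k_def k'_def by (intro DERIV_diff line_derivative)
    qed simp
    then obtain \<theta> where th: "0 < \<theta>" "\<theta> < 1" "k 1 - k 0 = k' \<theta>" by auto
    define y1 where "y1 = z + \<sigma> *\<^sub>R v + \<theta> *\<^sub>R (\<sigma> *\<^sub>R u)"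
    define y2 where "y2 = z + \<theta> *\<^sub>R (\<sigma> *\<^sub>R u)"
    have n1: "norm (y1 - z) \<le> \<sigma> * L" using sm[of \<theta> 1] th by (simp add: y1_def add_ac)
    have n2: "norm (y2 - z) \<le> \<sigma> * L" using sm[of \<theta> 0] th by (simp add: y2_def)
    have e1: "norm (g y1 - g z - H z (y1 - z)) \<le> \<eta> * (\<sigma> * L)"
      using dd[of y1] n1 sd eta by (meson le_less_trans mult_left_mono order_trans less_imp_le)
    have e2: "norm (g y2 - g z - H z (y2 - z)) \<le> \<eta> * (\<sigma> * L)"
      using dd[of y2] n2 sd eta by (meson le_less_trans mult_left_mono order_trans less_imp_le)
    have lin: "H z (y1 - z) - H z (y2 - z) = \<sigma> *\<^sub>R H z v"
      using H_linear[OF z] by (simp add: linear_diff[symmetric] y1_def y2_def linear_scale[symmetric])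
    have "k' \<theta> - \<sigma>\<^sup>2 * (H z v \<bullet> u)
        = ((g y1 - g z - H z (y1 - z)) - (g y2 - g z - H z (y2 - z))) \<bullet> (\<sigma> *\<^sub>R u)"
    proof -
      have "(g y1 - g z - H z (y1 - z)) - (g y2 - g z - H z (y2 - z)) = g y1 - g y2 - \<sigma> *\<^sub>R H z v"
        using lin by (simp add: algebra_simps)
      then have "((g y1 - g z - H z (y1 - z)) - (g y2 - g z - H z (y2 - z))) \<bullet> (\<sigma> *\<^sub>R u)
          = (g y1 - g y2 - \<sigma> *\<^sub>R H z v) \<bullet> (\<sigma> *\<^sub>R u)" by (simp only:)
      moreover have "k' \<theta> = (g y1 - g y2) \<bullet> (\<sigma> *\<^sub>R u)"
        by (simp only: k'_def y1_def y2_def inner_diff_left)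
      ultimately show ?thesis
        by (simp add: inner_diff_left power2_eq_square algebra_simps)
    qed
    also have "\<bar>\<dots>\<bar> \<le> norm ((g y1 - g z - H z (y1 - z)) - (g y2 - g z - H z (y2 - z))) * norm (\<sigma> *\<^sub>R u)"
      by (rule Cauchy_Schwarz_ineq2)
    also have "\<dots> \<le> (2 * (\<eta> * (\<sigma> * L))) * (\<sigma> * L)"
      using norm_triangle_ineq4[of "g y1 - g z - H z (y1 - z)" "g y2 - g z - H z (y2 - z)"] e1 e2 s L eta
      by (intro mult_mono) auto
    also have "\<dots> = \<epsilon> * \<sigma>\<^sup>2" using L by (simp add: \<eta>_def power2_eq_square)
    finally show ?case
      using th(3) by (simp add: k_def add_ac)
  qed
qed

text \<open>
  The second difference does not change when \<open>u\<close> and \<open>v\<close> are exchanged.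
\<close>

lemma hessian_symmetric:
  assumes z: "z \<in> U"
  shows "H z v \<bullet> u = H z u \<bullet> v"
proof (rule ccontr)
  assume ne: "H z v \<bullet> u \<noteq> H z u \<bullet> v"
  define \<epsilon> where "\<epsilon> = \<bar>H z v \<bullet> u - H z u \<bullet> v\<bar> / 3"
  have e: "\<epsilon> > 0" using ne by (simp add: \<epsilon>_def)
  have "\<forall>\<^sub>F \<sigma> in at_right (0::real). False"
    using second_difference[OF z e, of u v] second_difference[OF z e, of v u] eventually_at_right_less[of 0]
  proof eventually_elim
    case (elim \<sigma>)
    define D where "D = f (z + \<sigma> *\<^sub>R u + \<sigma> *\<^sub>R v) - f (z + \<sigma> *\<^sub>R u) - f (z + \<sigma> *\<^sub>R v) + f z"
    have "\<bar>D - \<sigma>\<^sup>2 * (H z v \<bullet> u)\<bar> \<le> \<epsilon> * \<sigma>\<^sup>2" using elim(1) by (simp add: D_def)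
    moreover have "\<bar>D - \<sigma>\<^sup>2 * (H z u \<bullet> v)\<bar> \<le> \<epsilon> * \<sigma>\<^sup>2" using elim(2) by (simp add: D_def algebra_simps)
    ultimately have "\<bar>\<sigma>\<^sup>2 * (H z v \<bullet> u) - \<sigma>\<^sup>2 * (H z u \<bullet> v)\<bar> \<le> 2 * \<epsilon> * \<sigma>\<^sup>2" by linarith
    moreover have "\<bar>\<sigma>\<^sup>2 * (H z v \<bullet> u) - \<sigma>\<^sup>2 * (H z u \<bullet> v)\<bar> = \<sigma>\<^sup>2 * (3 * \<epsilon>)"
      unfolding right_diff_distrib[symmetric] abs_mult by (simp add: \<epsilon>_def)
    ultimately have "\<sigma>\<^sup>2 * (3 * \<epsilon>) \<le> \<sigma>\<^sup>2 * (2 * \<epsilon>)"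
      by (simp only: mult_ac)
    then show ?case using elim(3) e by simp
  qed
  then show False by simp
qed

text \<open>
  The substitute for \<open>\<bar>D\<^sup>3f[u, v, w]\<bar> \<le> K\<close> that does not presuppose a third derivative.
\<close>

definition third_le :: "'a \<Rightarrow> 'a \<Rightarrow> 'a \<Rightarrow> real \<Rightarrow> bool" where
  "third_le u v w K \<longleftrightarrow>
     (\<forall>z s. z \<in> U \<and> z + s *\<^sub>R u \<in> U \<longrightarrow> \<bar>(H (z + s *\<^sub>R u) v - H z v) \<bullet> w\<bar> \<le> K * \<bar>s\<bar>)"

lemma third_leD:
  "third_le u v w K \<Longrightarrow> z \<in> U \<Longrightarrow> z + s *\<^sub>R u \<in> U \<Longrightarrow> \<bar>(H (z + s *\<^sub>R u) v - H z v) \<bullet> w\<bar> \<le> K * \<bar>s\<bar>"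
  by (auto simp: third_le_def)

text \<open>
  The difference of \<open>g \<bullet> w\<close> over the parallelogram spanned by \<open>s u\<close> and \<open>s v\<close> can be computed in two
  orders. The mean value theorem along \<open>v\<close> bounds it by the hypothesis, division along \<open>u\<close> gives the
  conclusion in the limit.
\<close>

lemma third_le_exchange:
  assumes T: "third_le u v w K"
  shows "third_le v u w K"
  unfolding third_le_def
proof (intro allI impI)
  fix z s assume zs: "z \<in> U \<and> z + s *\<^sub>R v \<in> U"
  define q where "q \<sigma> = ((g (z + s *\<^sub>R v + \<sigma> *\<^sub>R u) \<bullet> w - g (z + s *\<^sub>R v) \<bullet> w)
      - (g (z + \<sigma> *\<^sub>R u) \<bullet> w - g z \<bullet> w)) / \<sigma>" for \<sigma>
  have lim: "((\<lambda>\<sigma>. (g (y + \<sigma> *\<^sub>R u) \<bullet> w - g y \<bullet> w) / \<sigma>) \<longlongrightarrow> H y u \<bullet> w) (at_right 0)" if "y \<in> U" for y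
  proof -
    have "((\<lambda>t. g (y + t *\<^sub>R u) \<bullet> w) has_real_derivative H (y + 0 *\<^sub>R u) u \<bullet> w) (at 0)"
      by (rule gradient_line_derivative) (use that in simp)
    then have "((\<lambda>\<sigma>. (g (y + \<sigma> *\<^sub>R u) \<bullet> w - g y \<bullet> w) / \<sigma>) \<longlongrightarrow> H y u \<bullet> w) (at 0)"
      by (simp add: DERIV_def)
    then show ?thesis by (rule tendsto_mono[rotated]) (simp add: at_le)
  qed
  have "(q \<longlongrightarrow> H (z + s *\<^sub>R v) u \<bullet> w - H z u \<bullet> w) (at_right 0)"
    unfolding q_def diff_divide_distrib[of "_ - _" "_ - _"] using zs by (intro tendsto_diff lim) auto
  then have "((\<lambda>\<sigma>. \<bar>q \<sigma>\<bar>) \<longlongrightarrow> \<bar>(H (z + s *\<^sub>R v) u - H z u) \<bullet> w\<bar>) (at_right 0)"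
    using tendsto_rabs by (fastforce simp: inner_diff_left)
  moreover have "\<forall>\<^sub>F \<sigma> in at_right 0. \<bar>q \<sigma>\<bar> \<le> K * \<bar>s\<bar>"
    using eventually_in[OF conjunct1[OF zs], of u] eventually_in[OF conjunct2[OF zs], of u]
      eventually_at_right_less[of 0]
  proof eventually_elim
    case (elim \<sigma>)
    have zu: "z + \<sigma> *\<^sub>R u \<in> U" "z + s *\<^sub>R v + \<sigma> *\<^sub>R u \<in> U" "\<sigma> > 0" using elim zs by auto
    define k where "k \<tau> = g (z + \<sigma> *\<^sub>R u + \<tau> *\<^sub>R (s *\<^sub>R v)) \<bullet> w - g (z + \<tau> *\<^sub>R (s *\<^sub>R v)) \<bullet> w" for \<tau>
    define k' where "k' \<tau> = H (z + \<sigma> *\<^sub>R u + \<tau> *\<^sub>R (s *\<^sub>R v)) (s *\<^sub>R v) \<bullet> w - H (z + \<tau> *\<^sub>R (s *\<^sub>R v)) (s *\<^sub>R v) \<bullet> w" for \<tau>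
    have inU: "z + \<sigma> *\<^sub>R u + \<tau> *\<^sub>R (s *\<^sub>R v) \<in> U" "z + \<tau> *\<^sub>R (s *\<^sub>R v) \<in> U" if "0 \<le> \<tau>" "\<tau> \<le> 1" for \<tau>
      using segment_in[OF zu(1), of "s *\<^sub>R v" \<tau>] segment_in[of z "s *\<^sub>R v" \<tau>] zu zs that
      by (simp_all add: add_ac)
    have "\<exists>\<theta>. 0 < \<theta> \<and> \<theta> < 1 \<and> k 1 - k 0 = (1 - 0) * k' \<theta>"
    proof (rule MVT2)
      fix \<tau> :: real assume "0 \<le> \<tau>" "\<tau> \<le> 1"
      then show "(k has_real_derivative k' \<tau>) (at \<tau>)"
        unfolding k_def k'_def by (intro DERIV_diff gradient_line_derivative inU)
    qed simp
    then obtain \<theta> where th: "0 < \<theta>" "\<theta> < 1" "k 1 - k 0 = k' \<theta>" by auto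
    define y where "y = z + \<theta> *\<^sub>R (s *\<^sub>R v)"
    have y: "y \<in> U" "y + \<sigma> *\<^sub>R u \<in> U" using inU[of \<theta>] th by (auto simp: y_def add_ac)
    have "H y (s *\<^sub>R v) = s *\<^sub>R H y v" "H (y + \<sigma> *\<^sub>R u) (s *\<^sub>R v) = s *\<^sub>R H (y + \<sigma> *\<^sub>R u) v"
      using linear_scale[OF H_linear[OF y(1)]] linear_scale[OF H_linear[OF y(2)]] by auto
    moreover have "k' \<theta> = H (y + \<sigma> *\<^sub>R u) (s *\<^sub>R v) \<bullet> w - H y (s *\<^sub>R v) \<bullet> w"
      by (simp add: k'_def y_def add_ac)
    ultimately have "k' \<theta> = s * ((H (y + \<sigma> *\<^sub>R u) v - H y v) \<bullet> w)"
      by (simp add: inner_diff_left right_diff_distrib)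
    then have "\<bar>k 1 - k 0\<bar> = \<bar>s\<bar> * \<bar>(H (y + \<sigma> *\<^sub>R u) v - H y v) \<bullet> w\<bar>" using th(3) by (simp add: abs_mult)
    also have "\<dots> \<le> \<bar>s\<bar> * (K * \<sigma>)"
      using third_leD[OF T y] zu by (intro mult_left_mono) auto
    finally have "\<bar>k 1 - k 0\<bar> \<le> (K * \<bar>s\<bar>) * \<sigma>" by (simp add: mult_ac)
    moreover have "q \<sigma> = (k 1 - k 0) / \<sigma>" by (simp add: q_def k_def add_ac)
    ultimately show ?case using zu by (simp add: divide_le_eq abs_divide)
  qed
  ultimately show "\<bar>(H (z + s *\<^sub>R v) u - H z u) \<bullet> w\<bar> \<le> K * \<bar>s\<bar>"
    by (rule tendsto_upperbound) simp
qed

lemma third_le_sym23: "third_le u v w K \<Longrightarrow> third_le u w v K"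
  by (auto simp: third_le_def inner_diff_left hessian_symmetric)

text \<open>
  Swapping the two end points reverses the sign of the step.
\<close>

lemma third_le_positive_step:
  assumes "\<And>z s. z \<in> U \<Longrightarrow> z + s *\<^sub>R u \<in> U \<Longrightarrow> 0 < s \<Longrightarrow> \<bar>(H (z + s *\<^sub>R u) v - H z v) \<bullet> w\<bar> \<le> K * s"
  shows "third_le u v w K"
  unfolding third_le_def
proof (intro allI impI)
  fix z s assume zs: "z \<in> U \<and> z + s *\<^sub>R u \<in> U"
  consider "s > 0" | "s = 0" | "s < 0" by linarith
  then show "\<bar>(H (z + s *\<^sub>R u) v - H z v) \<bullet> w\<bar> \<le> K * \<bar>s\<bar>"
  proof cases
    case 3
    then show ?thesis using assms[of "z + s *\<^sub>R u" "-s"] zs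
      by (simp add: abs_minus_commute inner_diff_left)
  qed (use assms[of z s] zs in auto)
qed

text \<open>
  The second-order terms of the Taylor expansions at \<open>c\<close> cancel, and what remains is governed by the
  variation of \<open>H x \<bullet> x\<close> in the direction \<open>x\<close> alone.
\<close>

lemma centred_difference:
  assumes D: "third_le x x x K" and c: "c + x \<in> U" "c - x \<in> U"
  shows "\<bar>f (c + x) - f (c - x) - 2 * (g c \<bullet> x)\<bar> \<le> K / 3"
proof -
  have inU: "c + t *\<^sub>R x \<in> U" if "- 1 \<le> t" "t \<le> 1" for t
  proof -
    have "(c - x) + ((t + 1) / 2) *\<^sub>R (2 *\<^sub>R x) \<in> U"
    proof (rule segment_in)
      show "c - x + 2 *\<^sub>R x \<in> U" using c(1) by (simp add: scaleR_2)
    qed (use c that in auto)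
    also have "(c - x) + ((t + 1) / 2) *\<^sub>R (2 *\<^sub>R x) = c + t *\<^sub>R x"
    proof -
      have "(t + 1) / 2 * 2 = t + 1" by simp
      then show ?thesis by (simp only: scaleR_scaleR scaleR_left_distrib) simp
    qed
    finally show ?thesis .
  qed
  define h where "h t = f (c + t *\<^sub>R x) - f (c + t *\<^sub>R (- x)) - 2 * t * (g c \<bullet> x)" for t
  define h' where "h' t = g (c + t *\<^sub>R x) \<bullet> x - g (c + t *\<^sub>R (- x)) \<bullet> (- x) - 2 * (g c \<bullet> x)" for t
  define h'' where "h'' t = H (c + t *\<^sub>R x) x \<bullet> x - H (c + t *\<^sub>R (- x)) (- x) \<bullet> (- x)" for t
  have inU': "c + t *\<^sub>R x \<in> U" "c + t *\<^sub>R (- x) \<in> U" if "0 \<le> t" "t \<le> 1" for t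
    using inU[of t] inU[of "- t"] that by auto
  have d1: "(h has_real_derivative h' t) (at t)" if "0 \<le> t" "t \<le> 1" for t
    unfolding h_def h'_def
    by (intro DERIV_diff line_derivative inU' that) (auto intro!: derivative_eq_intros)
  have d2: "(h' has_real_derivative h'' t) (at t)" if "0 \<le> t" "t \<le> 1" for t
    unfolding h'_def h''_def
    using DERIV_diff[OF DERIV_diff[OF gradient_line_derivative[OF inU'(1)[OF that], of x]
        gradient_line_derivative[OF inU'(2)[OF that], of "- x"]] DERIV_const[of "2 * (g c \<bullet> x)"]]
    by simp
  have h2: "\<bar>h'' t\<bar> \<le> 2 * K * t" if t: "0 \<le> t" "t \<le> 1" for t
  proof -
    have "H (c + t *\<^sub>R (- x)) (- x) = - H (c + t *\<^sub>R (- x)) x"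
      using linear_neg[OF H_linear[OF inU'(2)[OF t]]] by simp
    moreover have "c - t *\<^sub>R x + (2 * t) *\<^sub>R x = c + t *\<^sub>R x"
      by (metis (no_types, lifting) add.assoc add_diff_cancel_right' diff_add_cancel mult_2 scaleR_left_distrib)
    ultimately have "h'' t = (H ((c - t *\<^sub>R x) + (2 * t) *\<^sub>R x) x - H (c - t *\<^sub>R x) x) \<bullet> x"
      by (simp only: h''_def inner_diff_left scaleR_minus_right inner_minus_left inner_minus_right
          minus_minus diff_conv_add_uminus[symmetric])
    also have "\<bar>\<dots>\<bar> \<le> K * \<bar>2 * t\<bar>"
    proof (rule third_leD[OF D])
      show "c - t *\<^sub>R x \<in> U" using inU'(2)[OF t] by simp
      show "c - t *\<^sub>R x + (2 * t) *\<^sub>R x \<in> U"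
        unfolding \<open>c - t *\<^sub>R x + (2 * t) *\<^sub>R x = c + t *\<^sub>R x\<close> by (rule inU'(1)[OF t])
    qed
    finally show ?thesis using t by simp
  qed
  have k: "((\<lambda>t. c * K * t ^ 3 / 3) has_real_derivative c * K * t\<^sup>2) (at t)"
    "((\<lambda>t. c * K * t\<^sup>2) has_real_derivative c * (2 * K * t)) (at t)" for c t :: real
    by (auto intro!: derivative_eq_intros)
  have "h 1 \<le> 1 * K * 1 ^ 3 / 3"
    by (rule second_order_comparison[OF _ _ _ d1 d2 k]) (use h2 in \<open>force simp: h_def h'_def\<close>)+
  moreover have "-1 * K * 1 ^ 3 / 3 \<le> h 1"
    by (rule second_order_comparison[OF _ _ _ k d1 d2]) (use h2 in \<open>force simp: h_def h'_def abs_le_iff\<close>)+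
  ultimately have "\<bar>h 1\<bar> \<le> K / 3" by simp
  moreover have "h 1 = f (c + x) - f (c - x) - 2 * (g c \<bullet> x)" by (simp add: h_def)
  ultimately show ?thesis by (simp only:)
qed

text \<open>
  Finiteness of the mixed bound. Moving the centre of a second difference in direction \<open>v\<close> by
  \<open>2 \<sigma> u\<close> changes it by a combination of centred differences along \<open>u + v\<close>, \<open>u - v\<close> and \<open>u\<close> in
  which the gradients cancel, hence by \<open>O(\<sigma>\<^sup>3)\<close>. Cutting a fixed displacement \<open>s u\<close> into steps of
  length \<open>2 \<sigma>\<close> gives \<open>O(s \<sigma>\<^sup>2)\<close>, and division by \<open>\<sigma>\<^sup>2\<close> leaves the Hessian. The constant is not
  sharp, it only has to be finite.
\<close>

lemma third_le_crude_square:
  fixes n :: "'a \<Rightarrow> real"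
  assumes n: "\<And>x. 0 \<le> n x" "\<And>x y. n (x + y) \<le> n x + n y" "\<And>c x. n (c *\<^sub>R x) = \<bar>c\<bar> * n x"
    and M: "0 \<le> M" and D: "\<And>x. third_le x x x (M * n x ^ 3)"
    and uv: "n u \<le> 1" "n v \<le> 1"
  shows "third_le u v v (3 * M)"
proof (rule third_le_positive_step)
  fix z s assume z: "z \<in> U" "z + s *\<^sub>R u \<in> U" and s: "0 < (s::real)"
  define z' where "z' = z + s *\<^sub>R u"
  have main: "\<bar>(H z' v - H z v) \<bullet> v\<bar> \<le> 3 * M * s + 2 * \<epsilon>" if e: "\<epsilon> > 0" for \<epsilon>
  proof -
    have zin: "z \<in> U" "z' \<in> U" using z by (auto simp: z'_def)
    define Q where "Q y \<sigma> = f (y + \<sigma> *\<^sub>R v) + f (y - \<sigma> *\<^sub>R v) - 2 * f y" for y \<sigma>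
    define OK where "OK y \<sigma> \<longleftrightarrow> \<bar>Q y \<sigma> - \<sigma>\<^sup>2 * (H y v \<bullet> v)\<bar> \<le> \<epsilon> * \<sigma>\<^sup>2 \<and> y + \<sigma> *\<^sub>R v \<in> U \<and> y + \<sigma> *\<^sub>R (- v) \<in> U" for y \<sigma>
    have ok: "\<forall>\<^sub>F \<sigma> in at_right 0. OK y \<sigma>" if y: "y \<in> U" for y
      using second_difference[OF y e, of "- v" v] eventually_in[OF y, of v] eventually_in[OF y, of "- v"]
    proof eventually_elim
      case (elim \<sigma>)
      have "\<bar>Q y \<sigma> - \<sigma>\<^sup>2 * (H y v \<bullet> v)\<bar>
        = \<bar>f (y + \<sigma> *\<^sub>R (- v) + \<sigma> *\<^sub>R v) - f (y + \<sigma> *\<^sub>R (- v)) - f (y + \<sigma> *\<^sub>R v) + f y - \<sigma>\<^sup>2 * (H y v \<bullet> (- v))\<bar>"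
        by (simp add: Q_def abs_minus_commute algebra_simps)
      then show ?case using elim by (simp add: OK_def)
    qed
    have "\<forall>\<^sub>F \<sigma> in at_right 0. OK z \<sigma> \<and> OK z' \<sigma>"
      using ok[OF zin(1)] ok[OF zin(2)] by (rule eventually_conj)
    then obtain r where r: "r > 0" "\<And>\<sigma>. 0 < \<sigma> \<Longrightarrow> \<sigma> < r \<Longrightarrow> OK z \<sigma> \<and> OK z' \<sigma>"
      unfolding eventually_at_right_field by auto
    \<comment> \<open>the number of steps, so large that the step size \<open>\<sigma>\<close> is admissible at both ends\<close>
    obtain m :: nat where m: "real m > s / r" using reals_Archimedean2 by blast
    then have m0: "m > 0" using s r by (metis divide_pos_pos gr0I less_trans of_nat_0 less_irrefl)
    define \<sigma> where "\<sigma> = s / (2 * real m)"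
    have sg: "0 < \<sigma>" "2 * real m * \<sigma> = s" using s m0 by (auto simp: \<sigma>_def)
    have "\<sigma> < r"
    proof -
      have "s < r * real m" using m r by (simp add: field_simps)
      moreover have "0 \<le> r * real m" using r by simp
      ultimately show ?thesis using m0 unfolding \<sigma>_def by (simp add: field_simps)
    qed
    then have okz: "OK z \<sigma>" "OK z' \<sigma>" using r(2) sg by auto
    have inU: "z + c *\<^sub>R (\<sigma> *\<^sub>R v) + \<tau> *\<^sub>R (s *\<^sub>R u) \<in> U"
      if "c = 1 \<or> c = 0 \<or> c = -1" "0 \<le> \<tau>" "\<tau> \<le> 1" for c \<tau>
    proof (rule segment_in)
      show "z + c *\<^sub>R (\<sigma> *\<^sub>R v) \<in> U" using okz(1) zin that(1) by (auto simp: OK_def)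
      have "z' + c *\<^sub>R (\<sigma> *\<^sub>R v) \<in> U" using okz(2) zin that(1) by (auto simp: OK_def)
      then show "z + c *\<^sub>R (\<sigma> *\<^sub>R v) + s *\<^sub>R u \<in> U" by (simp add: z'_def add_ac)
    qed (use that in auto)
    define y where "y j = z + (2 * real j * \<sigma>) *\<^sub>R u" for j :: nat
    have step: "\<bar>Q (y (Suc j)) \<sigma> - Q (y j) \<sigma>\<bar> \<le> 6 * M * \<sigma> ^ 3" if j: "j < m" for j
    proof -
      define c where "c = z + ((2 * real j + 1) * \<sigma>) *\<^sub>R u"
      have yc: "y (Suc j) = c + \<sigma> *\<^sub>R u" "y j = c - \<sigma> *\<^sub>R u"
      proof -
        have "2 * real (Suc j) * \<sigma> = (2 * real j + 1) * \<sigma> + \<sigma>" by (simp add: algebra_simps)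
        then show "y (Suc j) = c + \<sigma> *\<^sub>R u" by (simp only: y_def c_def scaleR_left_distrib add.assoc)
        have "2 * real j * \<sigma> = (2 * real j + 1) * \<sigma> - \<sigma>" by (simp add: algebra_simps)
        then show "y j = c - \<sigma> *\<^sub>R u" by (simp only: y_def c_def scaleR_left_diff_distrib add_diff_eq)
      qed
      have in2: "y i + (k * \<sigma>) *\<^sub>R v \<in> U" if "i \<le> m" "k = 1 \<or> k = 0 \<or> k = -1" for i k
      proof -
        have "real i / real m \<le> 1" using that m0 by simp
        then have "z + k *\<^sub>R (\<sigma> *\<^sub>R v) + (real i / real m) *\<^sub>R (s *\<^sub>R u) \<in> U"
          using that by (intro inU) auto
        also have "z + k *\<^sub>R (\<sigma> *\<^sub>R v) + (real i / real m) *\<^sub>R (s *\<^sub>R u) = y i + (k * \<sigma>) *\<^sub>R v"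
          using m0 sg(2)[symmetric] by (simp add: y_def add_ac mult_ac)
        finally show ?thesis .
      qed
      have R: "\<bar>f (c + \<sigma> *\<^sub>R x) - f (c - \<sigma> *\<^sub>R x) - 2 * (g c \<bullet> (\<sigma> *\<^sub>R x))\<bar> \<le> M * (l * \<sigma>) ^ 3 / 3"
        if "c + \<sigma> *\<^sub>R x \<in> U" "c - \<sigma> *\<^sub>R x \<in> U" "n x \<le> l" for x l
      proof -
        have "\<bar>f (c + \<sigma> *\<^sub>R x) - f (c - \<sigma> *\<^sub>R x) - 2 * (g c \<bullet> (\<sigma> *\<^sub>R x))\<bar> \<le> M * n (\<sigma> *\<^sub>R x) ^ 3 / 3"
          by (rule centred_difference[OF D that(1,2)])
        also have "\<dots> \<le> M * (l * \<sigma>) ^ 3 / 3"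
          using that(3) n sg M by (intro divide_right_mono mult_left_mono power_mono) (auto simp: mult.commute)
        finally show ?thesis .
      qed
      have nminus: "n (- v) = n v" using n(3)[of "-1" v] by simp
      have c1: "c + \<sigma> *\<^sub>R (u + v) \<in> U" "c - \<sigma> *\<^sub>R (u + v) \<in> U"
        using in2[of "Suc j" 1] in2[of j "-1"] j by (auto simp: yc algebra_simps)
      have c2: "c + \<sigma> *\<^sub>R (u - v) \<in> U" "c - \<sigma> *\<^sub>R (u - v) \<in> U"
        using in2[of "Suc j" "-1"] in2[of j 1] j by (auto simp: yc algebra_simps)
      have c3: "c + \<sigma> *\<^sub>R u \<in> U" "c - \<sigma> *\<^sub>R u \<in> U"
        using in2[of "Suc j" 0] in2[of j 0] j by (auto simp: yc)
      have l1: "n (u + v) \<le> 2" using n(2)[of u v] uv by simp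
      have l2: "n (u - v) \<le> 2" using n(2)[of u "- v"] uv nminus by simp
      define r1 where "r1 = f (c + \<sigma> *\<^sub>R (u + v)) - f (c - \<sigma> *\<^sub>R (u + v)) - 2 * (g c \<bullet> (\<sigma> *\<^sub>R (u + v)))"
      define r2 where "r2 = f (c + \<sigma> *\<^sub>R (u - v)) - f (c - \<sigma> *\<^sub>R (u - v)) - 2 * (g c \<bullet> (\<sigma> *\<^sub>R (u - v)))"
      define r3 where "r3 = f (c + \<sigma> *\<^sub>R u) - f (c - \<sigma> *\<^sub>R u) - 2 * (g c \<bullet> (\<sigma> *\<^sub>R u))"
      have "Q (y (Suc j)) \<sigma> - Q (y j) \<sigma> = r1 + r2 - 2 * r3"
        by (simp add: Q_def r1_def r2_def r3_def yc inner_add_right inner_diff_right algebra_simps)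
      moreover have "\<bar>r1\<bar> \<le> M * (2 * \<sigma>) ^ 3 / 3" unfolding r1_def by (rule R[OF c1 l1])
      moreover have "\<bar>r2\<bar> \<le> M * (2 * \<sigma>) ^ 3 / 3" unfolding r2_def by (rule R[OF c2 l2])
      moreover have "\<bar>r3\<bar> \<le> M * (1 * \<sigma>) ^ 3 / 3" unfolding r3_def by (rule R[OF c3 uv(1)])
      ultimately have "\<bar>Q (y (Suc j)) \<sigma> - Q (y j) \<sigma>\<bar>
          \<le> M * (2 * \<sigma>) ^ 3 / 3 + M * (2 * \<sigma>) ^ 3 / 3 + 2 * (M * (1 * \<sigma>) ^ 3 / 3)" by linarith
      then show ?thesis by (simp add: power_mult_distrib)
    qed
    have "\<bar>Q (y j) \<sigma> - Q (y 0) \<sigma>\<bar> \<le> real j * (6 * M * \<sigma> ^ 3)" if "j \<le> m" for j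
      using that
    proof (induction j)
      case (Suc j)
      then show ?case using step[of j] by (simp add: distrib_right)
    qed simp
    from this[of m] have "\<bar>Q (y m) \<sigma> - Q (y 0) \<sigma>\<bar> \<le> real m * (6 * M * \<sigma> ^ 3)" by simp
    also have "\<dots> = 3 * M * (2 * real m * \<sigma>) * \<sigma>\<^sup>2" by (simp add: power3_eq_cube power2_eq_square)
    also have "\<dots> = 3 * M * s * \<sigma>\<^sup>2" by (simp only: sg)
    finally have "\<bar>Q (y m) \<sigma> - Q (y 0) \<sigma>\<bar> \<le> 3 * M * s * \<sigma>\<^sup>2" .
    moreover have "y m = z'" "y 0 = z" using sg by (auto simp: y_def z'_def)
    ultimately have "\<bar>Q z' \<sigma> - Q z \<sigma>\<bar> \<le> 3 * M * s * \<sigma>\<^sup>2" by simp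
    moreover have "\<bar>Q z' \<sigma> - \<sigma>\<^sup>2 * (H z' v \<bullet> v)\<bar> \<le> \<epsilon> * \<sigma>\<^sup>2" "\<bar>Q z \<sigma> - \<sigma>\<^sup>2 * (H z v \<bullet> v)\<bar> \<le> \<epsilon> * \<sigma>\<^sup>2"
      using okz by (auto simp: OK_def)
    ultimately have "\<bar>\<sigma>\<^sup>2 * (H z' v \<bullet> v) - \<sigma>\<^sup>2 * (H z v \<bullet> v)\<bar> \<le> 3 * M * s * \<sigma>\<^sup>2 + 2 * (\<epsilon> * \<sigma>\<^sup>2)"
      by linarith
    then have "\<sigma>\<^sup>2 * \<bar>(H z' v - H z v) \<bullet> v\<bar> \<le> \<sigma>\<^sup>2 * (3 * M * s + 2 * \<epsilon>)"
      unfolding right_diff_distrib[symmetric] abs_mult by (simp add: inner_diff_left algebra_simps)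
    then show ?thesis using sg by simp
  qed
  have "\<bar>(H z' v - H z v) \<bullet> v\<bar> \<le> 3 * M * s"
    by (rule field_le_epsilon) (use main[of "_ / 2"] in auto)
  then show "\<bar>(H (z + s *\<^sub>R u) v - H z v) \<bullet> v\<bar> \<le> 3 * M * s" by (simp add: z'_def)
qed

lemma third_le_mono: "third_le u v w K \<Longrightarrow> K \<le> K' \<Longrightarrow> third_le u v w K'"
  unfolding third_le_def by (meson abs_ge_zero mult_right_mono order_trans)

lemma third_le_scale: "third_le u v w K \<Longrightarrow> third_le u v (c *\<^sub>R w) (\<bar>c\<bar> * K)"
  by (auto simp: third_le_def abs_mult mult.assoc intro!: mult_left_mono)

lemma third_le_add: "third_le u v w K \<Longrightarrow> third_le u v w' K' \<Longrightarrow> third_le u v (w + w') (K + K')"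
  unfolding third_le_def inner_add_right distrib_right
  by (meson abs_triangle_ineq add_mono order_trans)

lemma third_le_polarise:
  assumes "third_le u (v + w) (v + w) K" "third_le u (v - w) (v - w) K'"
  shows "third_le u v w ((K + K') / 4)"
  unfolding third_le_def
proof (intro allI impI)
  fix z s assume zs: "z \<in> U \<and> z + s *\<^sub>R u \<in> U"
  then have lin: "linear (H z)" "linear (H (z + s *\<^sub>R u))" using H_linear by auto
  define D where "D x y = (H (z + s *\<^sub>R u) x - H z x) \<bullet> y" for x y
  have "D (v + w) (v + w) - D (v - w) (v - w) = 4 * D v w"
    using lin zs hessian_symmetric[of z v w] hessian_symmetric[of "z + s *\<^sub>R u" v w]
    by (simp add: D_def linear_add linear_diff inner_add_left inner_add_right inner_diff_left inner_diff_right)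
  moreover have "\<bar>D (v + w) (v + w)\<bar> \<le> K * \<bar>s\<bar>" "\<bar>D (v - w) (v - w)\<bar> \<le> K' * \<bar>s\<bar>"
    using assms zs by (auto simp: D_def intro: third_leD)
  ultimately have "\<bar>D v w\<bar> \<le> (K + K') / 4 * \<bar>s\<bar>" by (simp add: field_simps)
  then show "\<bar>(H (z + s *\<^sub>R u) v - H z v) \<bullet> w\<bar> \<le> (K + K') / 4 * \<bar>s\<bar>" by (simp add: D_def)
qed

lemma third_le_closed:
  assumes "\<And>K'. K < K' \<Longrightarrow> third_le u v w K'"
  shows "third_le u v w K"
  unfolding third_le_def
proof (intro allI impI)
  fix z s assume zs: "z \<in> U \<and> z + s *\<^sub>R u \<in> U"
  have "\<bar>(H (z + s *\<^sub>R u) v - H z v) \<bullet> w\<bar> \<le> K * \<bar>s\<bar> + e" if "e > 0" for e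
  proof -
    have "\<bar>(H (z + s *\<^sub>R u) v - H z v) \<bullet> w\<bar> \<le> (K + e / (\<bar>s\<bar> + 1)) * \<bar>s\<bar>"
      using zs that by (intro third_leD assms) auto
    also have "\<dots> = K * \<bar>s\<bar> + e * (\<bar>s\<bar> / (\<bar>s\<bar> + 1))" by (simp add: algebra_simps)
    also have "\<dots> \<le> K * \<bar>s\<bar> + e * 1" using that by (intro add_left_mono mult_left_mono) auto
    finally show ?thesis by simp
  qed
  then show "\<bar>(H (z + s *\<^sub>R u) v - H z v) \<bullet> w\<bar> \<le> K * \<bar>s\<bar>" by (rule field_le_epsilon)
qed

text \<open>
  The sharp bound: the relation \<open>third_le\<close> satisfies the axioms of a trilinear gauge.
\<close>

theorem third_le_from_diagonal:
  assumes b: "inner_form b" and M: "0 \<le> M"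
    and D: "\<And>x. third_le x x x (M * form_norm b x ^ 3)"
  shows "third_le u v w (M * form_norm b u * form_norm b v * form_norm b w)"
proof -
  interpret inner_form b by (rule b)
  have crude: "third_le u v w (6 * M * nrm u * nrm v * nrm w)" for u v w
  proof -
    obtain u' v' w' where u: "nrm u' \<le> 1" "u = nrm u *\<^sub>R u'" and v: "nrm v' \<le> 1" "v = nrm v *\<^sub>R v'"
      and w: "nrm w' \<le> 1" "w = nrm w *\<^sub>R w'"
      using unit_exists by metis
    have sq: "third_le u' x x (12 * M)" if "nrm x \<le> 2" for x
    proof -
      have "third_le u' ((1/2) *\<^sub>R x) ((1/2) *\<^sub>R x) (3 * M)"
        by (rule third_le_crude_square[of nrm])
          (use M D u that in \<open>auto simp: nrm_triangle nrm_scale\<close>)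
      from third_le_scale[OF third_le_sym23[OF third_le_scale[OF this, of 2]], of 2]
      show ?thesis by simp
    qed
    have "third_le u' v' w' ((12 * M + 12 * M) / 4)"
      using nrm_triangle[of v' w'] nrm_triangle_diff[of v' w'] v w
      by (intro third_le_polarise sq) linarith+
    then have "third_le u' v' w' (6 * M)" by simp
    from third_le_scale[OF this, of "nrm w"] have "third_le u' v' w (nrm w * (6 * M))"
      by (simp add: w(2)[symmetric])
    from third_le_scale[OF third_le_sym23[OF this], of "nrm v"]
    have "third_le u' w v (nrm v * (nrm w * (6 * M)))" by (simp add: v(2)[symmetric])
    from third_le_scale[OF third_le_sym23[OF third_le_exchange[OF this]], of "nrm u"]
    have "third_le w v u (nrm u * (nrm v * (nrm w * (6 * M))))" by (simp add: u(2)[symmetric])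
    then have "third_le u v w (nrm u * (nrm v * (nrm w * (6 * M))))"
      by (rule third_le_exchange[OF third_le_sym23[OF third_le_exchange]])
    then show ?thesis by (simp add: mult_ac)
  qed
  interpret trilinear_gauge b third_le M "6 * M"
  proof
    fix u v w w' K K' c
    show "third_le u v w K \<Longrightarrow> third_le v u w K" by (rule third_le_exchange)
    show "third_le u v w K \<Longrightarrow> third_le u w v K" by (rule third_le_sym23)
    show "third_le u v w K \<Longrightarrow> third_le u v w' K' \<Longrightarrow> third_le u v (w + w') (K + K')"
      by (rule third_le_add)
    show "third_le u v w K \<Longrightarrow> third_le u v (c *\<^sub>R w) (\<bar>c\<bar> * K)" by (rule third_le_scale)
    show "third_le u (v + w) (v + w) K \<Longrightarrow> third_le u (v - w) (v - w) K' \<Longrightarrow> third_le u v w ((K + K') / 4)"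
      by (rule third_le_polarise)
    show "third_le u v w K \<Longrightarrow> K \<le> K' \<Longrightarrow> third_le u v w K'" by (rule third_le_mono)
    show "(\<And>K'. K < K' \<Longrightarrow> third_le u v w K') \<Longrightarrow> third_le u v w K" by (rule third_le_closed)
    show "third_le u u u (M * nrm u ^ 3)" by (rule D)
    show "third_le u v w (6 * M * nrm u * nrm v * nrm w)" by (rule crude)
    show "0 \<le> M" "0 \<le> 6 * M" using M by auto
  qed
  show ?thesis by (rule diagonal_bound_suffices)
qed

end

section \<open>Self-concordant functions along lines\<close>

text \<open>
  A function whose upper right derivative is nowhere positive. The last point at which
  \<open>f t \<le> f a + \<epsilon> (t - a)\<close> holds cannot lie before \<open>b\<close>.
\<close>

lemma nonincreasing_from_right_increments:
  fixes f :: "real \<Rightarrow> real"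
  assumes ab: "a \<le> b" and cont: "continuous_on {a..b} f"
    and inc: "\<And>t \<epsilon>. a \<le> t \<Longrightarrow> t < b \<Longrightarrow> 0 < \<epsilon> \<Longrightarrow> \<forall>\<^sub>F s in at_right t. f s \<le> f t + \<epsilon> * (s - t)"
  shows "f b \<le> f a"
proof -
  have "f b \<le> f a + \<epsilon> * (b - a)" if e: "\<epsilon> > 0" for \<epsilon>
  proof -
    define S where "S = {t \<in> {a..b}. f t - \<epsilon> * (t - a) \<le> f a}"
    have "S = {a..b} \<inter> (\<lambda>t. f t - \<epsilon> * (t - a)) -` {..f a}" by (auto simp: S_def)
    moreover have "closed ({a..b} \<inter> (\<lambda>t. f t - \<epsilon> * (t - a)) -` {..f a})"
      by (intro continuous_closed_preimage continuous_intros cont)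
    ultimately have "closed S" by simp
    moreover have "S \<subseteq> {a..b}" by (auto simp: S_def)
    ultimately have "compact S" by (meson bounded_closed_interval bounded_subset compact_eq_bounded_closed)
    moreover have "a \<in> S" using ab by (auto simp: S_def)
    ultimately obtain c where c: "c \<in> S" "\<And>t. t \<in> S \<Longrightarrow> t \<le> c"
      using compact_attains_sup[of S] by auto
    have "c = b"
    proof (rule ccontr)
      assume "c \<noteq> b"
      then have cb: "a \<le> c" "c < b" using c(1) by (auto simp: S_def)
      have "\<forall>\<^sub>F s in at_right c. s < b" using cb(2) unfolding eventually_at_right_field by auto
      then have "\<forall>\<^sub>F s in at_right c. f s \<le> f c + \<epsilon> * (s - c) \<and> c < s \<and> s < b"
        using inc[OF cb e] eventually_at_right_less[of c] by eventually_elim auto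
      then obtain s where s: "f s \<le> f c + \<epsilon> * (s - c)" "c < s" "s < b"
        using eventually_happens'[OF trivial_limit_at_right_real] by blast
      then have "s \<in> S" using c(1) cb by (auto simp: S_def algebra_simps)
      then show False using c(2) s by force
    qed
    then show ?thesis using c(1) by (auto simp: S_def)
  qed
  note * = this
  have "f b \<le> f a + e" if "e > 0" for e
  proof -
    have "e * ((b - a) / (b - a + 1)) \<le> e * 1" using ab that by (intro mult_left_mono) auto
    then show ?thesis using *[of "e / (b - a + 1)"] that ab by simp
  qed
  then show ?thesis by (rule field_le_epsilon)
qed

lemma square_powr_three_halves: "(x\<^sup>2) powr (3/2) = x ^ 3" if "0 \<le> (x::real)"
proof (cases "x = 0")
  case False
  then have "x powr 2 = x\<^sup>2" "x powr 3 = x ^ 3" using that by (simp_all add: powr_numeral)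
  then show ?thesis using powr_powr[of x 2 "3/2"] by simp
qed simp

locale barrier =
  fixes Z :: "(real^'p) set" and F :: "real^'p \<Rightarrow> real" and \<nu> :: real
  assumes convex_Z: "convex Z" and self_concordant_barrier: "self_concordant_barrier Z F \<nu>"
begin

abbreviation U where "U \<equiv> interior Z"
abbreviation G where "G \<equiv> grad F"
abbreviation H where "H z v \<equiv> hess F z *v v"
abbreviation N where "N \<equiv> local_norm F"

lemma
  shows self_concordant: "self_concordant_on U F"
    and differentiable: "z \<in> U \<Longrightarrow> F differentiable (at z)" "z \<in> U \<Longrightarrow> G differentiable (at z)"
    and hess_positive: "z \<in> U \<Longrightarrow> u \<noteq> 0 \<Longrightarrow> 0 < H z u \<bullet> u"
    and barrier_parameter: "z \<in> U \<Longrightarrow> 2 * (G z \<bullet> u) - (N z u)\<^sup>2 \<le> \<nu>"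
    and boundary: "x \<in> frontier Z \<Longrightarrow> filterlim F at_top (at x within U)"
    and parameter_pos: "0 < \<nu>"
  using self_concordant_barrier unfolding self_concordant_barrier_def by blast+

lemma gradient:
  assumes "z \<in> U"
  shows "(F has_derivative (\<lambda>h. G z \<bullet> h)) (at z)"
proof -
  obtain F' where F': "(F has_derivative F') (at z)"
    using differentiable(1)[OF assms] by (auto simp: differentiable_def)
  have "F' = (\<lambda>h. h \<bullet> adjoint F' 1)"
    using adjoint_works[OF has_derivative_linear[OF F'], of _ 1] by auto
  then have ex: "GDERIV F z :> adjoint F' 1"
    using F' by (simp add: gderiv_def)
  have "GDERIV F z :> G z"
    unfolding grad_def
  proof (rule theI[of _ "adjoint F' 1"])
    fix D assume "GDERIV F z :> D"
    then have "(\<lambda>h. h \<bullet> D) = (\<lambda>h. h \<bullet> adjoint F' 1)"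
      using ex unfolding gderiv_def by (rule has_derivative_unique)
    then have "h \<bullet> D = h \<bullet> adjoint F' 1" for h by (rule fun_cong)
    then have "\<forall>h. h \<bullet> D = h \<bullet> adjoint F' 1" by (rule allI)
    then show "D = adjoint F' 1" unfolding vector_eq_ldot .
  qed (rule ex)
  then show ?thesis by (simp add: gderiv_def inner_commute)
qed

sublocale twice_differentiable U F G "\<lambda>z v. hess F z *v v"
proof
  show "open U" "convex U" using convex_Z by auto
  show "(F has_derivative (\<lambda>h. G z \<bullet> h)) (at z)" if "z \<in> U" for z
    using that by (rule gradient)
  show "(G has_derivative (*v) (hess F z)) (at z)" if "z \<in> U" for z
    using differentiable(2)[OF that] unfolding hess_def jacobian_works .
qed

lemma inner_form_hess:
  assumes "z \<in> U"
  shows "inner_form (\<lambda>u v. H z u \<bullet> v)"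
proof
  show "0 < H z x \<bullet> x" if "x \<noteq> 0" for x by (rule hess_positive[OF assms that])
  show "H z x \<bullet> y = H z y \<bullet> x" for x y by (rule hessian_symmetric[OF assms])
qed (simp_all add: matrix_vector_right_distrib inner_add_left matrix_vector_mult_scaleR)

text \<open>
  Makes the facts about \<open>inner_form\<close> available for the local norm.
\<close>

lemma nrm_hess: "form_norm (\<lambda>u v. H z u \<bullet> v) = N z"
  by (auto simp: form_norm_def local_norm_def)

lemmas N_nonneg = inner_form.nrm_nonneg[OF inner_form_hess, unfolded nrm_hess]
  and N_sq = inner_form.nrm_sq[OF inner_form_hess, unfolded nrm_hess]
  and N_zero = inner_form.nrm_zero[OF inner_form_hess, unfolded nrm_hess]
  and N_pos = inner_form.nrm_pos[OF inner_form_hess, unfolded nrm_hess]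
  and N_scale = inner_form.nrm_scale[OF inner_form_hess, unfolded nrm_hess]
  and N_minus = inner_form.nrm_minus[OF inner_form_hess, unfolded nrm_hess]
  and N_minus_commute = inner_form.nrm_minus_commute[OF inner_form_hess, unfolded nrm_hess]
  and N_triangle = inner_form.nrm_triangle[OF inner_form_hess, unfolded nrm_hess]
  and N_triangle_diff = inner_form.nrm_triangle_diff[OF inner_form_hess, unfolded nrm_hess]
  and N_Cauchy_Schwarz = inner_form.Cauchy_Schwarz_form[OF inner_form_hess, unfolded nrm_hess]
  and N_form_bound = inner_form.symmetric_form_bound[OF inner_form_hess, unfolded nrm_hess]

text \<open>
  The derivatives that occur in the definition of self-concordance are identified with those of
  \<open>F\<close> by uniqueness of derivatives.
\<close>

lemma third_derivative_on_lines:
  assumes z: "z \<in> U"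
  obtains \<phi>3 where
    "\<And>\<tau>. z + \<tau> *\<^sub>R v \<in> U \<Longrightarrow> ((\<lambda>\<tau>. H (z + \<tau> *\<^sub>R v) v \<bullet> v) has_real_derivative \<phi>3 \<tau>) (at \<tau>)"
    "\<And>\<tau>. z + \<tau> *\<^sub>R v \<in> U \<Longrightarrow> \<bar>\<phi>3 \<tau>\<bar> \<le> 2 * N (z + \<tau> *\<^sub>R v) v ^ 3"
proof -
  define I where "I = {\<tau>. z + \<tau> *\<^sub>R v \<in> U}"
  have "open ((\<lambda>\<tau>. z + \<tau> *\<^sub>R v) -` U)"
    by (rule open_vimage[OF open_U]) (intro continuous_intros)
  moreover have "I = (\<lambda>\<tau>. z + \<tau> *\<^sub>R v) -` U" by (auto simp: I_def)
  ultimately have I: "open I" by simp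
  note sc = self_concordant[unfolded self_concordant_on_def Let_def, rule_format, OF z, of v, THEN conjunct2]
  obtain \<phi>1 \<phi>2 \<phi>3 where
    d: "\<forall>\<tau>\<in>I. ((\<lambda>\<tau>. F (z + \<tau> *\<^sub>R v)) has_real_derivative \<phi>1 \<tau>) (at \<tau>) \<and>
      (\<phi>1 has_real_derivative \<phi>2 \<tau>) (at \<tau>) \<and> (\<phi>2 has_real_derivative \<phi>3 \<tau>) (at \<tau>)"
    and le: "\<forall>\<tau>\<in>I. \<bar>\<phi>3 \<tau>\<bar> \<le> 2 * \<phi>2 \<tau> powr (3 / 2)"
    using sc[folded I_def] by (elim exE conjE) (rule that, assumption+)
  have p: "((\<lambda>\<tau>. F (z + \<tau> *\<^sub>R v)) has_real_derivative \<phi>1 \<tau>) (at \<tau>)"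
    "(\<phi>1 has_real_derivative \<phi>2 \<tau>) (at \<tau>)" "(\<phi>2 has_real_derivative \<phi>3 \<tau>) (at \<tau>)"
    "\<bar>\<phi>3 \<tau>\<bar> \<le> 2 * \<phi>2 \<tau> powr (3 / 2)" if "\<tau> \<in> I" for \<tau>
    using bspec[OF d that] bspec[OF le that] by auto
  have 1: "G (z + \<tau> *\<^sub>R v) \<bullet> v = \<phi>1 \<tau>" if "\<tau> \<in> I" for \<tau>
    using DERIV_unique[OF line_derivative p(1)[OF that]] that by (auto simp: I_def)
  have 2: "H (z + \<tau> *\<^sub>R v) v \<bullet> v = \<phi>2 \<tau>" if t: "\<tau> \<in> I" for \<tau>
  proof -
    have "(\<phi>1 has_real_derivative H (z + \<tau> *\<^sub>R v) v \<bullet> v) (at \<tau>)"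
      by (rule has_field_derivative_transform_within_open[OF gradient_line_derivative I t 1])
        (use t in \<open>simp_all add: I_def\<close>)
    then show ?thesis using DERIV_unique p(2)[OF t] by blast
  qed
  show ?thesis
  proof (rule that)
    fix \<tau> assume "z + \<tau> *\<^sub>R v \<in> U"
    then have t: "\<tau> \<in> I" by (simp add: I_def)
    show "((\<lambda>\<tau>. H (z + \<tau> *\<^sub>R v) v \<bullet> v) has_real_derivative \<phi>3 \<tau>) (at \<tau>)"
      by (rule has_field_derivative_transform_within_open[OF p(3)[OF t] I t]) (simp add: 2)
    have "\<phi>2 \<tau> = (N (z + \<tau> *\<^sub>R v) v)\<^sup>2"
      using 2[OF t] t N_sq by (simp add: I_def)
    then have "\<phi>2 \<tau> powr (3 / 2) = N (z + \<tau> *\<^sub>R v) v ^ 3"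
      using t N_nonneg[of "z + \<tau> *\<^sub>R v" v]
      using square_powr_three_halves N_nonneg[of "z + \<tau> *\<^sub>R v" v] by (simp add: I_def)
    then show "\<bar>\<phi>3 \<tau>\<bar> \<le> 2 * N (z + \<tau> *\<^sub>R v) v ^ 3" using p(4)[OF t] by simp
  qed
qed

text \<open>
  Self-concordance says exactly that \<open>1 / N (z + \<tau> v) v\<close> has a derivative of modulus at most 1.
\<close>

lemma inverse_norm_step:
  assumes z: "z \<in> U" and zt: "z + t *\<^sub>R v \<in> U" and v: "v \<noteq> 0" and t: "0 < t"
  shows "\<bar>1 / N (z + t *\<^sub>R v) v - 1 / N z v\<bar> \<le> t"
proof -
  obtain \<phi>3 where d: "\<And>\<tau>. z + \<tau> *\<^sub>R v \<in> U \<Longrightarrow> ((\<lambda>\<tau>. H (z + \<tau> *\<^sub>R v) v \<bullet> v) has_real_derivative \<phi>3 \<tau>) (at \<tau>)"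
    and le: "\<And>\<tau>. z + \<tau> *\<^sub>R v \<in> U \<Longrightarrow> \<bar>\<phi>3 \<tau>\<bar> \<le> 2 * N (z + \<tau> *\<^sub>R v) v ^ 3"
    using third_derivative_on_lines[OF z, of v] by blast
  have inU: "z + \<tau> *\<^sub>R v \<in> U" if "0 \<le> \<tau>" "\<tau> \<le> t" for \<tau>
    using segment_in[OF z zt, of "\<tau> / t"] that t by simp
  have der: "((\<lambda>\<tau>. 1 / N (z + \<tau> *\<^sub>R v) v) has_real_derivative - \<phi>3 \<tau> / (2 * N (z + \<tau> *\<^sub>R v) v ^ 3)) (at \<tau>)"
    if "0 \<le> \<tau>" "\<tau> \<le> t" for \<tau>
  proof -
    have pos: "0 < H (z + \<tau> *\<^sub>R v) v \<bullet> v"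
      using N_sq[OF inU[OF that], of v] N_pos[OF inU[OF that] v] by (metis zero_less_power)
    have "((\<lambda>\<tau>. 1 / sqrt (H (z + \<tau> *\<^sub>R v) v \<bullet> v)) has_real_derivative
      - (\<phi>3 \<tau> * (inverse (sqrt (H (z + \<tau> *\<^sub>R v) v \<bullet> v)) / 2)) / (sqrt (H (z + \<tau> *\<^sub>R v) v \<bullet> v))\<^sup>2) (at \<tau>)"
      using pos by (auto intro!: derivative_eq_intros d inU that simp: power2_eq_square)
    then show ?thesis
      by (simp add: local_norm_def divide_simps power3_eq_cube power2_eq_square mult_ac)
  qed
  have "\<exists>\<theta>. 0 < \<theta> \<and> \<theta> < t \<and> 1 / N (z + t *\<^sub>R v) v - 1 / N (z + 0 *\<^sub>R v) v
      = (t - 0) * (- \<phi>3 \<theta> / (2 * N (z + \<theta> *\<^sub>R v) v ^ 3))"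
    by (rule MVT2[OF t der])
  then obtain \<theta> where th: "0 < \<theta>" "\<theta> < t" "1 / N (z + t *\<^sub>R v) v - 1 / N z v
      = t * (- \<phi>3 \<theta> / (2 * N (z + \<theta> *\<^sub>R v) v ^ 3))" by auto
  have "0 < N (z + \<theta> *\<^sub>R v) v ^ 3" using N_pos[OF inU v] th by simp
  then have "\<bar>\<phi>3 \<theta> / (2 * N (z + \<theta> *\<^sub>R v) v ^ 3)\<bar> \<le> 1"
    using le[OF inU, of \<theta>] th by (simp add: abs_divide divide_le_eq)
  then have "t * \<bar>\<phi>3 \<theta> / (2 * N (z + \<theta> *\<^sub>R v) v ^ 3)\<bar> \<le> t * 1"
    using t by (intro mult_left_mono) auto
  then show ?thesis using th(3) t by (simp add: abs_mult)
qed

lemma directional_norm_bounds: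
  assumes z: "z \<in> U" and zt: "z + t *\<^sub>R v \<in> U" and t: "0 \<le> t"
  shows "t * N z v < 1 \<Longrightarrow> N (z + t *\<^sub>R v) v \<le> N z v / (1 - t * N z v)"
    and "N z v / (1 + t * N z v) \<le> N (z + t *\<^sub>R v) v"
proof -
  define p where "p = N z v"
  define q where "q = N (z + t *\<^sub>R v) v"
  have nn: "0 \<le> p" "0 \<le> q" using N_nonneg z zt by (auto simp: p_def q_def)
  have "(t * p < 1 \<longrightarrow> q \<le> p / (1 - t * p)) \<and> p / (1 + t * p) \<le> q"
  proof (cases "v = 0 \<or> t = 0")
    case True
    then show ?thesis using z zt by (auto simp: p_def q_def N_zero)
  next
    case False
    then have pq: "p > 0" "q > 0" and t: "t > 0" using N_pos z zt t by (auto simp: p_def q_def)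
    have "\<bar>1 / q - 1 / p\<bar> \<le> t"
      using inverse_norm_step[OF z zt _ t] False by (simp add: p_def q_def)
    then have le: "1 / q \<le> t + 1 / p" "1 / p \<le> t + 1 / q" by linarith+
    have 1: "p \<le> (1 + t * p) * q" using mult_left_mono[OF le(1), of "p * q"] pq by (simp add: algebra_simps)
    have 2: "(1 - t * p) * q \<le> p" using mult_left_mono[OF le(2), of "p * q"] pq by (simp add: algebra_simps)
    have "0 < 1 + t * p" using pq t by (simp add: add_pos_pos)
    then have "p / (1 + t * p) \<le> q" using 1 by (simp add: divide_le_eq mult.commute)
    moreover have "q \<le> p / (1 - t * p)" if "t * p < 1"
      using 2 that by (simp add: le_divide_eq mult.commute)
    ultimately show ?thesis by blast
  qed
  then show "t * N z v < 1 \<Longrightarrow> N (z + t *\<^sub>R v) v \<le> N z v / (1 - t * N z v)"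
    and "N z v / (1 + t * N z v) \<le> N (z + t *\<^sub>R v) v"
    by (auto simp: p_def q_def)
qed

text \<open>
  On a segment of length \<open>2 a\<close> around \<open>y\<close> the second derivative is at least
  \<open>(p / (1 + a p))\<^sup>2\<close> with \<open>p = N y x\<close>, so the second difference of \<open>F\<close> is at least
  \<open>(a p / (1 + a p))\<^sup>2\<close>. By continuity of \<open>F\<close> it is below \<open>1/4\<close>, which forces \<open>a p < 1\<close>.
\<close>

lemma hessian_locally_bounded:
  assumes z0: "z0 \<in> U"
  obtains a where "0 < a" "ball z0 a \<subseteq> U" "\<And>y x. y \<in> ball z0 a \<Longrightarrow> N y x \<le> norm x / a"
proof -
  have "isCont F z0" using gradient[OF z0] has_derivative_continuous by blast
  then obtain r1 where r1: "r1 > 0" "\<And>y. dist y z0 < r1 \<Longrightarrow> \<bar>F y - F z0\<bar> < 1/16"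
    unfolding continuous_at_eps_delta dist_real_def by (metis zero_less_divide_1_iff zero_less_numeral)
  obtain r2 where r2: "r2 > 0" "ball z0 r2 \<subseteq> U" using open_U z0 openE by blast
  define a where "a = min r1 r2 / 2"
  have a: "a > 0" "2 * a \<le> r1" "2 * a \<le> r2" using r1 r2 by (auto simp: a_def)
  have inU: "y + t *\<^sub>R x \<in> U" and Fy: "\<bar>F (y + t *\<^sub>R x) - F z0\<bar> < 1/16"
    if "y \<in> ball z0 a" "norm x \<le> 1" "\<bar>t\<bar> \<le> a" for y x t
  proof -
    have "norm (t *\<^sub>R x) \<le> a * 1" using that unfolding norm_scaleR by (intro mult_mono) auto
    then have "dist (y + t *\<^sub>R x) z0 < 2 * a"
      using that(1) dist_triangle[of "y + t *\<^sub>R x" z0 y] by (simp add: dist_norm norm_minus_commute)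
    then show "y + t *\<^sub>R x \<in> U" "\<bar>F (y + t *\<^sub>R x) - F z0\<bar> < 1/16"
      using r1(2) subsetD[OF r2(2), of "y + t *\<^sub>R x"] a by (auto simp: dist_commute)
  qed
  have unit: "N y x \<le> 1 / a" if y: "y \<in> ball z0 a" and x: "norm x \<le> 1" for y x
  proof (rule ccontr)
    assume "\<not> N y x \<le> 1 / a"
    then have pa: "N y x > 1 / a" by simp
    define p where "p = N y x"
    have p: "p > 1 / a" "p > 0" using pa a by (auto simp: p_def intro: less_trans[of 0 "1/a"])
    have yU: "y \<in> U" using inU[OF y x, of 0] a by simp
    define m where "m = (p / (1 + a * p))\<^sup>2"
    have pos: "0 < 1 + a * p" using a p by (simp add: add_pos_pos)
    have low: "m \<le> H (y + t *\<^sub>R w) w \<bullet> w" if t: "0 \<le> t" "t \<le> a" and w: "w = x \<or> w = - x" for t w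
    proof -
      have "norm w \<le> 1" using w x by auto
      then have yt: "y + t *\<^sub>R w \<in> U" using inU[OF y _, of w t] t by auto
      have "N y w = p" using w N_minus[OF yU] by (auto simp: p_def)
      then have "p / (1 + t * p) \<le> N (y + t *\<^sub>R w) w"
        using directional_norm_bounds(2)[OF yU yt t(1)] by simp
      moreover have "p / (1 + a * p) \<le> p / (1 + t * p)"
        using t p by (intro divide_left_mono mult_pos_pos add_pos_nonneg add_left_mono mult_right_mono) auto
      ultimately have "p / (1 + a * p) \<le> N (y + t *\<^sub>R w) w" by simp
      then have "m \<le> (N (y + t *\<^sub>R w) w)\<^sup>2"
        unfolding m_def using p pos by (intro power_mono) auto
      then show ?thesis using N_sq[OF yt] by simp
    qed
    have half: "F y + a * (G y \<bullet> w) + m * a\<^sup>2 / 2 \<le> F (y + a *\<^sub>R w)" if w: "w = x \<or> w = - x" for w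
    proof -
      have wn: "norm w \<le> 1" using w x by auto
      have inw: "y + t *\<^sub>R w \<in> U" if "0 \<le> t" "t \<le> a" for t using inU[OF y wn, of t] that by auto
      have k: "((\<lambda>t. F y + t * (G y \<bullet> w) + m * t\<^sup>2 / 2) has_real_derivative G y \<bullet> w + m * t) (at t)"
        "((\<lambda>t. G y \<bullet> w + m * t) has_real_derivative m) (at t)" for t :: real
        by (auto intro!: derivative_eq_intros)
      show ?thesis
        by (rule second_order_comparison[OF _ _ _ k line_derivative gradient_line_derivative])
          (use a w low inw in auto)
    qed
    have "m * a\<^sup>2 \<le> F (y + a *\<^sub>R x) + F (y + a *\<^sub>R (- x)) - 2 * F y"
      using half[of x] half[of "- x"] by simp
    also have "\<dots> < 1/4"
    proof -
      have "\<bar>F (y + a *\<^sub>R x) - F z0\<bar> < 1/16" "\<bar>F (y + a *\<^sub>R (- x)) - F z0\<bar> < 1/16" "\<bar>F y - F z0\<bar> < 1/16"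
        using Fy[OF y x, of a] Fy[OF y, of "- x" a] Fy[OF y x, of 0] x a by auto
      then show ?thesis by linarith
    qed
    finally have "(a * p / (1 + a * p))\<^sup>2 < (1/2)\<^sup>2"
      by (simp add: m_def power_divide power_mult_distrib power2_eq_square mult_ac)
    then have "a * p / (1 + a * p) < 1/2" by (rule power2_less_imp_less) simp
    then have "a * p < 1" using pos by (simp add: field_simps)
    then show False using p a by (simp add: field_simps)
  qed
  show ?thesis
  proof (rule that)
    show "0 < a" by (rule a)
    show "ball z0 a \<subseteq> U" using inU[of _ 0 0] a by auto
    fix y x assume y: "y \<in> ball z0 a"
    then have yU: "y \<in> U" using inU[of y 0 0] a by auto
    show "N y x \<le> norm x / a"
    proof (cases "x = 0")
      case False
      have "N y x = norm x * N y ((1 / norm x) *\<^sub>R x)"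
        using False by (simp add: N_scale[OF yU])
      also have "\<dots> \<le> norm x * (1 / a)"
        by (intro mult_left_mono unit y) auto
      finally show ?thesis by simp
    qed (simp add: N_zero[OF yU])
  qed
qed

end

section \<open>Comparison of Hessians\<close>

context barrier
begin

lemma twice_differentiable_subset:
  assumes "open B" "convex B" "B \<subseteq> U"
  shows "twice_differentiable B F G (\<lambda>z v. H z v)"
proof
  show "open B" "convex B" by fact+
  show "(F has_derivative (\<lambda>h. G z \<bullet> h)) (at z)" if "z \<in> B" for z
    using that assms by (intro gradient) auto
  show "(G has_derivative (*v) (hess F z)) (at z)" if "z \<in> B" for z
    using that assms by (intro hessian) auto
qed

text \<open>
  On a convex set where the local norms are dominated by one fixed inner product norm, the sharp
  mixed bound holds for that norm.
\<close>

lemma local_third_bound: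
  assumes B: "open B" "convex B" "B \<subseteq> U" and b: "inner_form b" and c: "0 \<le> c"
    and le: "\<And>y x. y \<in> B \<Longrightarrow> N y x \<le> c * form_norm b x"
    and y: "y \<in> B" "y' \<in> B"
  shows "\<bar>(H y' v - H y v) \<bullet> w\<bar>
    \<le> 2 * c ^ 3 * form_norm b (y' - y) * form_norm b v * form_norm b w"
proof -
  interpret B: twice_differentiable B F G "\<lambda>z v. H z v"
    by (rule twice_differentiable_subset[OF B])
  interpret b: inner_form b by (rule b)
  have "B.third_le x x x (2 * c ^ 3 * form_norm b x ^ 3)" for x
  proof (rule B.third_le_positive_step)
    fix z s assume z: "z \<in> B" "z + s *\<^sub>R x \<in> B" and s: "0 < (s::real)"
    have inB: "z + t *\<^sub>R x \<in> B" if "0 \<le> t" "t \<le> s" for t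
      using B.segment_in[OF z, of "t / s"] that s by simp
    obtain \<phi>3 where d: "\<And>\<tau>. z + \<tau> *\<^sub>R x \<in> U \<Longrightarrow> ((\<lambda>\<tau>. H (z + \<tau> *\<^sub>R x) x \<bullet> x) has_real_derivative \<phi>3 \<tau>) (at \<tau>)"
      and \<phi>3: "\<And>\<tau>. z + \<tau> *\<^sub>R x \<in> U \<Longrightarrow> \<bar>\<phi>3 \<tau>\<bar> \<le> 2 * N (z + \<tau> *\<^sub>R x) x ^ 3"
      using third_derivative_on_lines[of z x] z B(3) by blast
    have "\<exists>\<theta>. 0 < \<theta> \<and> \<theta> < s \<and> H (z + s *\<^sub>R x) x \<bullet> x - H (z + 0 *\<^sub>R x) x \<bullet> x = (s - 0) * \<phi>3 \<theta>"
      by (rule MVT2[OF s]) (use inB B(3) d in blast)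
    then obtain \<theta> where th: "0 < \<theta>" "\<theta> < s" "H (z + s *\<^sub>R x) x \<bullet> x - H z x \<bullet> x = s * \<phi>3 \<theta>" by auto
    have inth: "z + \<theta> *\<^sub>R x \<in> B" using inB th by simp
    then have inU: "z + \<theta> *\<^sub>R x \<in> U" using B(3) by blast
    have "\<bar>\<phi>3 \<theta>\<bar> \<le> 2 * N (z + \<theta> *\<^sub>R x) x ^ 3" by (rule \<phi>3[OF inU])
    also have "\<dots> \<le> 2 * (c * form_norm b x) ^ 3"
      using le[OF inth] N_nonneg[OF inU] by (intro mult_left_mono power_mono) auto
    also have "\<dots> = 2 * c ^ 3 * form_norm b x ^ 3" by (simp add: power_mult_distrib)
    finally have "s * \<bar>\<phi>3 \<theta>\<bar> \<le> s * (2 * c ^ 3 * form_norm b x ^ 3)"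
      using s by (intro mult_left_mono) auto
    then show "\<bar>(H (z + s *\<^sub>R x) x - H z x) \<bullet> x\<bar> \<le> 2 * c ^ 3 * form_norm b x ^ 3 * s"
      using th(3) s by (simp add: inner_diff_left abs_mult mult.commute)
  qed
  then have "B.third_le (y' - y) v w (2 * c ^ 3 * form_norm b (y' - y) * form_norm b v * form_norm b w)"
    using c by (intro B.third_le_from_diagonal[OF b]) auto
  from B.third_leD[OF this y(1), of 1] y(2) show ?thesis by simp
qed

lemma inner_form_inner: "inner_form (\<lambda>u v::real^'p. u \<bullet> v)"
  by unfold_locales (auto simp: inner_add_left intro: inner_commute)

lemma form_norm_inner: "form_norm (\<lambda>u v. u \<bullet> v) = norm"
  by (auto simp: form_norm_def norm_eq_sqrt_inner)

text \<open>
  The local bound on the Hessian, with the Euclidean inner product as the dominating form.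
\<close>

lemma hessian_locally_Lipschitz:
  assumes z0: "z0 \<in> U"
  obtains a C where "0 < a" "0 \<le> C" "ball z0 a \<subseteq> U"
    "\<And>y v w. y \<in> ball z0 a \<Longrightarrow> \<bar>(H y v - H z0 v) \<bullet> w\<bar> \<le> C * norm (y - z0) * norm v * norm w"
proof -
  obtain a where a: "0 < a" "ball z0 a \<subseteq> U" "\<And>y x. y \<in> ball z0 a \<Longrightarrow> N y x \<le> norm x / a"
    using hessian_locally_bounded[OF z0] by blast
  have "\<bar>(H y v - H z0 v) \<bullet> w\<bar> \<le> 2 * (1 / a) ^ 3 * norm (y - z0) * norm v * norm w" if "y \<in> ball z0 a" for y v w
    using local_third_bound[of "ball z0 a" "\<lambda>u v. u \<bullet> v" "1 / a" z0 y v w] a that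
    by (auto simp: form_norm_inner inner_form_inner)
  then show ?thesis using a by (intro that[of a "2 * (1 / a) ^ 3"]) auto
qed

lemma hessian_isCont: "z0 \<in> U \<Longrightarrow> isCont (\<lambda>y. H y v \<bullet> w) z0"
proof -
  assume z0: "z0 \<in> U"
  obtain a C where a: "0 < a" "0 \<le> C" "ball z0 a \<subseteq> U"
    "\<And>y v w. y \<in> ball z0 a \<Longrightarrow> \<bar>(H y v - H z0 v) \<bullet> w\<bar> \<le> C * norm (y - z0) * norm v * norm w"
    using hessian_locally_Lipschitz[OF z0] by blast
  have "((\<lambda>y. H y v \<bullet> w - H z0 v \<bullet> w) \<longlongrightarrow> 0) (at z0)"
  proof (rule Lim_null_comparison)
    have "\<forall>\<^sub>F y in at z0. y \<in> ball z0 a"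
      using a(1) by (intro eventually_at_in_open') auto
    then show "\<forall>\<^sub>F y in at z0. norm (H y v \<bullet> w - H z0 v \<bullet> w) \<le> C * norm (y - z0) * norm v * norm w"
      by eventually_elim (use a(4)[of _ v w] in \<open>simp add: inner_diff_left\<close>)
    show "((\<lambda>y. C * norm (y - z0) * norm v * norm w) \<longlongrightarrow> 0) (at z0)"
      by (auto intro!: tendsto_eq_intros)
  qed
  then show ?thesis by (simp add: isCont_def LIM_zero_iff)
qed

lemma norm_le_local_norm:
  assumes z0: "z0 \<in> U"
  obtains m where "0 < m" "\<And>x. m * norm x \<le> N z0 x"
proof -
  define q where "q x = H z0 x \<bullet> x" for x :: "real^'p"
  have "continuous_on (sphere 0 1) q" unfolding q_def
    by (intro continuous_intros matrix_vector_mult_linear_continuous_on)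
  moreover have "sphere 0 1 \<noteq> ({} :: (real^'p) set)" by simp
  ultimately obtain x0 where x0: "x0 \<in> sphere 0 1" "\<And>x. x \<in> sphere 0 1 \<Longrightarrow> q x0 \<le> q x"
    using continuous_attains_inf[of "sphere 0 1" q] by auto
  define m where "m = N z0 x0"
  have m: "m > 0" using x0(1) by (auto simp: m_def intro!: N_pos[OF z0])
  have unit: "m \<le> N z0 x" if "norm x = 1" for x
    using x0(2)[of x] that by (simp add: m_def local_norm_def q_def)
  have "m * norm x \<le> N z0 x" for x
  proof (cases "x = 0")
    case False
    have "m * norm x \<le> N z0 ((1 / norm x) *\<^sub>R x) * norm x"
      using False by (intro mult_right_mono unit) auto
    then show ?thesis using False by (simp add: N_scale[OF z0])
  qed (simp add: N_zero[OF z0])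
  then show ?thesis using m that by blast
qed

text \<open>
  By continuity of the Hessian the local norms near \<open>z0\<close> are at most \<open>1 + \<eta>\<close> times the one at \<open>z0\<close>,
  so the mixed bound holds with a constant as close to 2 as desired.
\<close>

lemma hessian_variation:
  assumes z0: "z0 \<in> U" and \<kappa>: "2 < \<kappa>"
  shows "\<forall>\<^sub>F y in nhds z0. \<forall>v w. \<bar>(H y v - H z0 v) \<bullet> w\<bar> \<le> \<kappa> * N z0 (y - z0) * N z0 v * N z0 w"
proof -
  obtain a C where a: "0 < a" "0 \<le> C" "ball z0 a \<subseteq> U"
    and C: "\<And>y v w. y \<in> ball z0 a \<Longrightarrow> \<bar>(H y v - H z0 v) \<bullet> w\<bar> \<le> C * norm (y - z0) * norm v * norm w"
    using hessian_locally_Lipschitz[OF z0] by blast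
  obtain m where m: "0 < m" "\<And>x. m * norm x \<le> N z0 x" using norm_le_local_norm[OF z0] by blast
  \<comment> \<open>\<open>(1 + \<eta>)\<^sup>3 \<le> 1 + 7 \<eta>\<close> for \<open>\<eta> \<le> 1\<close>, hence \<open>2 (1 + \<eta>)\<^sup>3 \<le> \<kappa>\<close>\<close>
  define \<eta> where "\<eta> = min 1 ((\<kappa> / 2 - 1) / 7)"
  have eta: "0 < \<eta>" "\<eta> \<le> 1" "7 * \<eta> \<le> \<kappa> / 2 - 1" 
  proof -
    show "0 < \<eta>" "\<eta> \<le> 1" using \<kappa> by (auto simp: \<eta>_def)
    have "\<eta> \<le> (\<kappa> / 2 - 1) / 7" unfolding \<eta>_def by (rule min.cobounded2)
    then show "7 * \<eta> \<le> \<kappa> / 2 - 1" by (simp add: le_divide_eq mult.commute)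
  qed
  have eta3: "2 * (1 + \<eta>) ^ 3 \<le> \<kappa>"
  proof -
    have "\<eta>\<^sup>2 \<le> \<eta>" "\<eta> ^ 3 \<le> \<eta>" using eta power_decreasing[of 1 2 \<eta>] power_decreasing[of 1 3 \<eta>] by auto
    moreover have "(1 + \<eta>) ^ 3 = 1 + 3 * \<eta> + 3 * \<eta>\<^sup>2 + \<eta> ^ 3" by (simp add: power3_eq_cube power2_eq_square algebra_simps)
    ultimately show ?thesis using eta by linarith
  qed
  define r where "r = min a (\<eta> * m\<^sup>2 / (C + 1))"
  have r: "0 < r" "r \<le> a" "C * r \<le> \<eta> * m\<^sup>2"
  proof -
    show "0 < r" "r \<le> a" using a eta m by (auto simp: r_def)
    have "C * r \<le> C * (\<eta> * m\<^sup>2 / (C + 1))" using a by (intro mult_left_mono) (auto simp: r_def)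
    also have "\<dots> = (\<eta> * m\<^sup>2) * (C / (C + 1))" by simp
    also have "\<dots> \<le> (\<eta> * m\<^sup>2) * 1" using a eta by (intro mult_left_mono) auto
    finally show "C * r \<le> \<eta> * m\<^sup>2" by simp
  qed
  have le: "N y x \<le> (1 + \<eta>) * form_norm (\<lambda>u v. H z0 u \<bullet> v) x" if y: "y \<in> ball z0 r" for y x
  proof -
    have yU: "y \<in> U" using y r a by auto
    have yr: "norm (y - z0) \<le> r" using y by (simp add: dist_norm norm_minus_commute)
    have "(N y x)\<^sup>2 - (N z0 x)\<^sup>2 = (H y x - H z0 x) \<bullet> x"
      using N_sq[OF yU] N_sq[OF z0] by (simp add: inner_diff_left)
    also have "\<dots> \<le> C * norm (y - z0) * norm x * norm x"
      using C[of y x x] y r by auto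
    also have "\<dots> \<le> C * r * norm x * norm x" using yr a by (intro mult_right_mono mult_left_mono) auto
    also have "\<dots> \<le> \<eta> * m\<^sup>2 * norm x * norm x" using r by (intro mult_right_mono) auto
    also have "\<dots> = \<eta> * (m * norm x)\<^sup>2" by (simp add: power2_eq_square)
    also have "\<dots> \<le> \<eta> * (N z0 x)\<^sup>2" using m eta by (intro mult_left_mono power_mono) auto
    finally have "(N y x)\<^sup>2 \<le> (1 + \<eta>) * (N z0 x)\<^sup>2" by (simp add: algebra_simps)
    also have "\<dots> \<le> (1 + \<eta>)\<^sup>2 * (N z0 x)\<^sup>2"
      using eta by (intro mult_right_mono) (auto simp: power2_eq_square)
    finally have "(N y x)\<^sup>2 \<le> ((1 + \<eta>) * N z0 x)\<^sup>2" by (simp add: power_mult_distrib)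
    then have "N y x \<le> (1 + \<eta>) * N z0 x"
      by (rule power2_le_imp_le) (use eta N_nonneg[OF z0] in auto)
    then show ?thesis by (simp add: nrm_hess)
  qed
  have "\<forall>\<^sub>F y in nhds z0. y \<in> ball z0 r" using r by (intro eventually_nhds_in_open) auto
  then show ?thesis
  proof eventually_elim
    case (elim y)
    show ?case
    proof (intro allI)
      fix v w
      have "\<bar>(H y v - H z0 v) \<bullet> w\<bar> \<le> 2 * (1 + \<eta>) ^ 3 * N z0 (y - z0) * N z0 v * N z0 w"
        using local_third_bound[of "ball z0 r" "\<lambda>u v. H z0 u \<bullet> v" "1 + \<eta>" z0 y v w]
          order_trans[OF subset_ball[OF r(2)] a(3)] elim r a eta
          inner_form_hess[OF z0] le by (auto simp: nrm_hess)
      also have "\<dots> \<le> \<kappa> * N z0 (y - z0) * N z0 v * N z0 w"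
        using eta3 N_nonneg[OF z0] by (intro mult_right_mono) auto
      finally show "\<bar>(H y v - H z0 v) \<bullet> w\<bar> \<le> \<kappa> * N z0 (y - z0) * N z0 v * N z0 w" .
    qed
  qed
qed

text \<open>
  Formally, \<open>q(\<tau>) = H (x + \<tau> h) v \<bullet> v\<close> satisfies \<open>\<bar>(ln q)'\<bar> \<le> 2 N (x + \<tau> h) h \<le> 2 r / (1 - \<tau> r)\<close>,
  and the right-hand side is the derivative of \<open>- 2 ln (1 - \<tau> r)\<close>. As \<open>q\<close> need not be differentiable,
  the inequality is verified for increments to the right. The sign \<open>s\<close> treats the upper and the
  lower bound for the Hessian at once.
\<close>

lemma log_hessian_comparison:
  assumes x: "x \<in> U" and xh: "x + h \<in> U" and r: "N x h < 1" and v: "v \<noteq> 0" and s: "s = 1 \<or> s = - 1"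
  shows "s * ln ((N (x + h) v)\<^sup>2) + 2 * ln (1 - N x h) \<le> s * ln ((N x v)\<^sup>2)"
proof -
  define r where "r = N x h"
  have r: "0 \<le> r" "r < 1" using N_nonneg[OF x] r by (auto simp: r_def)
  define q where "q \<tau> = H (x + \<tau> *\<^sub>R h) v \<bullet> v" for \<tau>
  have inU: "x + \<tau> *\<^sub>R h \<in> U" if "0 \<le> \<tau>" "\<tau> \<le> 1" for \<tau> using segment_in[OF x xh] that by auto
  have q_pos: "0 < q \<tau>" if "0 \<le> \<tau>" "\<tau> \<le> 1" for \<tau>
    unfolding q_def by (rule hess_positive[OF inU[OF that] v])
  have q_N: "q \<tau> = (N (x + \<tau> *\<^sub>R h) v)\<^sup>2" if "0 \<le> \<tau>" "\<tau> \<le> 1" for \<tau>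
    unfolding q_def using N_sq[OF inU[OF that]] by simp
  have pos: "0 < 1 - \<tau> * r" if "0 \<le> \<tau>" "\<tau> \<le> 1" for \<tau>
    using that r mult_left_le_one_le[of r \<tau>] by simp
  define f where "f \<tau> = s * ln (q \<tau>) + 2 * ln (1 - \<tau> * r)" for \<tau>
  have "f 1 \<le> f 0"
  proof (rule nonincreasing_from_right_increments[where f = f and a = 0 and b = 1])
    have "isCont q \<tau>" if "0 \<le> \<tau>" "\<tau> \<le> 1" for \<tau>
      unfolding q_def
      by (rule isCont_o2[of \<tau> "\<lambda>\<tau>. x + \<tau> *\<^sub>R h", OF _ hessian_isCont]) (use inU that in \<open>auto intro!: continuous_intros\<close>)
    then have "continuous_on {0..1} q" by (intro continuous_at_imp_continuous_on) auto
    then show "continuous_on {0..1} f"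
      unfolding f_def by (intro continuous_intros) (use q_pos pos in \<open>force+\<close>)
    fix \<tau> \<epsilon> :: real assume t: "0 \<le> \<tau>" "\<tau> < 1" and e: "0 < \<epsilon>"
    then have t1: "0 \<le> \<tau>" "\<tau> \<le> 1" by auto
    define \<rho> where "\<rho> = r / (1 - \<tau> * r)"
    have rho: "0 \<le> \<rho>" using r pos[OF t1] by (simp add: \<rho>_def)
    \<comment> \<open>half of the admissible slope \<open>\<epsilon>\<close> pays for \<open>\<kappa> > 2\<close>, the other half for the second-order terms\<close>
    define \<kappa> where "\<kappa> = 2 + \<epsilon> / (2 * (\<rho> + 1))"
    have kap: "\<kappa> > 2" "(\<kappa> - 2) * \<rho> \<le> \<epsilon> / 2"
    proof -
      show "\<kappa> > 2" using e rho by (simp add: \<kappa>_def)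
      have "(\<kappa> - 2) * \<rho> = \<epsilon> / 2 * (\<rho> / (\<rho> + 1))" using rho by (simp add: \<kappa>_def field_simps)
      also have "\<dots> \<le> \<epsilon> / 2 * 1" using e rho by (intro mult_left_mono) auto
      finally show "(\<kappa> - 2) * \<rho> \<le> \<epsilon> / 2" by simp
    qed
    have "((\<lambda>\<sigma>. x + \<sigma> *\<^sub>R h) \<longlongrightarrow> x + \<tau> *\<^sub>R h) (at_right \<tau>)" by (intro tendsto_intros)
    then have var: "\<forall>\<^sub>F \<sigma> in at_right \<tau>. \<forall>v w. \<bar>(H (x + \<sigma> *\<^sub>R h) v - H (x + \<tau> *\<^sub>R h) v) \<bullet> w\<bar>
        \<le> \<kappa> * N (x + \<tau> *\<^sub>R h) ((x + \<sigma> *\<^sub>R h) - (x + \<tau> *\<^sub>R h)) * N (x + \<tau> *\<^sub>R h) v * N (x + \<tau> *\<^sub>R h) w"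
      using hessian_variation[OF inU[OF t1] kap(1)] unfolding filterlim_iff by blast
    have lt: "\<forall>\<^sub>F \<sigma> in at_right \<tau>. \<sigma> < B" if "\<tau> < B" for B
      using that unfolding eventually_at_right_field by auto
    define L where "L = \<kappa> * \<rho>"
    have L: "0 \<le> L" using kap rho by (simp add: L_def)
    have lt2: "\<forall>\<^sub>F \<sigma> in at_right \<tau>. \<sigma> < \<tau> + 1 / (2 * (L + 1))"
      and lt3: "\<forall>\<^sub>F \<sigma> in at_right \<tau>. \<sigma> < \<tau> + \<epsilon> / (4 * (L + 1)\<^sup>2)"
      using L e by (auto intro!: lt)
    show "\<forall>\<^sub>F \<sigma> in at_right \<tau>. f \<sigma> \<le> f \<tau> + \<epsilon> * (\<sigma> - \<tau>)"
      using var lt[of 1, OF t(2)] lt2 lt3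
        eventually_at_right_less[of \<tau>]
    proof eventually_elim
      case (elim \<sigma>)
      define d where "d = \<sigma> - \<tau>"
      have s1: "0 \<le> \<sigma>" "\<sigma> \<le> 1" and d: "0 < d" using elim t by (auto simp: d_def)
      have d1: "d < 1 / (2 * (L + 1))" using elim(3) L by (simp add: d_def)
      have d2: "d < \<epsilon> / (4 * (L + 1)\<^sup>2)" using elim(4) L e by (simp add: d_def)
      have "(x + \<sigma> *\<^sub>R h) - (x + \<tau> *\<^sub>R h) = d *\<^sub>R h" by (simp add: d_def scaleR_left_diff_distrib)
      then have "N (x + \<tau> *\<^sub>R h) ((x + \<sigma> *\<^sub>R h) - (x + \<tau> *\<^sub>R h)) = d * N (x + \<tau> *\<^sub>R h) h"
        using N_scale[OF inU[OF t1], of d h] d by simp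
      also have "N (x + \<tau> *\<^sub>R h) h \<le> \<rho>"
        using directional_norm_bounds(1)[OF x inU[OF t1] t1(1)] pos[OF t1] by (simp add: \<rho>_def r_def)
      finally have nd: "N (x + \<tau> *\<^sub>R h) ((x + \<sigma> *\<^sub>R h) - (x + \<tau> *\<^sub>R h)) \<le> d * \<rho>" using d by simp
      have "\<bar>q \<sigma> - q \<tau>\<bar> \<le> \<kappa> * N (x + \<tau> *\<^sub>R h) ((x + \<sigma> *\<^sub>R h) - (x + \<tau> *\<^sub>R h)) * N (x + \<tau> *\<^sub>R h) v * N (x + \<tau> *\<^sub>R h) v"
        using elim(1) by (simp add: q_def inner_diff_left)
      also have "\<dots> = \<kappa> * N (x + \<tau> *\<^sub>R h) ((x + \<sigma> *\<^sub>R h) - (x + \<tau> *\<^sub>R h)) * q \<tau>"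
        by (simp add: q_N[OF t1] power2_eq_square)
      also have "\<dots> \<le> \<kappa> * (d * \<rho>) * q \<tau>"
        using nd kap q_pos[OF t1] by (intro mult_right_mono mult_left_mono) auto
      finally have dq: "\<bar>q \<sigma> - q \<tau>\<bar> \<le> d * L * q \<tau>" by (simp add: L_def mult_ac)
      define y where "y = (q \<sigma> - q \<tau>) / q \<tau>"
      have y: "\<bar>y\<bar> \<le> d * L" using dq q_pos[OF t1] by (simp add: y_def abs_divide divide_le_eq)
      have "d * L \<le> d * (L + 1)" using d by simp
      also have "\<dots> \<le> 1/2" using d1 L by (simp add: field_simps)
      finally have dL: "d * L \<le> 1/2" .
      have "q \<sigma> = q \<tau> * (1 + y)" using q_pos[OF t1] by (simp add: y_def field_simps)
      then have "ln (q \<sigma>) = ln (q \<tau>) + ln (1 + y)"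
        using q_pos[OF t1] y dL by (simp add: ln_mult)
      moreover have "\<bar>ln (1 + y) - y\<bar> \<le> 2 * y\<^sup>2"
        using y dL by (intro abs_ln_one_plus_x_minus_x_bound) auto
      moreover have "y\<^sup>2 \<le> (d * L)\<^sup>2" using y by (metis abs_ge_zero power2_abs power_mono)
      ultimately have lnq: "\<bar>ln (q \<sigma>) - ln (q \<tau>)\<bar> \<le> d * L + 2 * (d * L)\<^sup>2" using y by linarith
      have "1 - \<sigma> * r = (1 - \<tau> * r) * (1 - d * \<rho>)"
        using pos[OF t1] by (simp add: d_def \<rho>_def field_simps)
      moreover have "0 < 1 - d * \<rho>"
        using calculation pos[OF t1] pos[OF s1] by (simp add: zero_less_mult_iff)
      ultimately have "ln (1 - \<sigma> * r) = ln (1 - \<tau> * r) + ln (1 - d * \<rho>)"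
        using pos[OF t1] by (simp add: ln_mult)
      moreover have "ln (1 - d * \<rho>) \<le> - (d * \<rho>)"
        using ln_le_minus_one[OF \<open>0 < 1 - d * \<rho>\<close>] by simp
      ultimately have lnr: "ln (1 - \<sigma> * r) - ln (1 - \<tau> * r) \<le> - (d * \<rho>)" by simp
      have "s * ln (q \<sigma>) - s * ln (q \<tau>) \<le> \<bar>ln (q \<sigma>) - ln (q \<tau>)\<bar>" using s by auto
      then have "f \<sigma> - f \<tau> \<le> d * L + 2 * (d * L)\<^sup>2 - 2 * (d * \<rho>)"
        using lnq lnr by (simp add: f_def)
      also have "\<dots> = d * ((\<kappa> - 2) * \<rho>) + d * (2 * d * L\<^sup>2)"
        by (simp add: L_def power2_eq_square algebra_simps)
      also have "\<dots> \<le> d * (\<epsilon> / 2) + d * (\<epsilon> / 2)"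
      proof (intro add_mono mult_left_mono)
        have "2 * d * L\<^sup>2 \<le> 2 * d * (L + 1)\<^sup>2" using d L by (intro mult_left_mono power_mono) auto
        also have "\<dots> \<le> \<epsilon> / 2" using d2 L by (simp add: field_simps)
        finally show "2 * d * L\<^sup>2 \<le> \<epsilon> / 2" .
      qed (use kap d in auto)
      finally show ?case by (simp add: d_def algebra_simps)
    qed
  qed simp_all
  then show ?thesis using q_N[of 0] q_N[of 1] by (simp add: f_def r_def)
qed

lemma hessian_comparison:
  assumes x: "x \<in> U" and xh: "x + h \<in> U" and r: "N x h < 1"
  shows "(1 - N x h) * N x v \<le> N (x + h) v" and "N (x + h) v \<le> N x v / (1 - N x h)"
proof -
  have "(1 - N x h) * N x v \<le> N (x + h) v \<and> N (x + h) v * (1 - N x h) \<le> N x v"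
  proof (cases "v = 0")
    case False
    have p: "0 < N x v" "0 < N (x + h) v" "0 < 1 - N x h" using N_pos x xh False r by auto
    have "2 * ln (N (x + h) v * (1 - N x h)) \<le> 2 * ln (N x v)"
      using log_hessian_comparison[OF x xh r False, of 1] p by (simp add: ln_mult ln_realpow)
    moreover have "2 * ln ((1 - N x h) * N x v) \<le> 2 * ln (N (x + h) v)"
      using log_hessian_comparison[OF x xh r False, of "-1"] p by (simp add: ln_mult ln_realpow)
    ultimately show ?thesis using p by simp
  qed (use x xh N_zero in auto)
  then show "(1 - N x h) * N x v \<le> N (x + h) v" "N (x + h) v \<le> N x v / (1 - N x h)"
    using r by (auto simp: field_simps)
qed

end

section \<open>Gradient estimates and the Dikin ellipsoid\<close>

context barrier
begin

text \<open>
  Both one-sided comparisons bound the quadratic form of the difference, since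
  \<open>1 - c\<^sup>2 \<le> 1 / c\<^sup>2 - 1\<close>; polarisation extends the bound to the bilinear form.
\<close>

lemma hessian_diff_bound:
  assumes x: "x \<in> U" "x' \<in> U" and c: "0 < c" "c \<le> 1"
    and le: "\<And>v. c * N x v \<le> N x' v" "\<And>v. N x' v \<le> N x v / c"
  shows "\<bar>(H x' v - H x v) \<bullet> w\<bar> \<le> (1 / c\<^sup>2 - 1) * N x v * N x w"
proof (rule N_form_bound[OF x(1), of "\<lambda>v w. (H x' v - H x v) \<bullet> w"])
  show "(H x' y - H x y) \<bullet> z = (H x' z - H x z) \<bullet> y" for y z
    using hessian_symmetric x by (simp add: inner_diff_left)
  fix v
  have "1 \<le> 1 / c\<^sup>2" using c by (simp add: power_le_one)
  have *: "1 - c\<^sup>2 \<le> 1 / c\<^sup>2 - 1"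
  proof -
    have "0 \<le> (1 / c - c)\<^sup>2" by simp
    also have "\<dots> = 1 / c\<^sup>2 - 2 + c\<^sup>2" using c by (simp add: power2_diff power_divide)
    finally show ?thesis by simp
  qed
  have "(N x' v)\<^sup>2 \<le> (N x v / c)\<^sup>2" using le(2) N_nonneg x by (intro power_mono) auto
  moreover have "(c * N x v)\<^sup>2 \<le> (N x' v)\<^sup>2" using le(1) N_nonneg x c by (intro power_mono) auto
  moreover have "(1 - c\<^sup>2) * (N x v)\<^sup>2 \<le> (1 / c\<^sup>2 - 1) * (N x v)\<^sup>2" by (intro mult_right_mono *) simp
  ultimately have "\<bar>(N x' v)\<^sup>2 - (N x v)\<^sup>2\<bar> \<le> (1 / c\<^sup>2 - 1) * (N x v)\<^sup>2"
    by (simp add: power_divide power_mult_distrib abs_le_iff algebra_simps)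
  then show "\<bar>(H x' v - H x v) \<bullet> v\<bar> \<le> (1 / c\<^sup>2 - 1) * (H x v \<bullet> v)"
    using N_sq x by (simp add: inner_diff_left)
qed (auto simp: matrix_vector_right_distrib matrix_vector_mult_scaleR algebra_simps)

lemma abs_pairing_bound:
  assumes "x \<in> U" and "\<And>u. e \<bullet> u \<le> K * N x u"
  shows "\<bar>e \<bullet> u\<bar> \<le> K * N x u"
  using assms(2)[of u] assms(2)[of "- u"] N_minus[OF assms(1)] by simp

text \<open>
  Integrate the bound \<open>(1 / (1 - \<tau> r)\<^sup>2 - 1) r\<close> for the variation of \<open>H h\<close> over the segment.
\<close>

lemma gradient_bound:
  assumes x: "x \<in> U" and xh: "x + h \<in> U" and r: "N x h < 1"
  shows "\<bar>(G (x + h) - G x - H x h) \<bullet> u\<bar> \<le> (N x h)\<^sup>2 / (1 - N x h) * N x u"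
proof (rule abs_pairing_bound[OF x])
  fix u
  define r where "r = N x h"
  have r: "0 \<le> r" "r < 1" using N_nonneg[OF x] r by (auto simp: r_def)
  have pos: "0 < 1 - \<tau> * r" if "0 \<le> \<tau>" "\<tau> \<le> 1" for \<tau>
    using that r mult_left_le_one_le[of r \<tau>] by simp
  have inU: "x + \<tau> *\<^sub>R h \<in> U" if "0 \<le> \<tau>" "\<tau> \<le> 1" for \<tau> using segment_in[OF x xh] that by auto
  define k where "k \<tau> = G x \<bullet> u + N x u * (1 / (1 - \<tau> * r) - \<tau> * r - 1)" for \<tau>
  have "G (x + 1 *\<^sub>R h) \<bullet> u - 1 * (H x h \<bullet> u) \<le> k 1"
  proof (rule first_order_comparison[where h = "\<lambda>\<tau>. G (x + \<tau> *\<^sub>R h) \<bullet> u - \<tau> * (H x h \<bullet> u)"])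
    fix \<tau> :: real assume t: "0 \<le> \<tau>" "\<tau> \<le> 1"
    show "((\<lambda>\<tau>. G (x + \<tau> *\<^sub>R h) \<bullet> u - \<tau> * (H x h \<bullet> u)) has_real_derivative
        H (x + \<tau> *\<^sub>R h) h \<bullet> u - H x h \<bullet> u) (at \<tau>)"
      by (intro DERIV_diff gradient_line_derivative inU t) (auto intro!: derivative_eq_intros)
    show "(k has_real_derivative (1 / (1 - \<tau> * r)\<^sup>2 - 1) * r * N x u) (at \<tau>)"
      unfolding k_def using pos[OF t]
      by (auto intro!: derivative_eq_intros simp: power2_eq_square field_simps)
    have Nt: "N x (\<tau> *\<^sub>R h) = \<tau> * r" using t by (simp add: N_scale[OF x] r_def)
    have "\<bar>(H (x + \<tau> *\<^sub>R h) h - H x h) \<bullet> u\<bar> \<le> (1 / (1 - \<tau> * r)\<^sup>2 - 1) * N x h * N x u"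
      using hessian_comparison[OF x inU[OF t]] pos[OF t] t r Nt
      by (intro hessian_diff_bound x inU t) auto
    then show "H (x + \<tau> *\<^sub>R h) h \<bullet> u - H x h \<bullet> u \<le> (1 / (1 - \<tau> * r)\<^sup>2 - 1) * r * N x u"
      by (simp add: inner_diff_left r_def)
  qed (auto simp: k_def)
  moreover have "1 / (1 - r) - r - 1 = r\<^sup>2 / (1 - r)" using r by (simp add: field_simps power2_eq_square)
  ultimately show "(G (x + h) - G x - H x h) \<bullet> u \<le> (N x h)\<^sup>2 / (1 - N x h) * N x u"
    by (simp add: k_def r_def inner_diff_left mult.commute)
qed

text \<open>
  The linearisation error at \<open>z + d\<close>, measured there, in terms of the length of \<open>d\<close> at the other end
  \<open>z\<close>. Expressing it through \<open>N z d\<close> directly loses less than first passing to \<open>N (z + d) d\<close>; the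
  constants of the contraction towards the central path depend on this.
\<close>

lemma gradient_bound_at_endpoint:
  assumes z: "z \<in> U" and zd: "z + d \<in> U" and \<rho>: "N z d < 1"
  defines "\<rho> \<equiv> N z d"
  shows "\<bar>(G z - G (z + d) + H (z + d) d) \<bullet> u\<bar> \<le> \<rho>\<^sup>2 * (1 - 2 * \<rho> / 3) / (1 - \<rho>) ^ 3 * N (z + d) u"
proof (rule abs_pairing_bound[OF zd])
  fix u
  define x where "x = z + d"
  have xU: "x \<in> U" using zd by (simp add: x_def)
  have r: "0 \<le> \<rho>" "\<rho> < 1" using N_nonneg[OF z] \<rho> by (auto simp: \<rho>_def)
  have pos: "0 < 1 - \<sigma> * \<rho>" "1 - \<rho> \<le> 1 - \<sigma> * \<rho>" if "0 \<le> \<sigma>" "\<sigma> \<le> 1" for \<sigma>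
    using that r mult_left_le_one_le[of \<rho> \<sigma>] by auto
  have inU: "z + \<sigma> *\<^sub>R d \<in> U" if "0 \<le> \<sigma>" "\<sigma> \<le> 1" for \<sigma> using segment_in[OF z zd] that by auto
  define k where "k \<sigma> = N x u * (\<rho> / (1 - \<rho>)) * ((\<sigma> - \<sigma>\<^sup>2 * \<rho> + \<sigma> ^ 3 * \<rho>\<^sup>2 / 3) / (1 - \<rho>)\<^sup>2 - \<sigma>) - G z \<bullet> u" for \<sigma>
  have "1 * (H x d \<bullet> u) - G (z + 1 *\<^sub>R d) \<bullet> u \<le> k 1"
  proof (rule first_order_comparison[where h = "\<lambda>\<sigma>. \<sigma> * (H x d \<bullet> u) - G (z + \<sigma> *\<^sub>R d) \<bullet> u"])
    fix \<sigma> :: real assume t: "0 \<le> \<sigma>" "\<sigma> \<le> 1"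
    define y where "y = z + \<sigma> *\<^sub>R d"
    have yU: "y \<in> U" using inU[OF t] by (simp add: y_def)
    show "((\<lambda>\<sigma>. \<sigma> * (H x d \<bullet> u) - G (z + \<sigma> *\<^sub>R d) \<bullet> u) has_real_derivative
        H x d \<bullet> u - H y d \<bullet> u) (at \<sigma>)"
      unfolding y_def
      by (intro DERIV_diff gradient_line_derivative inU t) (auto intro!: derivative_eq_intros)
    define k' where "k' = N x u * (\<rho> / (1 - \<rho>)) * ((1 - \<sigma> * \<rho>)\<^sup>2 / (1 - \<rho>)\<^sup>2 - 1)"
    have "((\<lambda>\<sigma>. \<sigma> - \<sigma>\<^sup>2 * \<rho> + \<sigma> ^ 3 * \<rho>\<^sup>2 / 3) has_real_derivative (1 - \<sigma> * \<rho>)\<^sup>2) (at \<sigma>)"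
      by (auto intro!: derivative_eq_intros simp: power2_eq_square algebra_simps)
    then have "(k has_real_derivative k' - 0) (at \<sigma>)"
      unfolding k_def k'_def
      by (intro DERIV_diff DERIV_cmult DERIV_cdivide DERIV_ident DERIV_const)
    then show "(k has_real_derivative k') (at \<sigma>)" by simp
    \<comment> \<open>the comparison factor between the intermediate point \<open>y\<close> and the end point \<open>x\<close>\<close>
    define c where "c = (1 - \<rho>) / (1 - \<sigma> * \<rho>)"
    have c: "0 < c" "c \<le> 1" using pos[OF t] r by (auto simp: c_def)
    define q where "q = N y ((1 - \<sigma>) *\<^sub>R d)"
    have xy: "x = y + (1 - \<sigma>) *\<^sub>R d" by (simp add: x_def y_def algebra_simps)
    have "q = (1 - \<sigma>) * N y d" using t by (simp add: q_def N_scale[OF yU])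
    also have "\<dots> \<le> (1 - \<sigma>) * (\<rho> / (1 - \<sigma> * \<rho>))"
      using directional_norm_bounds(1)[OF z inU[OF t] t(1)] pos[OF t] t
      by (intro mult_left_mono) (auto simp: \<rho>_def y_def)
    also have "\<dots> = 1 - c" using pos[OF t] by (simp add: c_def field_simps)
    finally have q: "c \<le> 1 - q" by simp
    have "c * N x v \<le> N y v" "N y v \<le> N x v / c" for v
    proof -
      have "N x v \<le> N y v / (1 - q)" "(1 - q) * N y v \<le> N x v"
        using hessian_comparison[OF yU, of "(1 - \<sigma>) *\<^sub>R d" v] xU q c by (auto simp: xy q_def)
      moreover have "N y v / (1 - q) \<le> N y v / c" using N_nonneg[OF yU] q c by (intro divide_left_mono) auto
      moreover have "c * N y v \<le> (1 - q) * N y v" using N_nonneg[OF yU] q by (intro mult_right_mono) auto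
      ultimately have "N x v \<le> N y v / c" "c * N y v \<le> N x v" by auto
      then show "c * N x v \<le> N y v" "N y v \<le> N x v / c" using c by (auto simp: field_simps)
    qed
    from hessian_diff_bound[OF xU yU c this, of d u]
    have "\<bar>(H y d - H x d) \<bullet> u\<bar> \<le> (1 / c\<^sup>2 - 1) * N x d * N x u" .
    also have "\<dots> \<le> (1 / c\<^sup>2 - 1) * (\<rho> / (1 - \<rho>)) * N x u"
      using directional_norm_bounds(1)[of z 1 d] z zd r c N_nonneg[OF xU]
      by (intro mult_right_mono mult_left_mono) (auto simp: \<rho>_def x_def power_le_one)
    also have "\<dots> = k'" by (simp add: k'_def c_def power_divide)
    finally show "H x d \<bullet> u - H y d \<bullet> u \<le> k'" by (simp add: inner_diff_left)
  qed (auto simp: k_def)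
  moreover have "k 1 + G z \<bullet> u = \<rho>\<^sup>2 * (1 - 2 * \<rho> / 3) / (1 - \<rho>) ^ 3 * N x u"
  proof -
    define e where "e = 1 - \<rho>"
    have e: "e \<noteq> 0" "\<rho> = 1 - e" using r by (auto simp: e_def)
    have "\<rho> / e * ((1 - \<rho> + \<rho>\<^sup>2 / 3) / e\<^sup>2 - 1) = \<rho>\<^sup>2 * (1 - 2 * \<rho> / 3) / e ^ 3"
    proof -
      have "(1 - \<rho> + \<rho>\<^sup>2 / 3) / e\<^sup>2 - 1 = \<rho> * (1 - 2 * \<rho> / 3) / e\<^sup>2"
        using e(1) by (simp add: field_simps) (simp add: e(2) power2_eq_square algebra_simps)
      then show ?thesis using e(1) by (simp add: power2_eq_square power3_eq_cube)
    qed
    moreover have "k 1 + G z \<bullet> u = \<rho> / e * ((1 - \<rho> + \<rho>\<^sup>2 / 3) / e\<^sup>2 - 1) * N x u"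
      by (simp add: k_def e_def mult_ac)
    ultimately show ?thesis by (simp only: e_def)
  qed
  ultimately show "(G z - G (z + d) + H (z + d) d) \<bullet> u \<le> \<rho>\<^sup>2 * (1 - 2 * \<rho> / 3) / (1 - \<rho>) ^ 3 * N (z + d) u"
    by (simp add: x_def inner_diff_left inner_add_left)
qed

lemma gradient_monotone:
  assumes x: "x \<in> U" and xh: "x + h \<in> U"
  shows "(N x h)\<^sup>2 / (1 + N x h) \<le> (G (x + h) - G x) \<bullet> h"
proof -
  define r where "r = N x h"
  have r: "0 \<le> r" using N_nonneg[OF x] by (auto simp: r_def)
  have inU: "x + \<tau> *\<^sub>R h \<in> U" if "0 \<le> \<tau>" "\<tau> \<le> 1" for \<tau> using segment_in[OF x xh] that by auto
  have "G x \<bullet> h + r\<^sup>2 * 1 / (1 + 1 * r) \<le> G (x + 1 *\<^sub>R h) \<bullet> h"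
  proof (rule first_order_comparison[where h = "\<lambda>\<tau>. G x \<bullet> h + r\<^sup>2 * \<tau> / (1 + \<tau> * r)"])
    fix \<tau> :: real assume t: "0 \<le> \<tau>" "\<tau> \<le> 1"
    have pos: "0 < 1 + \<tau> * r" using t r by (simp add: add_pos_nonneg)
    show "((\<lambda>\<tau>. G (x + \<tau> *\<^sub>R h) \<bullet> h) has_real_derivative H (x + \<tau> *\<^sub>R h) h \<bullet> h) (at \<tau>)"
      by (intro gradient_line_derivative inU t)
    show "((\<lambda>\<tau>. G x \<bullet> h + r\<^sup>2 * \<tau> / (1 + \<tau> * r)) has_real_derivative (r / (1 + \<tau> * r))\<^sup>2) (at \<tau>)"
      using pos by (auto intro!: derivative_eq_intros simp: power2_eq_square field_simps)
    have "(r / (1 + \<tau> * r))\<^sup>2 \<le> (N (x + \<tau> *\<^sub>R h) h)\<^sup>2"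
      using directional_norm_bounds(2)[OF x inU[OF t] t(1)] r pos by (intro power_mono) (auto simp: r_def)
    then show "(r / (1 + \<tau> * r))\<^sup>2 \<le> H (x + \<tau> *\<^sub>R h) h \<bullet> h" using N_sq[OF inU[OF t]] by simp
  qed auto
  then show ?thesis by (simp add: r_def inner_diff_left)
qed

text \<open>
  Along the segment the second derivative of \<open>F\<close> stays below \<open>(r / (1 - r))\<^sup>2\<close>, so \<open>F\<close> stays bounded,
  whereas it tends to infinity at the first point of the segment outside the interior.
\<close>

lemma Dikin_ellipsoid:
  assumes x: "x \<in> U" and r: "N x h < 1"
  shows "x + h \<in> U"
proof (rule ccontr)
  assume out: "x + h \<notin> U"
  define r where "r = N x h"
  have r: "0 \<le> r" "r < 1" using N_nonneg[OF x] r by (auto simp: r_def)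
  have h0: "h \<noteq> 0" using x out by auto
  define S where "S = {0..1} \<inter> (\<lambda>\<tau>. x + \<tau> *\<^sub>R h) -` (- U)"
  have "closed S" unfolding S_def
    by (intro continuous_closed_preimage continuous_intros) auto
  moreover have "bounded S" by (rule bounded_subset[of "{0..1}"]) (auto simp: S_def)
  moreover have "1 \<in> S" using out by (simp add: S_def)
  ultimately obtain T where T: "T \<in> S" "\<And>\<tau>. \<tau> \<in> S \<Longrightarrow> T \<le> \<tau>"
    using compact_attains_inf[of S] by (auto simp: compact_eq_bounded_closed)
  have T01: "0 \<le> T" "T \<le> 1" and Tout: "x + T *\<^sub>R h \<notin> U" using T(1) by (auto simp: S_def)
  have "T \<noteq> 0" using Tout x by auto
  then have T0: "0 < T" using T01 by simp
  have inU: "x + \<tau> *\<^sub>R h \<in> U" if "0 \<le> \<tau>" "\<tau> < T" for \<tau>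
    using T(2)[of \<tau>] that T01 by (fastforce simp: S_def)
  define p where "p = x + T *\<^sub>R h"
  have left: "\<forall>\<^sub>F \<tau> in at_left T. 0 < \<tau> \<and> \<tau> < T"
    using T0 unfolding eventually_at_left_field by auto
  have tend: "((\<lambda>\<tau>. x + \<tau> *\<^sub>R h) \<longlongrightarrow> p) (at_left T)"
    unfolding p_def by (intro tendsto_intros)
  have "p \<in> closure U"
  proof (rule Lim_in_closed_set[OF closed_closure _ _ tend])
    show "\<forall>\<^sub>F \<tau> in at_left T. x + \<tau> *\<^sub>R h \<in> closure U"
      using left by eventually_elim (use inU closure_subset in force)
  qed (simp add: trivial_limit_at_left_real)
  then have "p \<in> frontier Z"
    using Tout closure_mono[OF interior_subset[of Z]] by (auto simp: frontier_def p_def)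
  then have "filterlim F at_top (at p within U)" by (rule boundary)
  moreover have "filterlim (\<lambda>\<tau>. x + \<tau> *\<^sub>R h) (at p within U) (at_left T)"
    unfolding filterlim_at
  proof (intro conjI tend)
    show "\<forall>\<^sub>F \<tau> in at_left T. x + \<tau> *\<^sub>R h \<in> U \<and> x + \<tau> *\<^sub>R h \<noteq> p"
      using left by eventually_elim (use inU h0 in \<open>auto simp: p_def\<close>)
  qed
  ultimately have "filterlim (\<lambda>\<tau>. F (x + \<tau> *\<^sub>R h)) at_top (at_left T)"
    by (rule filterlim_compose)
  then have big: "\<forall>\<^sub>F \<tau> in at_left T. c < F (x + \<tau> *\<^sub>R h)" for c
    by (simp add: filterlim_at_top_dense)
  define m where "m = (r / (1 - r))\<^sup>2"
  have up: "F (x + t *\<^sub>R h) \<le> F x + \<bar>G x \<bullet> h\<bar> + m" if t: "0 < t" "t < T" for t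
  proof -
    have k: "((\<lambda>t. F x + t * (G x \<bullet> h) + m * t\<^sup>2 / 2) has_real_derivative G x \<bullet> h + m * s) (at s)"
      "((\<lambda>t. G x \<bullet> h + m * t) has_real_derivative m) (at s)" if "s = t" for s t :: real
      using that by (auto intro!: derivative_eq_intros)
    have low: "H (x + s *\<^sub>R h) h \<bullet> h \<le> m" if s: "0 \<le> s" "s \<le> t" for s
    proof -
      have s': "s < T" "s \<le> 1" using s t T01 by auto
      have sr: "s * r \<le> r" using mult_left_le_one_le[of r s] s s' r by simp
      have "N (x + s *\<^sub>R h) h \<le> r / (1 - s * r)"
        using directional_norm_bounds(1)[OF x inU[OF s(1) s'(1)] s(1)] sr r by (simp add: r_def)
      also have "\<dots> \<le> r / (1 - r)" using sr r by (intro divide_left_mono) auto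
      finally have "(N (x + s *\<^sub>R h) h)\<^sup>2 \<le> m"
        unfolding m_def using N_nonneg[OF inU[OF s(1) s'(1)]] by (intro power_mono) auto
      then show ?thesis using N_sq[OF inU[OF s(1) s'(1)]] by simp
    qed
    have "F (x + t *\<^sub>R h) \<le> F x + t * (G x \<bullet> h) + m * t\<^sup>2 / 2"
      by (rule second_order_comparison[OF _ _ _ line_derivative gradient_line_derivative k])
        (use t low inU in auto)
    also have "\<dots> \<le> F x + \<bar>G x \<bullet> h\<bar> + m"
    proof -
      have "t * (G x \<bullet> h) \<le> t * \<bar>G x \<bullet> h\<bar>" using t by (intro mult_left_mono) auto
      also have "\<dots> \<le> 1 * \<bar>G x \<bullet> h\<bar>" using t T01 by (intro mult_right_mono) auto
      finally have 1: "t * (G x \<bullet> h) \<le> \<bar>G x \<bullet> h\<bar>" by simp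
      have "m * t\<^sup>2 \<le> m * 1" using t T01 by (intro mult_left_mono power_le_one) (auto simp: m_def)
      moreover have "0 \<le> m" by (simp add: m_def)
      ultimately show ?thesis using 1 by simp
    qed
    finally show ?thesis .
  qed
  have "\<forall>\<^sub>F \<tau> in at_left T. False"
    using big[of "F x + \<bar>G x \<bullet> h\<bar> + m"] left by eventually_elim (use up in force)
  then show False by (simp add: trivial_limit_at_left_real)
qed

lemma hess_inverse:
  assumes z: "z \<in> U"
  shows "H z (matrix_inv (hess F z) *v v) = v"
proof -
  have "x = 0" if "H z x = 0" for x
    using hess_positive[OF z, of x] that by (cases "x = 0") auto
  then have "\<exists>B. B ** hess F z = mat 1" by (simp add: matrix_left_invertible_ker)
  then have "invertible (hess F z)" by (simp add: invertible_left_inverse)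
  then have "hess F z ** matrix_inv (hess F z) = mat 1"
    unfolding matrix_inv_def invertible_def by (rule someI2_ex) auto
  then show ?thesis by (simp add: matrix_vector_mul_assoc)
qed

text \<open>
  Symmetry of the Hessian turns the dual norm of \<open>e\<close> into the local norm of \<open>H\<^sup>-\<^sup>1 e\<close>.
\<close>

lemma dual_norm_inverse:
  assumes "z \<in> U"
  shows "dual_norm F z e = N z (matrix_inv (hess F z) *v e)"
  by (simp add: dual_norm_def local_norm_def hess_inverse[OF assms] inner_commute)

lemma dual_pairing:
  assumes z: "z \<in> U"
  shows "e \<bullet> u \<le> dual_norm F z e * N z u"
  using N_Cauchy_Schwarz[OF z, of "matrix_inv (hess F z) *v e" u]
  by (simp add: hess_inverse[OF z] dual_norm_inverse[OF z])

lemma dual_norm_le: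
  assumes z: "z \<in> U" and K: "0 \<le> K" and le: "\<And>u. e \<bullet> u \<le> K * N z u"
  shows "dual_norm F z e \<le> K"
proof -
  define w where "w = matrix_inv (hess F z) *v e"
  have "(N z w)\<^sup>2 = e \<bullet> w" using N_sq[OF z] hess_inverse[OF z, of e] by (simp add: w_def)
  also have "\<dots> \<le> K * N z w" by (rule le)
  finally have "N z w \<le> K"
    using K N_nonneg[OF z, of w] by (cases "N z w = 0") (auto simp: power2_eq_square)
  then show ?thesis by (simp add: dual_norm_inverse[OF z] w_def)
qed

text \<open>
  The barrier inequality at the multiple \<open>s u\<close> that maximises its left-hand side.
\<close>

lemma gradient_dual_bound:
  assumes z: "z \<in> U"
  shows "G z \<bullet> u \<le> sqrt \<nu> * N z u"
proof (cases "u = 0")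
  case False
  then have N: "0 < N z u" by (rule N_pos[OF z])
  define s where "s = (G z \<bullet> u) / (N z u)\<^sup>2"
  have "2 * (G z \<bullet> (s *\<^sub>R u)) - (N z (s *\<^sub>R u))\<^sup>2 \<le> \<nu>" by (rule barrier_parameter[OF z])
  moreover have "2 * (G z \<bullet> (s *\<^sub>R u)) - (N z (s *\<^sub>R u))\<^sup>2 = (G z \<bullet> u)\<^sup>2 / (N z u)\<^sup>2"
    using N by (simp add: s_def N_scale[OF z] power_mult_distrib power2_eq_square field_simps)
  ultimately have "(G z \<bullet> u)\<^sup>2 \<le> \<nu> * (N z u)\<^sup>2" using N by (simp add: divide_le_eq)
  also have "\<dots> = (sqrt \<nu> * N z u)\<^sup>2" using parameter_pos by (simp add: power_mult_distrib)
  finally show ?thesis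
    by (rule power2_le_imp_le[where x = "G z \<bullet> u"]) (use parameter_pos N in auto)
qed (use z in \<open>simp add: N_zero\<close>)

end

section \<open>Existence of resolvents\<close>

text \<open>
  Adding the pair \<open>(w, v)\<close> to the graph keeps it monotone, so it was there already.
\<close>

lemma maximally_monotone_memI:
  assumes A: "maximally_monotone A" and rel: "\<And>x a. a \<in> A x \<Longrightarrow> 0 \<le> (a - v) \<bullet> (x - w)"
  shows "v \<in> A w"
proof -
  define B where "B = A(w := insert v (A w))"
  have "monotone_op B"
    unfolding monotone_op_def
  proof (intro allI ballI)
    fix x y a b assume ab: "a \<in> B x" "b \<in> B y"
    have mono: "a \<in> A x \<Longrightarrow> b \<in> A y \<Longrightarrow> 0 \<le> (a - b) \<bullet> (x - y)"
      using A by (auto simp: maximally_monotone_def monotone_op_def)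
    have a: "a \<in> A x \<or> a = v \<and> x = w" and b: "b \<in> A y \<or> b = v \<and> y = w"
      using ab by (auto simp: B_def split: if_splits)
    have "(v - b) \<bullet> (w - y) = (b - v) \<bullet> (y - w)"
      by (simp add: inner_diff_left inner_diff_right)
    then show "0 \<le> (a - b) \<bullet> (x - y)" using a b mono rel[of a x] rel[of b y] by auto
  qed
  moreover have "\<forall>x. A x \<subseteq> B x" by (auto simp: B_def)
  ultimately have "B = A" using A unfolding maximally_monotone_def by blast
  then show ?thesis by (metis B_def fun_upd_same insertI1)
qed

lemma monotone_opD: "maximally_monotone A \<Longrightarrow> a \<in> A x \<Longrightarrow> b \<in> A y \<Longrightarrow> 0 \<le> (a - b) \<bullet> (x - y)"
  by (auto simp: maximally_monotone_def monotone_op_def)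

text \<open>
  Symmetrising the double sum turns it into minus one half of a sum of monotonicity terms.
\<close>

lemma monotone_family_average:
  fixes x a :: "'i \<Rightarrow> 'a::real_inner"
  assumes I: "finite I" and l: "\<And>i. i \<in> I \<Longrightarrow> 0 \<le> l i" "sum l I = 1"
    and mono: "\<And>i j. i \<in> I \<Longrightarrow> j \<in> I \<Longrightarrow> 0 \<le> (a i - a j) \<bullet> (x i - x j)"
  shows "(\<Sum>i\<in>I. l i * (a i \<bullet> ((\<Sum>j\<in>I. l j *\<^sub>R x j) - x i))) \<le> 0"
proof -
  define xb where "xb = (\<Sum>j\<in>I. l j *\<^sub>R x j)"
  have "a i \<bullet> (xb - x i) = (\<Sum>j\<in>I. l j * (a i \<bullet> (x j - x i)))" for i
    using l(2) by (simp add: xb_def inner_diff_right inner_sum_right right_diff_distrib sum_subtractf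
        sum_distrib_right[symmetric])
  then have T: "(\<Sum>i\<in>I. l i * (a i \<bullet> (xb - x i))) = (\<Sum>i\<in>I. \<Sum>j\<in>I. l i * l j * (a i \<bullet> (x j - x i)))"
    by (simp add: sum_distrib_left mult.assoc)
  also have "\<dots> = (\<Sum>i\<in>I. \<Sum>j\<in>I. l i * l j * (a j \<bullet> (x i - x j)))"
    by (subst sum.swap) (simp add: mult_ac)
  finally have "2 * (\<Sum>i\<in>I. l i * (a i \<bullet> (xb - x i)))
      = (\<Sum>i\<in>I. \<Sum>j\<in>I. l i * l j * (a i \<bullet> (x j - x i))) + (\<Sum>i\<in>I. \<Sum>j\<in>I. l i * l j * (a j \<bullet> (x i - x j)))"
    using T by simp
  also have "\<dots> = - (\<Sum>i\<in>I. \<Sum>j\<in>I. l i * l j * ((a i - a j) \<bullet> (x i - x j)))"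
    by (simp add: sum.distrib[symmetric] sum_negf[symmetric] inner_diff_left inner_diff_right algebra_simps)
  also have "\<dots> \<le> 0"
    using l(1) mono by (auto intro!: sum_nonneg mult_nonneg_nonneg)
  finally show ?thesis by (simp add: xb_def)
qed

context
  fixes K :: "'a::euclidean_space \<Rightarrow> 'a" and m :: real
  assumes K_lin: "linear K" and K_form: "inner_form (\<lambda>u v. K u \<bullet> v)"
    and m: "0 < m" and coercive: "\<And>x. m * norm x \<le> form_norm (\<lambda>u v. K u \<bullet> v) x"
begin

interpretation K: inner_form "\<lambda>u v. K u \<bullet> v" by (rule K_form)

lemma K_surj: "\<exists>w. K w = v"
proof -
  have "inj K"
  proof (rule linear_injective_0[OF K_lin, THEN iffD2], intro allI impI)
    fix x assume "K x = 0"
    then show "x = 0" using K.pos[of x] by (cases "x = 0") auto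
  qed
  then have "surj K" using linear_injective_imp_surjective[OF K_lin] by simp
  then show ?thesis by (metis surjD)
qed

lemma K_continuous: "continuous_on S K"
  using K_lin by (simp add: linear_continuous_on linear_linear)

text \<open>
  As a function of \<open>w\<close> the left-hand side is the quadratic form of \<open>K\<close> plus an affine function; \<open>W\<close>
  is its minimiser.
\<close>

lemma completed_square:
  assumes "2 *\<^sub>R K W = K (u + x) - a" and "C = (a - K u) \<bullet> x"
  shows "(a - K (u - w)) \<bullet> (w - x) = K w \<bullet> w - 2 * (K W \<bullet> w) - C"
proof -
  have "2 * (K W \<bullet> w) = K u \<bullet> w + K x \<bullet> w - a \<bullet> w"
    using arg_cong[OF assms(1), of "\<lambda>v. v \<bullet> w"] by (simp add: linear_add[OF K_lin] inner_diff_left inner_add_left)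
  moreover have "K w \<bullet> x = K x \<bullet> w" by (rule K.sym)
  ultimately show ?thesis
    unfolding assms(2) by (simp add: linear_diff[OF K_lin] inner_diff_left inner_diff_right)
qed

text \<open>
  The pairs in \<open>S\<close> give quadratics \<open>q(w) - 2 b(W\<^sub>i, w) - C\<^sub>i\<close> that have to be nonpositive at a common
  point. Let \<open>(w, c)\<close> minimise \<open>q(w) + c\<close> over the convex hull of the points \<open>(W\<^sub>i, C\<^sub>i)\<close>. First-order
  optimality says that each quadratic is at most \<open>- (q(w) + c)\<close> at \<open>w\<close>. This number is the minimal
  value of the corresponding average of the quadratics, and at the average of the base points that
  average is nonpositive by monotonicity. The hull is formed in a space that also
  records the pairs themselves, so that the weights of a hull point can be read as weights of pairs.
\<close>

lemma finite_monotone_extension: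
  assumes S: "finite S" and mono: "\<And>x a y b. (x, a) \<in> S \<Longrightarrow> (y, b) \<in> S \<Longrightarrow> 0 \<le> (a - b) \<bullet> (x - y)"
  shows "\<exists>w. \<forall>(x, a)\<in>S. 0 \<le> (a - K (u - w)) \<bullet> (x - w)"
proof (cases "S = {}")
  case False
  obtain W where W: "\<And>x a. 2 *\<^sub>R K (W (x, a)) = K (u + x) - a"
  proof -
    have "\<exists>w. 2 *\<^sub>R K w = K (u + fst s) - snd s" for s
    proof -
      obtain w where "K w = K (u + fst s) - snd s" using K_surj by blast
      then have "2 *\<^sub>R K ((1/2) *\<^sub>R w) = K (u + fst s) - snd s" by (simp add: linear_scale[OF K_lin])
      then show ?thesis by blast
    qed
    then show ?thesis using that by (metis fst_conv snd_conv)
  qed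
  define C where "C s = (snd s - K u) \<bullet> fst s" for s
  define T where "T = (\<lambda>s. (s, W s, C s)) ` S"
  have T: "finite T" "T \<noteq> {}" using S False by (auto simp: T_def)
  define \<gamma> where "\<gamma> e = K (fst (snd e)) \<bullet> fst (snd e) + snd (snd e)" for e :: "('a \<times> 'a) \<times> 'a \<times> real"
  have "compact (convex hull T)" using T by (simp add: finite_imp_compact_convex_hull)
  moreover have "convex hull T \<noteq> {}" using T by simp
  moreover have "continuous_on (convex hull T) \<gamma>"
    unfolding \<gamma>_def
    by (intro continuous_intros continuous_on_compose2[OF K_continuous[of UNIV]]) auto
  ultimately obtain e where e: "e \<in> convex hull T" "\<And>e'. e' \<in> convex hull T \<Longrightarrow> \<gamma> e \<le> \<gamma> e'"
    using continuous_attains_inf[of "convex hull T" \<gamma>] by blast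
  define w c where "w = fst (snd e)" and "c = snd (snd e)"
  have "0 \<le> \<gamma> e"
  proof -
    obtain l where l: "\<And>y. y \<in> T \<Longrightarrow> 0 \<le> l y" "sum l T = 1" "(\<Sum>y\<in>T. l y *\<^sub>R y) = e"
      using e(1) by (auto simp: convex_hull_finite[OF T(1)])
    define x a where "x y = fst (fst y)" and "a y = snd (fst y)" for y :: "('a \<times> 'a) \<times> 'a \<times> real"
    define xb where "xb = (\<Sum>y\<in>T. l y *\<^sub>R x y)"
    have w: "w = (\<Sum>y\<in>T. l y *\<^sub>R fst (snd y))" and c: "c = (\<Sum>y\<in>T. l y * snd (snd y))"
      unfolding w_def c_def l(3)[symmetric] by (simp_all add: fst_sum snd_sum)
    have sq: "(a y - K (u - xb)) \<bullet> (xb - x y) = K xb \<bullet> xb - 2 * (K (fst (snd y)) \<bullet> xb) - snd (snd y)"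
      if "y \<in> T" for y
    proof (rule completed_square)
      show "2 *\<^sub>R K (fst (snd y)) = K (u + x y) - a y"
        using that W by (auto simp: T_def x_def a_def)
      show "snd (snd y) = (a y - K u) \<bullet> x y"
        using that by (auto simp: T_def C_def x_def a_def)
    qed
    have "(\<Sum>y\<in>T. l y * ((a y - K (u - xb)) \<bullet> (xb - x y)))
      = (\<Sum>y\<in>T. l y * (a y \<bullet> (xb - x y))) - K (u - xb) \<bullet> (\<Sum>y\<in>T. l y *\<^sub>R (xb - x y))"
      by (simp add: inner_diff_left right_diff_distrib sum_subtractf inner_sum_right)
    also have "(\<Sum>y\<in>T. l y *\<^sub>R (xb - x y)) = 0"
      using l(2) by (simp add: scaleR_diff_right sum_subtractf scaleR_left.sum[symmetric] xb_def)
    also have "(\<Sum>y\<in>T. l y * (a y \<bullet> (xb - x y))) \<le> 0"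
      unfolding xb_def
      by (rule monotone_family_average[OF T(1) l(1,2)]) (use mono in \<open>auto simp: T_def a_def x_def\<close>)
    finally have "(\<Sum>y\<in>T. l y * ((a y - K (u - xb)) \<bullet> (xb - x y))) \<le> 0" by simp
    moreover have "(\<Sum>y\<in>T. l y * ((a y - K (u - xb)) \<bullet> (xb - x y)))
        = (\<Sum>y\<in>T. l y * (K xb \<bullet> xb - 2 * (K (fst (snd y)) \<bullet> xb) - snd (snd y)))"
      using sq by (intro sum.cong) auto
    moreover have "\<dots> = K xb \<bullet> xb - 2 * (K w \<bullet> xb) - c"
    proof -
      have "K w \<bullet> xb = (\<Sum>y\<in>T. l y * (K (fst (snd y)) \<bullet> xb))"
        unfolding w by (simp add: linear_sum[OF K_lin] linear_scale[OF K_lin] inner_sum_left)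
      then show ?thesis using l(2)
        by (simp add: right_diff_distrib sum_subtractf sum_distrib_right[symmetric] sum_distrib_left c mult_ac)
    qed
    moreover have "0 \<le> K (xb - w) \<bullet> (xb - w)" by (rule K.form_nonneg)
    ultimately show ?thesis
      by (simp add: \<gamma>_def w_def[symmetric] c_def[symmetric] K.bilinear K.sym[of xb w])
  qed
  have "0 \<le> (a - K (u - w)) \<bullet> (x - w)" if xa: "(x, a) \<in> S" for x a
  proof -
    define wi ci where "wi = W (x, a)" and "ci = C (x, a)"
    have ei: "((x, a), wi, ci) \<in> convex hull T"
      using xa by (intro hull_inc) (auto simp: T_def wi_def ci_def)
    have "0 \<le> 2 * (K w \<bullet> (wi - w)) + (ci - c) + s * (K (wi - w) \<bullet> (wi - w))" if s: "0 < s" "s \<le> 1" for s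
    proof -
      have "\<gamma> e \<le> \<gamma> ((1 - s) *\<^sub>R e + s *\<^sub>R ((x, a), wi, ci))"
        using s by (intro e(2) convexD_alt[OF convex_convex_hull e(1) ei]) auto
      also have "\<dots> = K (w + s *\<^sub>R (wi - w)) \<bullet> (w + s *\<^sub>R (wi - w)) + (c + s * (ci - c))"
        by (simp add: \<gamma>_def w_def c_def algebra_simps)
      also have "\<dots> = \<gamma> e + s * (2 * (K w \<bullet> (wi - w)) + (ci - c) + s * (K (wi - w) \<bullet> (wi - w)))"
        unfolding K.add_left K.add_right K.scale_left K.scale_right K.sym[of "wi - w" w]
        by (simp add: \<gamma>_def w_def c_def algebra_simps)
      finally show ?thesis using s by (simp add: zero_le_mult_iff)
    qed
    then have "\<forall>\<^sub>F s in at_right 0. 0 \<le> 2 * (K w \<bullet> (wi - w)) + (ci - c) + s * (K (wi - w) \<bullet> (wi - w))"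
      unfolding eventually_at_right_field by (intro exI[of _ 1]) auto
    moreover have "((\<lambda>s. 2 * (K w \<bullet> (wi - w)) + (ci - c) + s * (K (wi - w) \<bullet> (wi - w)))
        \<longlongrightarrow> 2 * (K w \<bullet> (wi - w)) + (ci - c) + 0 * (K (wi - w) \<bullet> (wi - w))) (at_right 0)"
      by (intro tendsto_intros)
    ultimately have "0 \<le> 2 * (K w \<bullet> (wi - w)) + (ci - c) + 0 * (K (wi - w) \<bullet> (wi - w))"
      by (intro tendsto_lowerbound) auto
    moreover have "(a - K (u - w)) \<bullet> (w - x) = K w \<bullet> w - 2 * (K wi \<bullet> w) - ci"
      by (rule completed_square) (auto simp: wi_def ci_def C_def W)
    moreover have "\<gamma> e = K w \<bullet> w + c" by (simp add: \<gamma>_def w_def c_def)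
    ultimately have "(a - K (u - w)) \<bullet> (w - x) \<le> 0"
      using \<open>0 \<le> \<gamma> e\<close> K.sym[of wi w] by (simp add: inner_diff_right)
    then show ?thesis by (simp add: inner_diff_right)
  qed
  then show ?thesis by blast
qed simp

text \<open>
  The conditions imposed on \<open>w\<close> by single elements of the graph are closed, and bounded since \<open>K\<close> is
  coercive. Finitely many of them are compatible by the previous lemma, hence all of them, and then
  maximality applies.
\<close>

theorem Minty_surjectivity:
  assumes A: "maximally_monotone A"
  shows "\<exists>w. K (u - w) \<in> A w"
proof (cases "\<exists>x0 a0. a0 \<in> A x0")
  case False
  then show ?thesis using maximally_monotone_memI[OF A] by blast
next
  case True
  then obtain x0 a0 where x0: "a0 \<in> A x0" by blast
  define R where "R s = {w. 0 \<le> (snd s - K (u - w)) \<bullet> (fst s - w)}" for s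
  have closed: "closed (R s)" for s
  proof -
    have "continuous_on UNIV (\<lambda>w. (snd s - K (u - w)) \<bullet> (fst s - w))"
      by (intro continuous_intros continuous_on_compose2[OF K_continuous[of UNIV]]) auto
    then have "closed ((\<lambda>w. (snd s - K (u - w)) \<bullet> (fst s - w)) -` {0..})"
      by (intro closed_vimage) auto
    moreover have "(\<lambda>w. (snd s - K (u - w)) \<bullet> (fst s - w)) -` {0..} = R s" by (auto simp: R_def)
    ultimately show ?thesis by simp
  qed
  have "bounded (R (x0, a0))"
  proof -
    obtain W where W': "K W = (1/2) *\<^sub>R (K (u + x0) - a0)" using K_surj by blast
    have W: "2 *\<^sub>R K W = K (u + x0) - a0" unfolding W' by simp
    define c where "c = \<bar>(a0 - K u) \<bullet> x0\<bar>"
    define L where "L = 2 * K.nrm W + c + 1"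
    have L: "1 \<le> L" by (simp add: L_def c_def)
    have "norm w \<le> L / m" if "w \<in> R (x0, a0)" for w
    proof -
      have "(a0 - K (u - w)) \<bullet> (w - x0) \<le> 0" using that by (simp add: R_def inner_diff_right)
      then have "K w \<bullet> w \<le> 2 * (K W \<bullet> w) + c"
        unfolding completed_square[OF W refl] c_def by linarith
      also have "\<dots> \<le> 2 * (K.nrm W * K.nrm w) + c" using K.Cauchy_Schwarz_form[of W w] by simp
      finally have le: "(K.nrm w)\<^sup>2 \<le> 2 * K.nrm W * K.nrm w + c" by (simp add: K.nrm_sq)
      have "K.nrm w \<le> L"
      proof (rule ccontr)
        assume "\<not> K.nrm w \<le> L"
        then have gt: "L < K.nrm w" by simp
        then have "L * K.nrm w < K.nrm w * K.nrm w" using L by (intro mult_strict_right_mono) auto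
        moreover have "c * 1 \<le> c * K.nrm w" using gt L by (intro mult_left_mono) (auto simp: c_def)
        ultimately show False using le gt L by (simp add: power2_eq_square L_def algebra_simps)
      qed
      then have "m * norm w \<le> L" using coercive[of w] by simp
      then show ?thesis using m by (simp add: le_divide_eq mult.commute)
    qed
    then show ?thesis by (auto simp: bounded_iff)
  qed
  then have cpt: "compact (R (x0, a0))" using closed by (simp add: compact_eq_bounded_closed)
  have fip: "R (x0, a0) \<inter> \<Inter>\<F> \<noteq> {}"
    if F: "finite \<F>" "\<F> \<subseteq> R ` {s. snd s \<in> A (fst s)}" for \<F>
  proof -
    obtain S where S: "S \<subseteq> {s. snd s \<in> A (fst s)}" "finite S" "\<F> = R ` S"
      using finite_subset_image[OF F] by blast
    have "\<exists>w. \<forall>(x, a)\<in>insert (x0, a0) S. 0 \<le> (a - K (u - w)) \<bullet> (x - w)"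
    proof (rule finite_monotone_extension)
      show "finite (insert (x0, a0) S)" using S by simp
      fix x a y b assume "(x, a) \<in> insert (x0, a0) S" "(y, b) \<in> insert (x0, a0) S"
      then have "a \<in> A x" "b \<in> A y" using S x0 by auto
      then show "0 \<le> (a - b) \<bullet> (x - y)" by (rule monotone_opD[OF A])
    qed
    then obtain w where "\<forall>s\<in>insert (x0, a0) S. w \<in> R s" by (auto simp: R_def case_prod_beta)
    then have "w \<in> R (x0, a0) \<inter> \<Inter>\<F>" by (simp add: S(3))
    then show ?thesis by blast
  qed
  have "R (x0, a0) \<inter> \<Inter>(R ` {s. snd s \<in> A (fst s)}) \<noteq> {}"
  proof (rule compact_imp_fip[OF cpt])
    show "closed T" if "T \<in> R ` {s. snd s \<in> A (fst s)}" for T using that closed by blast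
  qed (rule fip)
  then obtain w where w: "w \<in> \<Inter>(R ` {s. snd s \<in> A (fst s)})" by blast
  have "w \<in> R (x, a)" if "a \<in> A x" for x a
    using INT_D[OF w, of "(x, a)"] that by simp
  then have "K (u - w) \<in> A w" by (intro maximally_monotone_memI[OF A]) (auto simp: R_def)
  then show ?thesis by blast
qed

end

section \<open>One step of the inexact Newton scheme\<close>

lemma le_if_square_le_mult:
  fixes x K :: real
  assumes "x\<^sup>2 \<le> K * x" "0 \<le> K"
  shows "x \<le> K"
proof (rule ccontr)
  assume "\<not> x \<le> K"
  then have "K * x < x * x" using assms(2) by (intro mult_strict_right_mono) auto
  then show False using assms(1) by (simp add: power2_eq_square)
qed

text \<open>
  The bound for the new decrement when the old one is \<open>l\<close> and the tolerance is \<open>\<delta>\<close>.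
\<close>

definition step_bound :: "real \<Rightarrow> real \<Rightarrow> real" where
  "step_bound l \<delta> = (\<delta> + (l + \<delta>)\<^sup>2 / (1 - (l + \<delta>))) / (1 - (l + \<delta>))"

lemma step_bound_mono:
  assumes "0 \<le> l + \<delta>" "0 \<le> \<delta>" "\<delta> \<le> \<delta>'" "l + \<delta> \<le> l' + \<delta>'" "l' + \<delta>' < 1"
  shows "step_bound l \<delta> \<le> step_bound l' \<delta>'"
proof -
  define s s' where "s = l + \<delta>" and "s' = l' + \<delta>'"
  have "(\<delta> + s\<^sup>2 / (1 - s)) / (1 - s) \<le> (\<delta>' + s'\<^sup>2 / (1 - s')) / (1 - s')"
    using assms by (intro frac_le add_mono power_mono add_nonneg_nonneg divide_nonneg_pos) (auto simp: s_def s'_def)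
  then show ?thesis by (simp add: step_bound_def s_def s'_def)
qed

locale newton_scheme = barrier Z F \<nu>
  for Z :: "(real^'p) set" and F :: "real^'p \<Rightarrow> real" and \<nu> :: real +
  fixes A :: "real^'p \<Rightarrow> (real^'p) set" and t :: real
  assumes A: "maximally_monotone A" and t: "0 < t"
begin

abbreviation newton where "newton \<equiv> newton_point F A t"
abbreviation decr where "decr \<equiv> newton_decrement F A t"

lemma resolvent_unique:
  assumes z: "z \<in> U" and w: "t *\<^sub>R H z (u - w) \<in> A w" and w': "t *\<^sub>R H z (u - w') \<in> A w'"
  shows "w = w'"
proof (rule ccontr)
  assume "w \<noteq> w'"
  then have "0 < H z (w - w') \<bullet> (w - w')" by (intro hess_positive[OF z]) simp
  moreover have "0 \<le> (t *\<^sub>R H z (u - w) - t *\<^sub>R H z (u - w')) \<bullet> (w - w')"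
    by (rule monotone_opD[OF A w w'])
  moreover have "t *\<^sub>R H z (u - w) - t *\<^sub>R H z (u - w') = - (t *\<^sub>R H z (w - w'))"
    by (simp add: scaleR_diff_right[symmetric] matrix_vector_mult_diff_distrib scaleR_minus_right[symmetric] del: scaleR_minus_right)
  moreover have "0 < t * (H z (w - w') \<bullet> (w - w'))" using calculation(1) t by simp
  ultimately show False by simp
qed

lemma resolvent_exists:
  assumes z: "z \<in> U"
  shows "\<exists>w. t *\<^sub>R H z (u - w) \<in> A w"
proof -
  obtain m where m: "0 < m" "\<And>x. m * norm x \<le> N z x" using norm_le_local_norm[OF z] by blast
  have form: "inner_form (\<lambda>u v. (t *\<^sub>R H z u) \<bullet> v)"
  proof
    fix x y :: "real^'p" and w c
    show "(t *\<^sub>R H z x) \<bullet> y = (t *\<^sub>R H z y) \<bullet> x" using hessian_symmetric[OF z] by simp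
    show "x \<noteq> 0 \<Longrightarrow> 0 < (t *\<^sub>R H z x) \<bullet> x" using hess_positive[OF z] t by simp
  qed (auto simp: matrix_vector_right_distrib matrix_vector_mult_scaleR inner_add_left distrib_left)
  have "sqrt t * m * norm x \<le> form_norm (\<lambda>u v. (t *\<^sub>R H z u) \<bullet> v) x" for x
    using m(2)[of x] t by (simp add: form_norm_def local_norm_def real_sqrt_mult mult.assoc mult_left_mono)
  moreover have "linear (\<lambda>u. t *\<^sub>R H z u)"
    by (intro linearI) (auto simp: matrix_vector_right_distrib matrix_vector_mult_scaleR scaleR_right_distrib)
  ultimately show ?thesis
    using Minty_surjectivity[OF _ form, of "sqrt t * m" A u] m(1) t A by auto
qed

text \<open>
  Multiplying the defining equation of the resolvent by \<open>t H\<close> turns it into an inclusion for which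
  existence and uniqueness are known, so the description operator denotes a genuine solution.
\<close>

lemma newton_point:
  assumes z: "z \<in> U"
  shows "t *\<^sub>R (H z (z - newton z) - G z) \<in> A (newton z)"
proof -
  define u where "u = z - matrix_inv (hess F z) *v G z"
  have inj: "v = w" if "H z v = H z w" for v w
    using hess_positive[OF z, of "v - w"] that by (cases "v = w") (auto simp: matrix_vector_mult_diff_distrib)
  have char: "(\<exists>a\<in>A w. u = w + (1 / t) *\<^sub>R (matrix_inv (hess F z) *v a)) \<longleftrightarrow> t *\<^sub>R H z (u - w) \<in> A w" for w
  proof
    assume "\<exists>a\<in>A w. u = w + (1 / t) *\<^sub>R (matrix_inv (hess F z) *v a)"
    then obtain a where a: "a \<in> A w" "u - w = (1 / t) *\<^sub>R (matrix_inv (hess F z) *v a)" by auto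
    have "t *\<^sub>R H z (u - w) = a"
      unfolding a(2) using t by (simp add: matrix_vector_mult_scaleR hess_inverse[OF z])
    then show "t *\<^sub>R H z (u - w) \<in> A w" using a(1) by simp
  next
    assume a: "t *\<^sub>R H z (u - w) \<in> A w"
    have "H z ((1 / t) *\<^sub>R (matrix_inv (hess F z) *v (t *\<^sub>R H z (u - w)))) = H z (u - w)"
      using t by (simp add: matrix_vector_mult_scaleR hess_inverse[OF z])
    from inj[OF this] show "\<exists>a\<in>A w. u = w + (1 / t) *\<^sub>R (matrix_inv (hess F z) *v a)"
      using a by (intro bexI[of _ "t *\<^sub>R H z (u - w)"]) auto
  qed
  have ex1: "\<exists>!w. t *\<^sub>R H z (u - w) \<in> A w"
    using resolvent_exists[OF z] resolvent_unique[OF z] by blast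
  have "newton z = (THE w. t *\<^sub>R H z (u - w) \<in> A w)"
    unfolding newton_point_def scaled_resolvent_def u_def[symmetric] char ..
  then have "t *\<^sub>R H z (u - newton z) \<in> A (newton z)" using theI'[OF ex1] by simp
  moreover have "H z (u - newton z) = H z (z - newton z) - G z"
    by (simp add: u_def matrix_vector_mult_diff_distrib hess_inverse[OF z])
  ultimately show ?thesis by simp
qed

text \<open>
  The residual \<open>\<delta>\<close> of the linearised inclusion is expressed by pairings instead of the dual norm. The
  distance in \<open>newton_approx\<close> is an infimum, so it yields this property with every tolerance above
  the given one.
\<close>

definition approx :: "real^'p \<Rightarrow> real \<Rightarrow> real^'p \<Rightarrow> bool" where
  "approx x \<delta> y \<longleftrightarrow> (\<exists>a\<in>A y. \<forall>u. (G x + H x (y - x) + (1 / t) *\<^sub>R a) \<bullet> u \<le> \<delta> * N x u)"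

lemma approx_of_newton_approx:
  assumes x: "x \<in> U" and y: "newton_approx F A t \<delta> x y" and e: "0 < \<eta>"
  shows "approx x (\<delta> + \<eta>) y"
proof -
  have "dist_zero F x ((\<lambda>a. t *\<^sub>R (G x + H x (y - x)) + a) ` A y) < ereal (t * (\<delta> + \<eta>))"
    using y[unfolded newton_approx_def] t e by (auto elim: le_less_trans)
  then obtain a where a: "a \<in> A y" "dual_norm F x (t *\<^sub>R (G x + H x (y - x)) + a) < t * (\<delta> + \<eta>)"
    by (auto simp: dist_zero_def INF_less_iff)
  have "(G x + H x (y - x) + (1 / t) *\<^sub>R a) \<bullet> u \<le> (\<delta> + \<eta>) * N x u" for u
  proof -
    have "t * ((G x + H x (y - x) + (1 / t) *\<^sub>R a) \<bullet> u) = (t *\<^sub>R (G x + H x (y - x)) + a) \<bullet> u"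
      using t by (simp add: inner_add_left distrib_left)
    also have "\<dots> \<le> dual_norm F x (t *\<^sub>R (G x + H x (y - x)) + a) * N x u" by (rule dual_pairing[OF x])
    also have "\<dots> \<le> t * (\<delta> + \<eta>) * N x u"
      using a(2) N_nonneg[OF x] by (intro mult_right_mono) auto
    finally show ?thesis using t by (simp add: mult.assoc)
  qed
  then show ?thesis using a(1) by (auto simp: approx_def)
qed

text \<open>
  Test monotonicity at \<open>y\<close> and \<open>xb\<close>.
\<close>

lemma approx_distance:
  assumes x: "x \<in> U" and y: "approx x \<delta> y" and b: "t *\<^sub>R (H x (x - xb) - G x) \<in> A xb"
  shows "N x (y - xb) \<le> max \<delta> 0"
proof -
  obtain a where a: "a \<in> A y" and le: "\<And>u. (G x + H x (y - x) + (1 / t) *\<^sub>R a) \<bullet> u \<le> \<delta> * N x u"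
    using y by (auto simp: approx_def)
  define v where "v = y - xb"
  have "0 \<le> (a - t *\<^sub>R (H x (x - xb) - G x)) \<bullet> v"
    unfolding v_def by (rule monotone_opD[OF A a b])
  then have "0 \<le> (1 / t) * ((a - t *\<^sub>R (H x (x - xb) - G x)) \<bullet> v)" using t by simp
  also have "\<dots> = ((1 / t) *\<^sub>R a - (H x (x - xb) - G x)) \<bullet> v"
    using t by (simp add: inner_diff_left right_diff_distrib)
  also have "\<dots> = (G x + H x (y - x) + (1 / t) *\<^sub>R a) \<bullet> v - (N x v)\<^sup>2"
    unfolding N_sq[OF x] v_def by (simp add: matrix_vector_mult_diff_distrib inner_diff_left inner_add_left)
  finally have "(N x v)\<^sup>2 \<le> \<delta> * N x v" using le[of v] by simp
  also have "\<dots> \<le> max \<delta> 0 * N x v" using N_nonneg[OF x] by (intro mult_right_mono) auto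
  finally have "N x v \<le> max \<delta> 0" by (rule le_if_square_le_mult) simp
  then show ?thesis by (simp add: v_def)
qed

text \<open>
  Test monotonicity at \<open>y\<close> and the Newton point of \<open>y\<close>: the squared decrement is at most the pairing
  of \<open>y - newton y\<close> with the residual at \<open>x\<close> plus the linearisation error of the gradient. The factor
  \<open>1 / (1 - s)\<close> comes from passing from the norm at \<open>x\<close> to the norm at \<open>y\<close>.
\<close>

lemma approx_decrement:
  assumes x: "x \<in> U" and y: "approx x \<delta> y" and s: "N x (y - x) < 1" and \<delta>: "0 \<le> \<delta>"
  shows "decr y \<le> (\<delta> + (N x (y - x))\<^sup>2 / (1 - N x (y - x))) / (1 - N x (y - x))"
proof -
  define s where "s = N x (y - x)"
  have s: "0 \<le> s" "s < 1" using N_nonneg[OF x] s by (auto simp: s_def)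
  have yx: "y = x + (y - x)" by simp
  have yU: "y \<in> U" using Dikin_ellipsoid[OF x, of "y - x"] s by (simp add: s_def)
  obtain a where a: "a \<in> A y" and le: "\<And>u. (G x + H x (y - x) + (1 / t) *\<^sub>R a) \<bullet> u \<le> \<delta> * N x u"
    using y by (auto simp: approx_def)
  define w where "w = y - newton y"
  define R where "R = \<delta> + s\<^sup>2 / (1 - s)"
  have R: "0 \<le> R" using s \<delta> by (simp add: R_def)
  have "0 \<le> (a - t *\<^sub>R (H y w - G y)) \<bullet> w"
    unfolding w_def by (rule monotone_opD[OF A a newton_point[OF yU]])
  then have "0 \<le> (1 / t) * ((a - t *\<^sub>R (H y w - G y)) \<bullet> w)" using t by simp
  also have "\<dots> = ((1 / t) *\<^sub>R a + G y) \<bullet> w - (N y w)\<^sup>2"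
    using t by (simp add: N_sq[OF yU] inner_diff_left inner_add_left right_diff_distrib)
  finally have "(N y w)\<^sup>2 \<le> ((1 / t) *\<^sub>R a + G y) \<bullet> w" by simp
  also have "\<dots> = (G x + H x (y - x) + (1 / t) *\<^sub>R a) \<bullet> w + (G y - G x - H x (y - x)) \<bullet> w"
    by (simp add: inner_add_left inner_diff_left)
  also have "\<dots> \<le> \<delta> * N x w + s\<^sup>2 / (1 - s) * N x w"
    using le[of w] gradient_bound[OF x, of "y - x" w] yU s by (simp add: s_def)
  also have "\<dots> = R * N x w" by (simp add: R_def distrib_right)
  also have "\<dots> \<le> R * (N y w / (1 - s))"
  proof -
    have "(1 - s) * N x w \<le> N y w"
      using hessian_comparison(1)[OF x, of "y - x" w] yU s by (simp add: s_def)
    then show ?thesis using s R by (intro mult_left_mono) (auto simp: le_divide_eq mult.commute)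
  qed
  finally have "(N y w)\<^sup>2 \<le> (R / (1 - s)) * N y w" by simp
  then have "N y w \<le> R / (1 - s)" by (rule le_if_square_le_mult) (use s R in simp)
  then show ?thesis by (simp add: newton_decrement_def w_def R_def s_def)
qed

lemma decrement_nonneg: "x \<in> U \<Longrightarrow> 0 \<le> decr x"
  by (simp add: newton_decrement_def N_nonneg)

lemma approx_newton_point: "x \<in> U \<Longrightarrow> approx x 0 (newton x)"
  using newton_point[of x] t
  by (auto simp: approx_def matrix_vector_mult_diff_distrib intro!: bexI[OF _ newton_point[of x]])

lemma newton_step:
  assumes x: "x \<in> U" and y: "newton_approx F A t \<delta> x y" and \<delta>: "0 \<le> \<delta>"
    and small: "decr x + \<delta> < 1"
  shows "N x (y - newton x) \<le> \<delta>" "N x (y - x) \<le> decr x + \<delta>" "y \<in> U" "decr y \<le> step_bound (decr x) \<delta>"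
proof -
  show 1: "N x (y - newton x) \<le> \<delta>"
  proof (rule field_le_epsilon)
    fix e :: real assume e: "0 < e"
    show "N x (y - newton x) \<le> \<delta> + e"
      using approx_distance[OF x approx_of_newton_approx[OF x y e] newton_point[OF x]] \<delta> e by simp
  qed
  have "N x (y - x) \<le> N x (y - newton x) + N x (newton x - x)"
    using N_triangle[OF x, of "y - newton x" "newton x - x"] by simp
  also have "N x (newton x - x) = decr x"
    unfolding newton_decrement_def by (rule N_minus_commute[OF x])
  finally show 2: "N x (y - x) \<le> decr x + \<delta>" using 1 by simp
  show yU: "y \<in> U" using Dikin_ellipsoid[OF x, of "y - x"] 2 small by simp
  define s where "s = N x (y - x)"
  have s: "0 \<le> s" "s < 1" "s \<le> decr x + \<delta>" using 2 small N_nonneg[OF x] by (auto simp: s_def)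
  have "decr y \<le> (\<delta> + s\<^sup>2 / (1 - s)) / (1 - s)"
  proof (rule field_le_epsilon)
    fix e :: real assume e: "0 < e"
    have e': "0 < e * (1 - s)" using e s by simp
    have "decr y \<le> (\<delta> + e * (1 - s) + s\<^sup>2 / (1 - s)) / (1 - s)"
      using approx_decrement[OF x approx_of_newton_approx[OF x y e']] \<delta> e' s by (simp add: s_def)
    also have "\<dots> = (\<delta> + s\<^sup>2 / (1 - s)) / (1 - s) + e" using s by (simp add: add_divide_distrib)
    finally show "decr y \<le> (\<delta> + s\<^sup>2 / (1 - s)) / (1 - s) + e" .
  qed
  also have "\<dots> = step_bound (s - \<delta>) \<delta>" by (simp add: step_bound_def)
  also have "\<dots> \<le> step_bound (decr x) \<delta>" using s \<delta> small by (intro step_bound_mono) auto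
  finally show "decr y \<le> step_bound (decr x) \<delta>" .
qed

end

section \<open>Contraction towards the central path\<close>

context newton_scheme
begin

text \<open>
  The point of the central path of the barrier problem with parameter \<open>t\<close>.
\<close>

definition central :: "real^'p \<Rightarrow> bool" where
  "central z \<longleftrightarrow> z \<in> U \<and> - (t *\<^sub>R G z) \<in> A z"

lemma exact_newton_step:
  assumes x: "x \<in> U" and l: "decr x < 1"
  shows "newton x \<in> U" "decr (newton x) \<le> (decr x / (1 - decr x))\<^sup>2"
proof -
  have n: "N x (newton x - x) = decr x"
    unfolding newton_decrement_def by (rule N_minus_commute[OF x])
  then show "newton x \<in> U" using Dikin_ellipsoid[OF x, of "newton x - x"] l by simp
  have "decr (newton x) \<le> (0 + (decr x)\<^sup>2 / (1 - decr x)) / (1 - decr x)"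
    using approx_decrement[OF x approx_newton_point[OF x]] n l by simp
  then show "decr (newton x) \<le> (decr x / (1 - decr x))\<^sup>2" by (simp add: power2_eq_square)
qed

text \<open>
  From a decrement of at most \<open>3/50\<close> on, every exact step divides it by ten. The displacements, in the
  norm at the starting point, are at most \<open>1/15 (1/10)\<^sup>k\<close>, and \<open>2/27\<close> is the sum of that series.
\<close>

lemma exact_newton_orbit:
  assumes x: "x \<in> U" and l: "decr x \<le> 3/50"
  defines "X \<equiv> \<lambda>k. (newton ^^ k) x"
  shows "X k \<in> U \<and> decr (X k) \<le> 3/50 * (1/10) ^ k \<and> N x (X k - x) \<le> 2/27 * (1 - (1/10) ^ k)"
proof (induction k)
  case 0
  then show ?case using x l by (simp add: X_def N_zero)
next
  case (Suc k)
  define y where "y = X k"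
  define p :: real where "p = (1/10) ^ k"
  have p: "0 < p" "p \<le> 1" by (auto simp: p_def power_le_one)
  have y: "y \<in> U" "decr y \<le> 3/50 * p" "N x (y - x) \<le> 2/27 * (1 - p)"
    using Suc by (auto simp: y_def p_def)
  have l: "0 \<le> decr y" "decr y \<le> 3/50" using decrement_nonneg[OF y(1)] y(2) p by auto
  have Sy: "X (Suc k) = newton y" by (simp add: X_def y_def)
  have yU: "newton y \<in> U" using exact_newton_step(1)[OF y(1)] l by simp
  have "decr (newton y) \<le> (decr y / (1 - decr y))\<^sup>2" using exact_newton_step(2)[OF y(1)] l by simp
  also have "\<dots> \<le> 1/10 * decr y"
  proof -
    have "decr y / (1 - decr y) \<le> decr y / (47/50)" using l by (intro divide_left_mono) auto
    then have "(decr y / (1 - decr y))\<^sup>2 \<le> (decr y / (47/50))\<^sup>2"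
      using l by (intro power_mono) auto
    also have "\<dots> = (50/47)\<^sup>2 * decr y * decr y" by (simp add: power2_eq_square)
    also have "\<dots> \<le> (50/47)\<^sup>2 * (3/50) * decr y" using l by (intro mult_right_mono mult_left_mono) auto
    also have "\<dots> \<le> 1/10 * decr y" using l by (intro mult_right_mono) (auto simp: power2_eq_square)
    finally show ?thesis .
  qed
  also have "\<dots> \<le> 3/50 * (1/10) ^ Suc k" using y(2) by (simp add: p_def)
  finally have d: "decr (newton y) \<le> 3/50 * (1/10) ^ Suc k" .
  have "(1 - N x (y - x)) * N x (newton y - y) \<le> N y (newton y - y)"
    using hessian_comparison(1)[OF x, of "y - x"] y p by simp
  also have "N y (newton y - y) = decr y"
    unfolding newton_decrement_def by (rule N_minus_commute[OF y(1)])
  finally have "(1 - N x (y - x)) * N x (newton y - y) \<le> decr y" .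
  moreover have "9/10 * N x (newton y - y) \<le> (1 - N x (y - x)) * N x (newton y - y)"
    using y(3) p N_nonneg[OF x] by (intro mult_right_mono) auto
  ultimately have "N x (newton y - y) \<le> 1/15 * p" using y(2) by linarith
  have "N x (newton y - x) \<le> 1/15 * p + 2/27 * (1 - p)"
  proof -
    have "N x (newton y - x) \<le> N x (newton y - y) + N x (y - x)"
      using N_triangle[OF x, of "newton y - y" "y - x"] by simp
    then show ?thesis using y(3) \<open>N x (newton y - y) \<le> 1/15 * p\<close> by linarith
  qed
  then have "N x (newton y - x) \<le> 2/27 * (1 - (1/10) ^ Suc k)" by (simp add: p_def field_simps)
  then show ?case using d yU by (simp add: Sy)
qed

lemma local_norm_continuous: "continuous_on S (N x)"
  unfolding local_norm_def
  by (intro continuous_intros matrix_vector_mult_linear_continuous_on)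

text \<open>
  The exact Newton iterates converge by the geometric bound on the displacements. In the limit the
  correction term \<open>H (X\<^sub>k - X\<^sub>k\<^sub>+\<^sub>1)\<close> vanishes, and maximality makes the graph of \<open>A\<close> closed.
\<close>

theorem central_point_exists:
  assumes x: "x \<in> U" and l: "decr x \<le> 3/50"
  shows "\<exists>z. central z"
proof -
  define X where "X k = (newton ^^ k) x" for k
  have X: "X k \<in> U" "decr (X k) \<le> 3/50 * (1/10) ^ k" "N x (X k - x) \<le> 1/10" for k
  proof -
    have "N x (X k - x) \<le> 2/27 * (1 - (1/10) ^ k)" using exact_newton_orbit[OF x l, of k] by (simp add: X_def)
    also have "\<dots> \<le> 2/27 * (1 - 0)" by (intro mult_left_mono diff_left_mono) auto
    finally show "N x (X k - x) \<le> 1/10" by simp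
  qed (use exact_newton_orbit[OF x l, of k] in \<open>auto simp: X_def\<close>)
  have XS: "X (Suc k) = newton (X k)" for k by (simp add: X_def)
  obtain m where m: "0 < m" "\<And>v. m * norm v \<le> N x v" using norm_le_local_norm[OF x] by blast
  have lower: "9/10 * N x v \<le> N (X k) v" and upper: "N (X k) v \<le> N x v / (9/10)" for k v
  proof -
    have "9/10 * N x v \<le> (1 - N x (X k - x)) * N x v"
      using X(3)[of k] N_nonneg[OF x] by (intro mult_right_mono) auto
    then show "9/10 * N x v \<le> N (X k) v"
      using hessian_comparison(1)[OF x, of "X k - x" v] X[of k] by simp
    have "N (X k) v \<le> N x v / (1 - N x (X k - x))"
      using hessian_comparison(2)[OF x, of "X k - x" v] X[of k] by simp
    also have "\<dots> \<le> N x v / (9/10)" using X(3)[of k] N_nonneg[OF x] by (intro divide_left_mono) auto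
    finally show "N (X k) v \<le> N x v / (9/10)" .
  qed
  have inc: "norm (X (Suc k) - X k) \<le> 1 / (15 * m) * (1/10) ^ k" for k
  proof -
    have "9/10 * (m * norm (X (Suc k) - X k)) \<le> 9/10 * N x (X (Suc k) - X k)" using m by simp
    also have "\<dots> \<le> N (X k) (X (Suc k) - X k)" by (rule lower)
    also have "\<dots> = decr (X k)"
      unfolding newton_decrement_def XS by (rule N_minus_commute[OF X(1)])
    also have "\<dots> \<le> 3/50 * (1/10) ^ k" by (rule X(2))
    finally show ?thesis using m by (simp add: field_simps)
  qed
  have "summable (\<lambda>k. X (Suc k) - X k)"
    by (rule summable_comparison_test'[where N = 0 and g = "\<lambda>k. 1 / (15 * m) * (1/10) ^ k"])
      (rule summable_mult, simp, rule inc)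
  then have "convergent (\<lambda>n. \<Sum>k<n. X (Suc k) - X k)" by (simp add: summable_iff_convergent)
  then obtain L where "(\<lambda>n. X n - X 0) \<longlonglongrightarrow> L"
    by (auto simp: convergent_def sum_lessThan_telescope)
  from tendsto_add[OF this tendsto_const[of "X 0"]]
  obtain z where z: "X \<longlonglongrightarrow> z" by auto
  have zS: "(\<lambda>k. X (Suc k)) \<longlonglongrightarrow> z" using z by (rule LIMSEQ_Suc)
  have "(\<lambda>k. N x (X k - x)) \<longlonglongrightarrow> N x (z - x)"
    by (rule continuous_on_tendsto_compose[OF local_norm_continuous[of UNIV]]) (auto intro!: tendsto_intros z)
  then have "N x (z - x) \<le> 1/10" by (rule tendsto_upperbound) (intro always_eventually allI X(3), simp)
  then have zU: "z \<in> U" using Dikin_ellipsoid[OF x, of "z - x"] by simp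
  have GX: "(\<lambda>k. G (X k)) \<longlonglongrightarrow> G z"
    using has_derivative_continuous[OF hessian[OF zU]] z by (rule isCont_tendsto_compose)
  have "- (t *\<^sub>R G z) \<in> A z"
  proof (rule maximally_monotone_memI[OF A])
    fix y a assume a: "a \<in> A y"
    define rest where "rest k = H (X k) (X k - X (Suc k)) \<bullet> (y - X (Suc k))" for k
    have "rest \<longlonglongrightarrow> 0"
    proof (rule Lim_null_comparison)
      have "norm (rest k) \<le> 3/50 * (1/10) ^ k * ((N x (y - x) + 1/10) / (9/10))" for k
      proof -
        have "\<bar>rest k\<bar> \<le> N (X k) (X k - X (Suc k)) * N (X k) (y - X (Suc k))"
          unfolding rest_def by (rule N_Cauchy_Schwarz[OF X(1)])
        also have "N (X k) (X k - X (Suc k)) = decr (X k)"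
          by (simp add: newton_decrement_def XS)
        also have "decr (X k) * N (X k) (y - X (Suc k)) \<le> 3/50 * (1/10) ^ k * ((N x (y - x) + 1/10) / (9/10))"
        proof (rule mult_mono[OF X(2)])
          have "N x (y - X (Suc k)) \<le> N x (y - x) + 1/10"
            using N_triangle_diff[OF x, of "y - x" "X (Suc k) - x"] X(3)[of "Suc k"] by simp
          then show "N (X k) (y - X (Suc k)) \<le> (N x (y - x) + 1/10) / (9/10)"
            using upper[of k "y - X (Suc k)"] by (simp add: field_simps)
        qed (auto intro: N_nonneg X(1))
        finally show ?thesis by simp
      qed
      then show "\<forall>\<^sub>F k in sequentially. norm (rest k) \<le> 3/50 * (1/10) ^ k * ((N x (y - x) + 1/10) / (9/10))"
        by simp
      show "(\<lambda>k. 3/50 * (1/10) ^ k * ((N x (y - x) + 1/10) / (9/10))) \<longlonglongrightarrow> 0"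
        by (intro tendsto_mult_left_zero tendsto_mult_right_zero LIMSEQ_power_zero) auto
    qed
    then have "(\<lambda>k. (a + t *\<^sub>R G (X k)) \<bullet> (y - X (Suc k)) - t * rest k) \<longlonglongrightarrow> (a + t *\<^sub>R G z) \<bullet> (y - z) - t * 0"
      by (intro tendsto_intros GX zS)
    moreover have "0 \<le> (a + t *\<^sub>R G (X k)) \<bullet> (y - X (Suc k)) - t * rest k" for k
    proof -
      have "0 \<le> (a - t *\<^sub>R (H (X k) (X k - X (Suc k)) - G (X k))) \<bullet> (y - X (Suc k))"
        unfolding XS by (rule monotone_opD[OF A a newton_point[OF X(1)]])
      then show ?thesis by (simp add: rest_def inner_diff_left inner_add_left algebra_simps)
    qed
    ultimately have "0 \<le> (a + t *\<^sub>R G z) \<bullet> (y - z) - t * 0"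
      by (intro tendsto_lowerbound[of _ _ sequentially]) auto
    then show "0 \<le> (a - - (t *\<^sub>R G z)) \<bullet> (y - z)" by simp
  qed
  then show ?thesis using zU by (auto simp: central_def)
qed

lemma newton_central_pairing:
  assumes x: "x \<in> U" and z: "central z"
  shows "0 \<le> (H x (x - newton x) - G x + G z) \<bullet> (newton x - z)"
proof -
  have "0 \<le> (t *\<^sub>R (H x (x - newton x) - G x) - - (t *\<^sub>R G z)) \<bullet> (newton x - z)"
    using z by (intro monotone_opD[OF A newton_point[OF x]]) (simp add: central_def)
  also have "\<dots> = t * ((H x (x - newton x) - G x + G z) \<bullet> (newton x - z))"
    by (simp add: inner_add_left inner_diff_left algebra_simps)
  finally show ?thesis using t by (simp add: zero_le_mult_iff)
qed

text \<open>
  The lower bound \<open>gradient_monotone\<close> holds at any distance, so the distance of the Newton point from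
  the central path is controlled without assuming beforehand that it is small.
\<close>

lemma newton_point_near_central:
  assumes x: "x \<in> U" and l: "decr x < 1" and z: "central z"
  defines "u \<equiv> N (newton x) (newton x - z)"
  shows "u \<le> (decr x / (1 - decr x))\<^sup>2 * (1 + u)"
proof -
  define y where "y = newton x"
  define d where "d = y - z"
  have yU: "y \<in> U" using exact_newton_step(1)[OF x l] by (simp add: y_def)
  have zU: "z \<in> U" using z by (simp add: central_def)
  have n: "N x (y - x) = decr x"
    unfolding newton_decrement_def y_def by (rule N_minus_commute[OF x])
  have l0: "0 \<le> decr x" by (rule decrement_nonneg[OF x])
  have u0: "0 \<le> u" unfolding u_def y_def[symmetric] by (rule N_nonneg[OF yU])
  have u: "N y (- d) = u" 
    by (simp add: u_def y_def d_def N_minus_commute[OF yU[unfolded y_def], of z])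
  \<comment> \<open>the base point of the estimate is \<open>y\<close>, hence the signs\<close>
  have "u\<^sup>2 / (1 + u) \<le> (G (y + - d) - G y) \<bullet> (- d)"
    using gradient_monotone[OF yU, of "- d"] zU unfolding u by (simp add: d_def)
  also have "\<dots> = (G y - G z) \<bullet> d"
    using zU by (simp add: d_def inner_diff_left inner_diff_right)
  also have "\<dots> \<le> (G (x + (y - x)) - G x - H x (y - x)) \<bullet> d"
  proof -
    have "H x (x - y) = - H x (y - x)" by (simp add: matrix_vector_mult_diff_distrib)
    then show ?thesis
      using newton_central_pairing[OF x z] by (simp add: y_def[symmetric] d_def[symmetric] inner_diff_left inner_add_left)
  qed
  also have "\<dots> \<le> (decr x)\<^sup>2 / (1 - decr x) * N x d"
    using gradient_bound[OF x, of "y - x" d] yU l n by simp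
  also have "\<dots> \<le> (decr x)\<^sup>2 / (1 - decr x) * (u / (1 - decr x))"
  proof -
    have "(1 - decr x) * N x d \<le> N y d"
      using hessian_comparison(1)[OF x, of "y - x" d] yU l n by simp
    then have "N x d \<le> u / (1 - decr x)"
      using l by (simp add: u_def y_def d_def le_divide_eq mult.commute)
    then show ?thesis using l l0 by (intro mult_left_mono) auto
  qed
  also have "\<dots> = (decr x / (1 - decr x))\<^sup>2 * u" by (simp add: power2_eq_square)
  finally have "u\<^sup>2 \<le> (decr x / (1 - decr x))\<^sup>2 * (1 + u) * u"
    using u0 by (simp add: divide_le_eq mult_ac)
  then show ?thesis by (rule le_if_square_le_mult) (use u0 in simp)
qed

text \<open>
  The norm at the fixed point \<open>z\<close> avoids a conversion between norms at successive iterates. The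
  exact Newton point is compared with \<open>z\<close> by monotonicity, and the inexact one is within \<open>\<delta>\<close> of it.
\<close>

lemma newton_step_towards_central:
  assumes z: "central z" and x: "x \<in> U" and y: "newton_approx F A t \<delta> x y" and \<delta>: "0 \<le> \<delta>"
    and \<rho>: "N z (x - z) < 1"
  defines "\<rho> \<equiv> N z (x - z)"
  shows "N z (y - z) \<le> (\<delta> + \<rho>\<^sup>2 * (1 - 2 * \<rho> / 3) / (1 - \<rho>) ^ 3) / (1 - \<rho>)"
proof -
  have zU: "z \<in> U" using z by (simp add: central_def)
  have r: "0 \<le> \<rho>" "\<rho> < 1" using N_nonneg[OF zU] \<rho> by (auto simp: \<rho>_def)
  define E where "E = \<rho>\<^sup>2 * (1 - 2 * \<rho> / 3) / (1 - \<rho>) ^ 3"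
  have E: "0 \<le> E" using r by (simp add: E_def)
  define u where "u = newton x - z"
  have "(N x u)\<^sup>2 \<le> (G z - G x + H x (x - z)) \<bullet> u"
    using newton_central_pairing[OF x z]
    by (simp add: u_def N_sq[OF x] matrix_vector_mult_diff_distrib inner_diff_left inner_add_left)
  also have "\<dots> \<le> E * N x u"
    using gradient_bound_at_endpoint[OF zU, of "x - z" u] x r by (simp add: \<rho>_def E_def)
  finally have "N x u \<le> E" by (rule le_if_square_le_mult) (rule E)
  moreover have "N x (y - newton x) \<le> \<delta>"
  proof (rule field_le_epsilon)
    fix e :: real assume e: "0 < e"
    show "N x (y - newton x) \<le> \<delta> + e"
      using approx_distance[OF x approx_of_newton_approx[OF x y e] newton_point[OF x]] \<delta> e by simp
  qed
  ultimately have "N x (y - z) \<le> \<delta> + E"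
    using N_triangle[OF x, of "y - newton x" u] by (simp add: u_def)
  moreover have "(1 - \<rho>) * N z (y - z) \<le> N x (y - z)"
    using hessian_comparison(1)[OF zU, of "x - z" "y - z"] x r by (simp add: \<rho>_def)
  ultimately have "(1 - \<rho>) * N z (y - z) \<le> \<delta> + E" by simp
  then show ?thesis using r by (simp add: E_def le_divide_eq mult.commute)
qed

text \<open>
  An element of \<open>A y\<close> is the residual minus \<open>t\<close> times the linearised gradient, and the gradient has dual
  norm at most \<open>sqrt \<nu>\<close>.
\<close>

lemma residual_bound:
  assumes x: "x \<in> U" and y: "newton_approx F A t \<delta> x y" and \<delta>: "0 \<le> \<delta>"
    and s: "N x (y - x) < 1"
  shows "y \<in> U" "dist_zero F y (A y) \<le> ereal (t * ((\<delta> + sqrt \<nu> + N x (y - x)) / (1 - N x (y - x))))"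
proof -
  define s where "s = N x (y - x)"
  have s: "0 \<le> s" "s < 1" using N_nonneg[OF x] s by (auto simp: s_def)
  show yU: "y \<in> U" using Dikin_ellipsoid[OF x, of "y - x"] s by (simp add: s_def)
  have "dist_zero F y (A y) \<le> ereal (t * ((\<delta> + sqrt \<nu> + s) / (1 - s))) + ereal e" if e: "0 < e" for e
  proof -
    define \<eta> where "\<eta> = e * (1 - s) / t"
    have \<eta>: "0 < \<eta>" using e s t by (simp add: \<eta>_def)
    define B where "B = \<delta> + \<eta> + sqrt \<nu> + s"
    have B: "0 \<le> B" using \<delta> \<eta> s parameter_pos by (simp add: B_def)
    obtain a where a: "a \<in> A y"
      and le: "\<And>u. (G x + H x (y - x) + (1 / t) *\<^sub>R a) \<bullet> u \<le> (\<delta> + \<eta>) * N x u"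
      using approx_of_newton_approx[OF x y \<eta>] by (auto simp: approx_def)
    have "a \<bullet> u \<le> (t * (B / (1 - s))) * N y u" for u
    proof -
      have "(1 / t) * (a \<bullet> u) = (G x + H x (y - x) + (1 / t) *\<^sub>R a) \<bullet> u + G x \<bullet> (- u) + H x (y - x) \<bullet> (- u)"
        by (simp add: inner_add_left)
      also have "\<dots> \<le> (\<delta> + \<eta>) * N x u + sqrt \<nu> * N x (- u) + s * N x (- u)"
        using le[of u] gradient_dual_bound[OF x, of "- u"] N_Cauchy_Schwarz[OF x, of "y - x" "- u"]
        unfolding s_def by linarith
      also have "\<dots> = B * N x u" by (simp add: N_minus[OF x] B_def distrib_right)
      also have "\<dots> \<le> B * (N y u / (1 - s))"
      proof -
        have "(1 - s) * N x u \<le> N y u"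
          using hessian_comparison(1)[OF x, of "y - x" u] yU s by (simp add: s_def)
        then show ?thesis using s B by (intro mult_left_mono) (auto simp: le_divide_eq mult.commute)
      qed
      finally have "t * ((1 / t) * (a \<bullet> u)) \<le> t * (B * (N y u / (1 - s)))"
        using t by (intro mult_left_mono) auto
      then show ?thesis using t by simp
    qed
    then have "dual_norm F y a \<le> t * (B / (1 - s))"
      using B s t by (intro dual_norm_le[OF yU]) auto
    also have "\<dots> = t * ((\<delta> + sqrt \<nu> + s) / (1 - s)) + e"
      using s t by (simp add: B_def \<eta>_def field_simps)
    finally show ?thesis
      unfolding dist_zero_def using a by (intro INF_lower2[of a]) auto
  qed
  then show "dist_zero F y (A y) \<le> ereal (t * ((\<delta> + sqrt \<nu> + N x (y - x)) / (1 - N x (y - x))))"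
    unfolding s_def[symmetric] by (rule ereal_le_epsilon2)
qed

end

section \<open>Numerical estimates\<close>

lemma step_bound_eq:
  assumes "l + \<delta> < 1"
  shows "step_bound l \<delta> = (\<delta> * (1 - (l + \<delta>)) + (l + \<delta>)\<^sup>2) / (1 - (l + \<delta>))\<^sup>2"
proof -
  define e where "e = 1 - (l + \<delta>)"
  have "e \<noteq> 0" using assms by (simp add: e_def)
  then have "(\<delta> + (l + \<delta>)\<^sup>2 / e) / e = (\<delta> * e + (l + \<delta>)\<^sup>2) / e\<^sup>2"
    by (simp add: field_simps power2_eq_square)
  then show ?thesis by (simp add: step_bound_def e_def)
qed

text \<open>
  The invariance of the radius needs only \<open>\<delta> (1 + 3\<beta> - 2\<beta>\<^sup>2) \<le> \<beta> (1 - 3\<beta> + \<beta>\<^sup>2)\<close>, which \<open>delta_max\<close>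
  satisfies with room to spare.
\<close>

lemma delta_max_bounds:
  assumes b: "0 < \<beta>" "\<beta> < (3 - sqrt 5) / 2"
  shows "\<beta> < 2/5" "delta_max \<beta> \<le> \<beta>" "delta_max \<beta> * (1 + 3 * \<beta> - 2 * \<beta>\<^sup>2) \<le> \<beta> * (1 - 3 * \<beta> + \<beta>\<^sup>2)"
proof -
  have "11/5 \<le> sqrt 5" by (rule real_le_rsqrt) (simp add: power2_eq_square)
  then show b2: "\<beta> < 2/5" using b by simp
  have "sqrt 5 < 3 - 2 * \<beta>" using b by simp
  then have "(sqrt 5)\<^sup>2 < (3 - 2 * \<beta>)\<^sup>2" by (intro power_strict_mono) auto
  then have q: "0 < 1 - 3 * \<beta> + \<beta>\<^sup>2" by (simp add: power2_diff)
  define D where "D = 2 * \<beta> ^ 3 - 5 * \<beta>\<^sup>2 + 3 * \<beta> + 1"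
  define E where "E = 1 + 3 * \<beta> - 2 * \<beta>\<^sup>2"
  have bb: "\<beta>\<^sup>2 \<le> 2/5 * \<beta>" using b b2 by (simp add: power2_eq_square)
  have E1: "1 \<le> E" using bb b by (simp add: E_def)
  have D1: "0 < D" using bb b zero_le_power[of \<beta> 3] unfolding D_def by linarith
  have poly: "D - (1 - \<beta>)\<^sup>2 * E = \<beta> * (2 + 2 * \<beta> - 5 * \<beta>\<^sup>2 + 2 * \<beta> ^ 3)"
    by (simp add: D_def E_def power2_eq_square power3_eq_cube algebra_simps)
  have "0 \<le> 2 + 2 * \<beta> - 5 * \<beta>\<^sup>2 + 2 * \<beta> ^ 3" using bb b b2 zero_le_power[of \<beta> 3] by linarith
  then have "(1 - \<beta>)\<^sup>2 * E \<le> D" using poly b by (smt (verit) mult_nonneg_nonneg)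
  moreover have "(1 - \<beta>) ^ 4 \<le> (1 - \<beta>)\<^sup>2" using b b2 by (intro power_decreasing) auto
  then have "(1 - \<beta>) ^ 4 * E \<le> (1 - \<beta>)\<^sup>2 * E" using E1 by (intro mult_right_mono) auto
  ultimately have "(1 - \<beta>) ^ 4 * E / D \<le> 1" using D1 by simp
  then have "\<beta> * (1 - 3 * \<beta> + \<beta>\<^sup>2) * ((1 - \<beta>) ^ 4 * E / D) \<le> \<beta> * (1 - 3 * \<beta> + \<beta>\<^sup>2) * 1"
    using b q by (intro mult_left_mono) auto
  then show main: "delta_max \<beta> * (1 + 3 * \<beta> - 2 * \<beta>\<^sup>2) \<le> \<beta> * (1 - 3 * \<beta> + \<beta>\<^sup>2)"
    unfolding delta_max_def D_def[symmetric] E_def[symmetric] by (simp add: mult_ac)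
  have "0 \<le> delta_max \<beta>"
    unfolding delta_max_def D_def[symmetric] using b b2 q D1 by simp
  then have "delta_max \<beta> * 1 \<le> delta_max \<beta> * E" using E1 by (intro mult_left_mono)
  also have "\<dots> \<le> \<beta> * (1 - 3 * \<beta> + \<beta>\<^sup>2)" using main by (simp add: E_def)
  also have "\<dots> \<le> \<beta> * 1" using b bb by (intro mult_left_mono) auto
  finally show "delta_max \<beta> \<le> \<beta>" by simp
qed

text \<open>
  With \<open>l = \<beta>\<close> the claim \<open>step_bound \<beta> \<delta> \<le> \<beta>\<close> is quadratic in \<open>\<delta>\<close>; dropping the nonnegative term
  \<open>\<beta> \<delta>\<^sup>2\<close> leaves the linear condition of the previous lemma.
\<close>

lemma step_bound_delta_max:
  assumes b: "0 < \<beta>" "\<beta> < (3 - sqrt 5) / 2" and d: "0 \<le> \<delta>" "\<delta> \<le> delta_max \<beta>"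
    and l: "0 \<le> l" "l \<le> \<beta>"
  shows "l + \<delta> < 1" "step_bound l \<delta> \<le> \<beta>"
proof -
  note m = delta_max_bounds[OF b]
  have s: "\<beta> + \<delta> < 1" using m d by linarith
  then show "l + \<delta> < 1" using l by simp
  have bb: "\<beta>\<^sup>2 \<le> 2/5 * \<beta>" using b m(1) by (simp add: power2_eq_square)
  have "\<delta> * (1 + 3 * \<beta> - 2 * \<beta>\<^sup>2) \<le> delta_max \<beta> * (1 + 3 * \<beta> - 2 * \<beta>\<^sup>2)"
    using d bb b by (intro mult_right_mono) auto
  then have "\<delta> * (1 + 3 * \<beta> - 2 * \<beta>\<^sup>2) \<le> \<beta> * (1 - 3 * \<beta> + \<beta>\<^sup>2)" using m(3) by simp
  moreover have "\<beta> * (1 - (\<beta> + \<delta>))\<^sup>2 - (\<delta> * (1 - (\<beta> + \<delta>)) + (\<beta> + \<delta>)\<^sup>2)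
      = \<beta> * (1 - 3 * \<beta> + \<beta>\<^sup>2) - \<delta> * (1 + 3 * \<beta> - 2 * \<beta>\<^sup>2) + \<beta> * \<delta>\<^sup>2"
    by (simp add: power2_eq_square algebra_simps)
  moreover have "0 \<le> \<beta> * \<delta>\<^sup>2" using b by simp
  ultimately have "\<delta> * (1 - (\<beta> + \<delta>)) + (\<beta> + \<delta>)\<^sup>2 \<le> \<beta> * (1 - (\<beta> + \<delta>))\<^sup>2" by linarith
  then have "step_bound \<beta> \<delta> \<le> \<beta>" unfolding step_bound_eq[OF s] using s by (simp add: divide_le_eq)
  moreover have "step_bound l \<delta> \<le> step_bound \<beta> \<delta>" using l d s by (intro step_bound_mono) auto
  ultimately show "step_bound l \<delta> \<le> \<beta>" by simp
qed

lemma newton_rate_split: "l < 1/2 \<Longrightarrow> newton_rate l = 2 / (1 - 2 * l)\<^sup>2 + l\<^sup>2 / (1 - 2 * l) ^ 3"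
  by (simp add: newton_rate_def power2_eq_square power3_eq_cube divide_simps)

lemma newton_rate_mono:
  assumes "0 \<le> l" "l \<le> b" "b < 1/2"
  shows "newton_rate l \<le> newton_rate b"
proof -
  have "2 / (1 - 2 * l)\<^sup>2 + l\<^sup>2 / (1 - 2 * l) ^ 3 \<le> 2 / (1 - 2 * b)\<^sup>2 + b\<^sup>2 / (1 - 2 * b) ^ 3"
    using assms by (intro add_mono frac_le power_mono) auto
  then show ?thesis using assms by (simp add: newton_rate_split)
qed

lemma newton_rate_pos: "0 \<le> l \<Longrightarrow> l < 1/2 \<Longrightarrow> 0 < newton_rate l"
  by (simp add: newton_rate_def add_pos_nonneg)

lemma newton_rate_contraction:
  assumes "0 \<le> b" "b \<le> 0.18858"
  shows "newton_rate b * b < 1"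
proof -
  have "newton_rate b * b \<le> newton_rate 0.18858 * 0.18858"
    using assms newton_rate_pos[of b] newton_rate_pos[of "0.18858"] by (intro mult_mono newton_rate_mono) auto
  also have "\<dots> < 1" by (simp add: newton_rate_def power2_eq_square power3_eq_cube)
  finally show ?thesis .
qed

lemma newton_rate_square_less_one:
  assumes "0 \<le> l" "l \<le> 0.287"
  shows "newton_rate l * l\<^sup>2 < 1"
proof -
  have "newton_rate l * l\<^sup>2 \<le> newton_rate 0.287 * 0.287\<^sup>2"
    using assms newton_rate_pos[of l] newton_rate_pos[of "0.287"] by (intro mult_mono newton_rate_mono power_mono) auto
  also have "\<dots> < 1" by (simp add: newton_rate_def power2_eq_square power3_eq_cube)
  finally show ?thesis .
qed

text \<open>
  For the largest admissible tolerance the bound equals \<open>(2 - 2l) / (1 - 2l)\<^sup>2\<close> times \<open>l\<^sup>2\<close>, slightly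
  less than the stated rate.
\<close>

lemma step_bound_newton_rate:
  assumes l: "0 \<le> l" "l < 1/2" and d: "0 \<le> \<delta>" "\<delta> \<le> l\<^sup>2 / (1 - l)"
  shows "l + \<delta> < 1" "step_bound l \<delta> \<le> newton_rate l * l\<^sup>2"
proof -
  define \<delta>' where "\<delta>' = l\<^sup>2 / (1 - l)"
  have s: "l + \<delta>' = l / (1 - l)" using l by (simp add: \<delta>'_def field_simps power2_eq_square)
  have s1: "l + \<delta>' < 1" unfolding s using l by simp
  then show "l + \<delta> < 1" using d by (simp add: \<delta>'_def)
  define e where "e = 1 - 2 * l"
  have e: "0 < e" using l by (simp add: e_def)
  have 1: "1 - (l + \<delta>') = e / (1 - l)" unfolding s using l by (simp add: e_def field_simps)
  have "step_bound l \<delta> \<le> step_bound l \<delta>'"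
    using l d s1 by (intro step_bound_mono) (auto simp: \<delta>'_def)
  also have "\<dots> = (\<delta>' * (e / (1 - l)) + (l / (1 - l))\<^sup>2) / (e / (1 - l))\<^sup>2"
    unfolding step_bound_eq[OF s1] 1 by (simp only: s)
  also have "\<dots> = (l\<^sup>2 * e + l\<^sup>2) / e\<^sup>2"
    using l e by (simp add: \<delta>'_def power_divide divide_simps) (simp add: power2_eq_square algebra_simps)
  also have "\<dots> = (e + 1) * e / e ^ 3 * l\<^sup>2"
    using e by (simp add: power2_eq_square power3_eq_cube field_simps)
  also have "\<dots> \<le> newton_rate l * l\<^sup>2"
  proof -
    have "l * l \<le> l * (2/3)" using l by (intro mult_left_mono) auto
    then have "(e + 1) * e \<le> 2 - 4 * l + l\<^sup>2" by (simp add: e_def power2_eq_square algebra_simps)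
    then have "(e + 1) * e / e ^ 3 \<le> newton_rate l"
      unfolding newton_rate_def e_def[symmetric] using e by (intro divide_right_mono) auto
    then show ?thesis by (intro mult_right_mono) auto
  qed
  finally show "step_bound l \<delta> \<le> newton_rate l * l\<^sup>2" .
qed

lemma beta_seq_0: "beta_seq \<beta> 0 = \<beta>"
  by (simp add: beta_seq_def)

lemma beta_seq_Suc: "beta_seq \<beta> (Suc k) = newton_rate \<beta> * (beta_seq \<beta> k)\<^sup>2"
proof -
  have "(2::nat) ^ Suc k - 1 = Suc (2 * (2 ^ k - 1))"
    using one_le_power[of "2::nat" k] unfolding power_Suc by arith
  then have "newton_rate \<beta> ^ (2 ^ Suc k - 1) = newton_rate \<beta> * (newton_rate \<beta> ^ (2 ^ k - 1))\<^sup>2"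
    by (simp add: power_mult[symmetric] mult.commute)
  moreover have "\<beta> ^ 2 ^ Suc k = (\<beta> ^ 2 ^ k)\<^sup>2" by (simp add: power_mult[symmetric] mult.commute)
  ultimately show ?thesis by (simp add: beta_seq_def power_mult_distrib)
qed

lemma beta_seq_bounds:
  assumes b: "0 < \<beta>" "\<beta> \<le> 0.18858"
  defines "\<theta> \<equiv> newton_rate \<beta> * \<beta>"
  shows "0 < beta_seq \<beta> k" "beta_seq \<beta> k \<le> \<beta> * \<theta> ^ k"
proof -
  have c: "0 < newton_rate \<beta>" using b by (intro newton_rate_pos) auto
  have th: "0 < \<theta>" "\<theta> < 1" using newton_rate_contraction[of \<beta>] b c by (auto simp: \<theta>_def)
  have "0 < beta_seq \<beta> k \<and> beta_seq \<beta> k \<le> \<beta> * \<theta> ^ k" for k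
  proof (induction k)
    case (Suc k)
    have "beta_seq \<beta> k \<le> \<beta> * 1"
      using Suc th b by (intro order_trans[OF conjunct2[OF Suc]] mult_left_mono power_le_one) auto
    then have "newton_rate \<beta> * (beta_seq \<beta> k * beta_seq \<beta> k) \<le> newton_rate \<beta> * (\<beta> * (\<beta> * \<theta> ^ k))"
      using Suc b c by (intro mult_left_mono mult_mono) auto
    then show ?case using Suc c by (simp add: beta_seq_Suc power2_eq_square \<theta>_def mult_ac)
  qed (use b in \<open>auto simp: beta_seq_0\<close>)
  then show "0 < beta_seq \<beta> k" "beta_seq \<beta> k \<le> \<beta> * \<theta> ^ k" by auto
qed

lemma beta_seq_le:
  assumes b: "0 < \<beta>" "\<beta> \<le> 0.18858"
  shows "beta_seq \<beta> k \<le> \<beta>"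
proof -
  have "0 < newton_rate \<beta>" using b by (intro newton_rate_pos) auto
  then have "\<beta> * (newton_rate \<beta> * \<beta>) ^ k \<le> \<beta> * 1"
    using newton_rate_contraction[of \<beta>] b by (intro mult_left_mono power_le_one) auto
  then show ?thesis using beta_seq_bounds(2)[OF b, of k] by simp
qed

lemma delta_seq_bounds:
  assumes b: "0 < \<beta>" "\<beta> \<le> 0.18858"
  shows "0 \<le> delta_seq \<beta> k" "delta_seq \<beta> k \<le> 5/2 * (beta_seq \<beta> k)\<^sup>2" "delta_seq \<beta> k \<le> 0.0877"
proof -
  define x where "x = beta_seq \<beta> k"
  have x: "0 \<le> x" "x \<le> 0.18858"
    using beta_seq_bounds(1)[OF b, of k] beta_seq_le[OF b, of k] b by (auto simp: x_def)
  show "0 \<le> delta_seq \<beta> k" using x by (simp add: delta_seq_def x_def[symmetric])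
  have "2 * x\<^sup>2 / (1 - x) \<le> 2 * x\<^sup>2 / (1 - 0.18858)" using x by (intro divide_left_mono) auto
  also have "\<dots> \<le> 5/2 * x\<^sup>2" using zero_le_power2[of x] by (simp add: field_simps)
  finally show "delta_seq \<beta> k \<le> 5/2 * (beta_seq \<beta> k)\<^sup>2" by (simp add: delta_seq_def x_def)
  have "2 * x\<^sup>2 / (1 - x) \<le> 2 * 0.18858\<^sup>2 / (1 - 0.18858)"
    using x by (intro frac_le mult_left_mono power_mono) auto
  also have "\<dots> \<le> 0.0877" by (simp add: power2_eq_square)
  finally show "delta_seq \<beta> k \<le> 0.0877" by (simp add: delta_seq_def x_def)
qed

lemma newton_rate_le_9: "0 \<le> \<beta> \<Longrightarrow> \<beta> \<le> 0.18858 \<Longrightarrow> newton_rate \<beta> \<le> 9"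
proof -
  assume b: "0 \<le> \<beta>" "\<beta> \<le> 0.18858"
  then have "newton_rate \<beta> \<le> newton_rate 0.18858" by (intro newton_rate_mono) auto
  also have "\<dots> \<le> 9" by (simp add: newton_rate_def power2_eq_square power3_eq_cube)
  finally show ?thesis .
qed

text \<open>
  On \<open>[0, 0.18]\<close> the factor \<open>(1 - 2\<rho>/3) / (1 - \<rho>)\<^sup>3\<close> is at most \<open>8/5\<close>, by the tangent of the cube at
  \<open>1 - 0.18\<close>. The value \<open>0.0877\<close> bounds all tolerances in \<open>delta_seq\<close>, and \<open>0.18\<close> is invariant
  under the resulting map.
\<close>

lemma central_step_contraction:
  fixes \<rho> \<delta> :: real
  assumes r: "0 \<le> \<rho>" "\<rho> \<le> 0.18" and d: "0 \<le> \<delta>" "\<delta> \<le> 0.0877"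
  defines "\<rho>' \<equiv> (\<delta> + \<rho>\<^sup>2 * (1 - 2 * \<rho> / 3) / (1 - \<rho>) ^ 3) / (1 - \<rho>)"
  shows "\<rho>' \<le> 2 * \<delta> + 2 * \<rho>\<^sup>2" "\<rho>' \<le> 0.18"
proof -
  define v where "v = 9/50 - \<rho>"
  have v: "0 \<le> v" "1 - \<rho> = 41/50 + v" "\<rho> = 9/50 - v" using r by (auto simp: v_def)
  have "(41/50 + v) ^ 3 = (41/50) ^ 3 + 3 * (41/50)\<^sup>2 * v + (3 * (41/50) + v) * v\<^sup>2"
    by (simp only: power2_eq_square power3_eq_cube algebra_simps)
  moreover have "0 \<le> (3 * (41/50) + v) * v\<^sup>2" using v by simp
  ultimately have "(41/50) ^ 3 + 3 * (41/50)\<^sup>2 * v \<le> (1 - \<rho>) ^ 3" unfolding v(2) by linarith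
  moreover have "1 - 2 * \<rho> / 3 \<le> 8/5 * ((41/50) ^ 3 + 3 * (41/50)\<^sup>2 * v)"
    unfolding v(3) using v(1) by (simp add: power2_eq_square power3_eq_cube diff_divide_distrib)
  ultimately have "1 - 2 * \<rho> / 3 \<le> 8/5 * (1 - \<rho>) ^ 3" by simp
  then have "(1 - 2 * \<rho> / 3) / (1 - \<rho>) ^ 3 \<le> 1.6" using r by (simp add: divide_le_eq)
  then have "\<rho>\<^sup>2 * ((1 - 2 * \<rho> / 3) / (1 - \<rho>) ^ 3) \<le> \<rho>\<^sup>2 * 1.6" by (intro mult_left_mono) auto
  then have "\<rho>' \<le> (\<delta> + 1.6 * \<rho>\<^sup>2) / (1 - \<rho>)"
    unfolding \<rho>'_def using r by (intro divide_right_mono) auto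
  also have "\<dots> \<le> (\<delta> + 1.6 * \<rho>\<^sup>2) / 0.82" using r d by (intro divide_left_mono) auto
  finally have le: "\<rho>' \<le> (\<delta> + 1.6 * \<rho>\<^sup>2) / 0.82" .
  then have "41 * \<rho>' \<le> 50 * \<delta> + 80 * \<rho>\<^sup>2" by simp
  moreover have "0 \<le> \<rho>\<^sup>2" by simp
  ultimately show "\<rho>' \<le> 2 * \<delta> + 2 * \<rho>\<^sup>2" using d(1) by linarith
  have "\<rho>\<^sup>2 \<le> 0.18\<^sup>2" using r by (intro power_mono) auto
  then show "\<rho>' \<le> 0.18" using le d by (simp add: power2_eq_square)
qed

text \<open>
  The recursion starts at index 1 because the distance to the central point is controlled only after
  the first step. Once \<open>\<beta>\<^sub>k \<le> 0.01\<close>, the distances contract linearly up to \<open>0.0005\<close>, so two more steps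
  bring \<open>\<rho>\<close> below \<open>1/18\<close>. From there \<open>9 max(\<rho>, \<beta>\<^sub>k)\<close> is at least squared in every step. The index \<open>K\<close>
  is the same for all sequences \<open>\<rho>\<close>, which makes the iteration count uniform over all problems.
\<close>

lemma doubly_exponential_decay:
  assumes b: "0 < \<beta>" "\<beta> \<le> 0.18858"
  shows "\<exists>K\<ge>1. \<forall>\<rho>. \<rho> 1 \<le> 0.18 \<and> (\<forall>k\<ge>1. 0 \<le> \<rho> k \<and> (\<rho> k \<le> 0.18 \<longrightarrow>
      \<rho> (Suc k) \<le> 2 * delta_seq \<beta> k + 2 * (\<rho> k)\<^sup>2 \<and> \<rho> (Suc k) \<le> (0.18::real))) \<longrightarrow>
    (\<forall>k\<ge>1. \<rho> k \<le> 0.18) \<and>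
    (\<forall>j. 9 * \<rho> (K + j) \<le> (1/2) ^ (2 ^ j) \<and> 9 * beta_seq \<beta> (K + j) \<le> (1/2) ^ (2 ^ j))"
proof -
  define \<theta> where "\<theta> = newton_rate \<beta> * \<beta>"
  have c: "0 < newton_rate \<beta>" "newton_rate \<beta> \<le> 9"
    using b newton_rate_le_9[of \<beta>] by (auto intro: newton_rate_pos)
  have th: "0 < \<theta>" "\<theta> < 1" using newton_rate_contraction[of \<beta>] b c by (auto simp: \<theta>_def)
  obtain n where n: "\<theta> ^ n < 0.01" using real_arch_pow_inv[of "0.01" \<theta>] th by auto
  have small: "beta_seq \<beta> k \<le> 0.01" if k: "n \<le> k" for k
  proof -
    have "beta_seq \<beta> k \<le> \<beta> * \<theta> ^ k" using beta_seq_bounds(2)[OF b] by (simp add: \<theta>_def)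
    also have "\<dots> \<le> 1 * \<theta> ^ n" using b th k by (intro mult_mono power_decreasing) auto
    finally show ?thesis using n by simp
  qed
  define K where "K = n + 3"
  have "(\<forall>k\<ge>1. \<rho> k \<le> 0.18) \<and>
      (\<forall>j. 9 * \<rho> (K + j) \<le> (1/2) ^ (2 ^ j) \<and> 9 * beta_seq \<beta> (K + j) \<le> (1/2) ^ (2 ^ j))"
    if start: "\<rho> 1 \<le> (0.18::real)" and nonneg: "\<And>k. 1 \<le> k \<Longrightarrow> 0 \<le> \<rho> k"
      and step: "\<And>k. 1 \<le> k \<Longrightarrow> \<rho> k \<le> 0.18 \<Longrightarrow> \<rho> (Suc k) \<le> 2 * delta_seq \<beta> k + 2 * (\<rho> k)\<^sup>2 \<and> \<rho> (Suc k) \<le> 0.18" for \<rho>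
  proof -
    have r18: "\<rho> k \<le> 0.18" if "1 \<le> k" for k
      using that by (induction k rule: dec_induct) (use start step in auto)
    have rec: "\<rho> (Suc k) \<le> 5 * (beta_seq \<beta> k)\<^sup>2 + 2 * (\<rho> k)\<^sup>2" if k: "1 \<le> k" for k
      using step[OF k r18[OF k]] delta_seq_bounds(2)[OF b, of k] by simp
    have lin: "\<rho> (Suc k) \<le> 0.0005 + 0.36 * \<rho> k" if k: "1 \<le> k" "n \<le> k" for k
    proof -
      have "(beta_seq \<beta> k)\<^sup>2 \<le> 0.01\<^sup>2"
        using small[OF k(2)] beta_seq_bounds(1)[OF b, of k] by (intro power_mono) auto
      moreover have "(\<rho> k)\<^sup>2 \<le> 0.18 * \<rho> k"
        using mult_right_mono[OF r18[OF k(1)] nonneg[OF k(1)]] by (simp add: power2_eq_square)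
      ultimately show ?thesis using rec[OF k(1)] by (simp add: power2_eq_square)
    qed
    have "\<rho> (Suc (Suc (Suc n))) \<le> 1/18"
      using lin[of "Suc n"] lin[of "Suc (Suc n)"] r18[of "Suc n"] by simp
    then have rK: "9 * \<rho> K \<le> 1/2" by (simp add: K_def numeral_3_eq_3)
    have bK: "9 * beta_seq \<beta> K \<le> 1/2" using small[of K] by (simp add: K_def)
    have "9 * \<rho> (K + j) \<le> (1/2) ^ (2 ^ j) \<and> 9 * beta_seq \<beta> (K + j) \<le> (1/2) ^ (2 ^ j)" for j
    proof (induction j)
      case (Suc j)
      define q :: real where "q = (1/2) ^ (2 ^ j)"
      have q2: "(1/2::real) ^ (2 ^ Suc j) = q\<^sup>2" by (simp add: q_def power_mult[symmetric] mult.commute)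
      have k: "1 \<le> K + j" by (simp add: K_def)
      have rq: "(9 * \<rho> (K + j))\<^sup>2 \<le> q\<^sup>2" using Suc nonneg[OF k] by (intro power_mono) (auto simp: q_def)
      have bq: "(9 * beta_seq \<beta> (K + j))\<^sup>2 \<le> q\<^sup>2"
        using Suc beta_seq_bounds(1)[OF b, of "K + j"] by (intro power_mono) (auto simp: q_def)
      have "9 * \<rho> (Suc (K + j)) \<le> 9 * (5 * (beta_seq \<beta> (K + j))\<^sup>2 + 2 * (\<rho> (K + j))\<^sup>2)"
        using rec[OF k] by simp
      also have "\<dots> \<le> q\<^sup>2"
      proof -
        have "81 * (\<rho> (K + j))\<^sup>2 \<le> q\<^sup>2" "81 * (beta_seq \<beta> (K + j))\<^sup>2 \<le> q\<^sup>2"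
          using rq bq by (simp_all add: power_mult_distrib)
        moreover have combine: "9 * (5 * y + 2 * x) \<le> Q" if "81 * x \<le> Q" "81 * y \<le> Q" "0 \<le> Q" for x y Q :: real
          using that by simp
        ultimately show ?thesis by (intro combine) auto
      qed
      finally have 1: "9 * \<rho> (Suc (K + j)) \<le> q\<^sup>2" .
      have "9 * beta_seq \<beta> (Suc (K + j)) \<le> 9 * (9 * (beta_seq \<beta> (K + j))\<^sup>2)"
        unfolding beta_seq_Suc using c by (intro mult_left_mono mult_right_mono) auto
      also have "\<dots> \<le> q\<^sup>2" using bq by (simp add: power_mult_distrib)
      finally have "9 * beta_seq \<beta> (Suc (K + j)) \<le> q\<^sup>2" .
      with 1 show ?case unfolding q2 add_Suc_right by (rule conjI)
    qed (use rK bK in simp)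
    then show ?thesis using r18 by blast
  qed
  then show ?thesis by (intro exI[of _ K]) (auto simp: K_def)
qed

definition loglog :: "real \<Rightarrow> nat" where
  "loglog e = nat \<lceil>log 2 (log 2 (1 / e))\<rceil>"

lemma half_power_loglog:
  assumes e: "0 < e" "e < 1"
  shows "(1/2) ^ (2 ^ loglog e) \<le> e"
proof -
  have l: "0 < log 2 (1 / e)" using e by simp
  have "log 2 (1 / e) = 2 powr (log 2 (log 2 (1 / e)))" using l by simp
  also have "\<dots> \<le> 2 powr real (loglog e)"
    unfolding loglog_def by (intro powr_mono real_nat_ceiling_ge) simp
  also have "\<dots> = real (2 ^ loglog e)" by (simp add: powr_realpow)
  finally have le: "log 2 (1 / e) \<le> real (2 ^ loglog e)" .
  have "1 / e = 2 powr (log 2 (1 / e))" using e by simp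
  also have "\<dots> \<le> 2 powr real (2 ^ loglog e)" using le by (intro powr_mono) auto
  also have "\<dots> = 2 ^ (2 ^ loglog e)" by (subst powr_realpow) auto
  finally show ?thesis using e by (simp add: power_divide field_simps)
qed

text \<open>
  The estimate uses \<open>e < 1\<close> near 0, where the iterated logarithm is meaningful.
\<close>

lemma loglog_bigo: "(\<lambda>e. real (K + loglog e)) \<in> O[at_right 0](\<lambda>e. ln (ln (1 / e)))"
proof -
  define C where "C = real K + 1 + \<bar>ln (ln 2)\<bar> / ln 2 + 1 / ln (2::real)"
  have "filterlim (\<lambda>e::real. ln (ln (inverse e))) at_top (at_right 0)"
    by (intro filterlim_compose[OF ln_at_top] filterlim_inverse_at_top_right)
  then have "\<forall>\<^sub>F e::real in at_right 0. 1 \<le> ln (ln (inverse e))"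
    by (simp add: filterlim_at_top)
  moreover have lt1: "\<forall>\<^sub>F e::real in at_right 0. e < 1"
    unfolding eventually_at_right_field by (intro exI[of _ 1]) auto
  ultimately have "\<forall>\<^sub>F e::real in at_right 0. norm (real (K + loglog e)) \<le> C * norm (ln (ln (1 / e)))"
    using eventually_at_right_less[of 0] lt1
  proof eventually_elim
    case (elim e)
    define L where "L = ln (ln (1 / e))"
    have L: "1 \<le> L" using elim by (simp add: L_def inverse_eq_divide)
    have l2: "0 < ln (2::real)" by simp
    have lne: "0 < ln (1 / e)" using elim by simp
    have eq: "log 2 (log 2 (1 / e)) = (L - ln (ln 2)) / ln 2"
      using lne l2 by (simp add: log_def ln_div L_def)
    have "real (loglog e) \<le> \<bar>log 2 (log 2 (1 / e))\<bar> + 1"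
      unfolding loglog_def by linarith
    also have "\<dots> \<le> (L + \<bar>ln (ln 2)\<bar>) / ln 2 + 1"
      unfolding eq abs_divide using L l2 by (auto intro!: divide_right_mono)
    finally have "real (K + loglog e) \<le> (real K + 1 + \<bar>ln (ln 2)\<bar> / ln 2) * 1 + 1 / ln 2 * L"
      by (simp add: add_divide_distrib)
    also have "\<dots> \<le> (real K + 1 + \<bar>ln (ln 2)\<bar> / ln 2) * L + 1 / ln 2 * L"
      using L l2 by (intro add_mono mult_left_mono add_nonneg_nonneg divide_nonneg_pos) auto
    also have "\<dots> = C * L" by (simp add: C_def algebra_simps)
    finally show ?case using L by (simp add: L_def)
  qed
  then show ?thesis by (rule bigoI)
qed

section \<open>Convergence of the scheme\<close>

context newton_scheme
begin

lemma inexact_newton_invariant: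
  assumes b: "0 < \<beta>" "\<beta> < (3 - sqrt 5) / 2"
    and seq: "FGN_sequence F A t \<delta> z" and z0: "z 0 \<in> neighborhood Z F A t \<beta>"
    and \<delta>: "\<And>k. \<delta> k \<le> delta_max \<beta>"
  shows "z k \<in> neighborhood Z F A t \<beta>"
proof (induction k)
  case (Suc k)
  then have x: "z k \<in> U" "decr (z k) \<le> \<beta>" by (auto simp: neighborhood_def)
  have s: "0 \<le> \<delta> k" "newton_approx F A t (\<delta> k) (z k) (z (Suc k))"
    using seq by (auto simp: FGN_sequence_def)
  note sb = step_bound_delta_max[OF b s(1) \<delta> decrement_nonneg[OF x(1)] x(2)]
  show ?case
    using newton_step(3,4)[OF x(1) s(2,1) sb(1)] sb(2) by (auto simp: neighborhood_def)
qed (rule z0)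

lemma inexact_newton_quadratic_step:
  assumes seq: "FGN_sequence F A t \<delta> z" and \<delta>: "\<delta> k \<le> (decr (z k))\<^sup>2 / (1 - decr (z k))"
    and x: "z k \<in> U" "decr (z k) < 1/2"
  shows "z (Suc k) \<in> U" "decr (z (Suc k)) \<le> newton_rate (decr (z k)) * (decr (z k))\<^sup>2"
proof -
  have s: "0 \<le> \<delta> k" "newton_approx F A t (\<delta> k) (z k) (z (Suc k))"
    using seq by (auto simp: FGN_sequence_def)
  note sb = step_bound_newton_rate[OF decrement_nonneg[OF x(1)] x(2) s(1) \<delta>]
  show "z (Suc k) \<in> U" "decr (z (Suc k)) \<le> newton_rate (decr (z k)) * (decr (z k))\<^sup>2"
    using newton_step(3,4)[OF x(1) s(2,1) sb(1)] sb(2) by auto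
qed

text \<open>
  Below \<open>0.18858\<close> the factor \<open>newton_rate l * l\<close> is less than 1, so the decrement does not increase.
\<close>

lemma inexact_newton_stays:
  assumes seq: "FGN_sequence F A t \<delta> z" and \<delta>: "\<And>k. \<delta> k \<le> (decr (z k))\<^sup>2 / (1 - decr (z k))"
    and b: "\<beta> \<le> 0.18858" and z0: "z 0 \<in> neighborhood Z F A t \<beta>"
  shows "z k \<in> neighborhood Z F A t \<beta>"
proof (induction k)
  case (Suc k)
  then have x: "z k \<in> U" "decr (z k) \<le> \<beta>" by (auto simp: neighborhood_def)
  have l: "0 \<le> decr (z k)" "decr (z k) < 1/2" "decr (z k) \<le> 0.18858"
    using decrement_nonneg[OF x(1)] x(2) b by auto
  have "newton_rate (decr (z k)) * (decr (z k))\<^sup>2 = newton_rate (decr (z k)) * decr (z k) * decr (z k)"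
    by (simp add: power2_eq_square)
  also have "\<dots> \<le> 1 * decr (z k)"
    using newton_rate_contraction[OF l(1,3)] l by (intro mult_right_mono) auto
  finally show ?case
    using inexact_newton_quadratic_step[OF seq \<delta> x(1) l(2)] x(2) by (auto simp: neighborhood_def)
qed (rule z0)

lemma inexact_newton_decrements:
  assumes seq: "FGN_sequence F A t \<delta> z" and z0: "z 0 \<in> U"
    and \<delta>: "\<forall>k. \<delta> k \<le> (decr (z k))\<^sup>2 / (1 - decr (z k))"
  shows "(\<forall>k. z k \<in> U \<and> decr (z k) < 1 / 2 \<longrightarrow> z (Suc k) \<in> U \<and>
      decr (z (Suc k)) \<le> newton_rate (decr (z k)) * (decr (z k))\<^sup>2 \<and>
      (decr (z k) \<le> 0.287 \<longrightarrow> newton_rate (decr (z k)) * (decr (z k))\<^sup>2 < 1)) \<and>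
    (decr (z 0) \<le> 0.18858 \<longrightarrow>
      (\<forall>k. decr (z (Suc k)) \<le> newton_rate (decr (z k)) * (decr (z k))\<^sup>2 \<and>
        newton_rate (decr (z k)) * (decr (z k))\<^sup>2 < 1))"
proof (intro conjI impI allI)
  fix k assume x: "z k \<in> U \<and> decr (z k) < 1 / 2"
  note step = inexact_newton_quadratic_step[OF seq spec[OF \<delta>] conjunct1[OF x] conjunct2[OF x]]
  show "z (Suc k) \<in> U" by (rule step)
  show "decr (z (Suc k)) \<le> newton_rate (decr (z k)) * (decr (z k))\<^sup>2" by (rule step)
  assume "decr (z k) \<le> 0.287"
  then show "newton_rate (decr (z k)) * (decr (z k))\<^sup>2 < 1"
    by (rule newton_rate_square_less_one[OF decrement_nonneg[OF conjunct1[OF x]]])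
next
  fix k assume "decr (z 0) \<le> 0.18858"
  then have "z k \<in> neighborhood Z F A t 0.18858"
    using inexact_newton_stays[OF seq spec[OF \<delta>], of "0.18858" k] z0 by (simp add: neighborhood_def)
  then have x: "z k \<in> U" "decr (z k) \<le> 0.18858" by (auto simp: neighborhood_def)
  show "decr (z (Suc k)) \<le> newton_rate (decr (z k)) * (decr (z k))\<^sup>2"
    using inexact_newton_quadratic_step(2)[OF seq spec[OF \<delta>] x(1)] x(2) by simp
  show "newton_rate (decr (z k)) * (decr (z k))\<^sup>2 < 1"
    using newton_rate_square_less_one[OF decrement_nonneg[OF x(1)]] x(2) by simp
qed

lemma quadratic_region:
  assumes b: "0 < \<beta>" "\<beta> \<le> 0.18858"
  shows "quadratic_convergence_region
    {z. \<exists>\<delta>. FGN_sequence F A t \<delta> z \<and> (\<forall>k. \<delta> k \<le> (decr (z k))\<^sup>2 / (1 - decr (z k)))} Z F A t \<beta>"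
  unfolding quadratic_convergence_region_def
proof (intro conjI ballI impI)
  fix z assume "z \<in> {z. \<exists>\<delta>. FGN_sequence F A t \<delta> z \<and> (\<forall>k. \<delta> k \<le> (decr (z k))\<^sup>2 / (1 - decr (z k)))}"
    and z0: "z 0 \<in> neighborhood Z F A t \<beta>"
  then obtain \<delta> where seq: "FGN_sequence F A t \<delta> z" and \<delta>: "\<And>k. \<delta> k \<le> (decr (z k))\<^sup>2 / (1 - decr (z k))" by auto
  note stay = inexact_newton_stays[OF seq \<delta> b(2) z0]
  then show "\<forall>k. z k \<in> neighborhood Z F A t \<beta>" by blast
  have l: "0 \<le> decr (z k)" "decr (z k) \<le> \<beta>" for k
    using stay[of k] decrement_nonneg by (auto simp: neighborhood_def)
  define c where "c = newton_rate \<beta>"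
  have c: "0 < c" using b by (auto simp: c_def intro: newton_rate_pos)
  have quad: "decr (z (Suc k)) \<le> c * (decr (z k))\<^sup>2" for k
  proof -
    have "decr (z (Suc k)) \<le> newton_rate (decr (z k)) * (decr (z k))\<^sup>2"
      using l[of k] b stay[of k] by (intro inexact_newton_quadratic_step[OF seq \<delta>]) (auto simp: neighborhood_def)
    also have "\<dots> \<le> c * (decr (z k))\<^sup>2"
      unfolding c_def using l[of k] b by (intro mult_right_mono newton_rate_mono) auto
    finally show ?thesis .
  qed
  have geo: "decr (z k) \<le> (c * \<beta>) ^ k * \<beta>" for k
  proof (induction k)
    case (Suc k)
    have "decr (z (Suc k)) \<le> (c * decr (z k)) * decr (z k)"
      using quad[of k] by (simp add: power2_eq_square mult.assoc)
    also have "\<dots> \<le> (c * \<beta>) * ((c * \<beta>) ^ k * \<beta>)"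
      using Suc l[of k] c b by (intro mult_mono mult_left_mono) auto
    finally show ?case by simp
  qed (use l in simp)
  have "(\<lambda>k. decr (z k)) \<longlonglongrightarrow> 0"
  proof (rule tendsto_sandwich[OF _ _ tendsto_const])
    show "(\<lambda>k. (c * \<beta>) ^ k * \<beta>) \<longlonglongrightarrow> 0"
      using newton_rate_contraction[of \<beta>] b c
      by (intro tendsto_mult_left_zero LIMSEQ_power_zero) (auto simp: c_def)
  qed (use l geo in auto)
  moreover have "\<forall>k. \<bar>decr (z (Suc k))\<bar> \<le> c * \<bar>decr (z k)\<bar>\<^sup>2" using quad l by simp
  ultimately show "converges_quadratically_to_zero (\<lambda>k. decr (z k))"
    unfolding converges_quadratically_to_zero_def by blast
qed (use b in auto)

text \<open>
  The exact Newton point \<open>xb\<close> of the start has decrement at most \<open>0.0541\<close>, so the central point exists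
  and is within \<open>0.0572\<close> of \<open>xb\<close>. The iterate is within \<open>0.0877 / 0.81142 \<le> 0.1081\<close> of \<open>xb\<close>. Going through
  \<open>xb\<close> keeps the conversion to the norm at the central point cheap.
\<close>

lemma first_step_near_central:
  assumes b: "0 < \<beta>" "\<beta> \<le> 0.18858" and x: "x \<in> neighborhood Z F A t \<beta>"
    and y: "newton_approx F A t \<delta> x y" and \<delta>: "0 \<le> \<delta>" "\<delta> \<le> 0.0877"
  shows "\<exists>c. central c \<and> N c (y - c) \<le> 0.18"
proof -
  define l where "l = decr x"
  define xb where "xb = newton x"
  have xU: "x \<in> U" and l: "0 \<le> l" "l \<le> 0.18858"
    using x b decrement_nonneg by (auto simp: neighborhood_def l_def)
  have n: "N x (xb - x) = l"
    unfolding l_def newton_decrement_def xb_def by (rule N_minus_commute[OF xU])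
  have xbU: "xb \<in> U" using exact_newton_step(1)[OF xU] l by (simp add: xb_def l_def)
  define \<kappa> where "\<kappa> = (l / (1 - l))\<^sup>2"
  have "\<kappa> \<le> (0.18858 / (1 - 0.18858))\<^sup>2"
    unfolding \<kappa>_def using l by (intro power_mono frac_le) auto
  also have "\<dots> \<le> 0.0541" by (simp add: power2_eq_square)
  finally have \<kappa>: "\<kappa> \<le> 0.0541" .
  have "decr xb \<le> \<kappa>"
    using exact_newton_step(2)[OF xU] l by (simp add: xb_def l_def \<kappa>_def)
  then obtain c where c: "central c" using central_point_exists[OF xbU] \<kappa> by auto
  have cU: "c \<in> U" using c by (simp add: central_def)
  define u where "u = N xb (xb - c)"
  have "u \<le> \<kappa> * (1 + u)"
    using newton_point_near_central[OF xU _ c] l by (simp add: u_def xb_def l_def \<kappa>_def)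
  moreover have "\<kappa> * (1 + u) \<le> 0.0541 * (1 + u)"
    using \<kappa> N_nonneg[OF xbU] by (intro mult_right_mono) (auto simp: u_def)
  ultimately have u: "u \<le> 0.0572" by simp
  have "(1 - l) * N xb (y - xb) \<le> N x (y - xb)"
    using hessian_comparison(2)[OF xU, of "xb - x" "y - xb"] xbU n l by (simp add: field_simps)
  also have "\<dots> \<le> 0.0877"
    using newton_step(1)[OF xU y \<delta>(1)] l \<delta> by (simp add: xb_def l_def)
  finally have "(1 - l) * N xb (y - xb) \<le> 0.0877" .
  moreover have "0.81142 * N xb (y - xb) \<le> (1 - l) * N xb (y - xb)"
    using l N_nonneg[OF xbU] by (intro mult_right_mono) auto
  ultimately have "N xb (y - xb) \<le> 0.1081" by simp
  then have yc: "N xb (y - c) \<le> 0.1653"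
    using N_triangle[OF xbU, of "y - xb" "xb - c"] u by (simp add: u_def)
  have u': "N xb (c - xb) = u" unfolding u_def by (rule N_minus_commute[OF xbU])
  have "N c (y - c) \<le> N xb (y - c) / (1 - u)"
    using hessian_comparison(2)[OF xbU, of "c - xb" "y - c"] cU u u' by simp
  also have "\<dots> \<le> 0.1653 / (1 - 0.0572)"
    using yc u N_nonneg[OF xbU] by (intro frac_le) auto
  also have "\<dots> \<le> 0.18" by simp
  finally show ?thesis using c by blast
qed

text \<open>
  \<open>t_choice\<close> is \<open>(1 - e) \<epsilon>\<close> divided by a bound for \<open>sqrt \<nu> + s + \<delta>\<close>, which is what \<open>residual_bound\<close>
  asks for.
\<close>

lemma eps_solution_when_steps_small:
  assumes \<nu>t: "t = t_choice \<nu> e \<epsilon>" and e: "0 < e" "e < 1" and \<epsilon>: "0 < \<epsilon>"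
    and x: "x \<in> U" and y: "newton_approx F A t \<delta> x y" and \<delta>: "0 \<le> \<delta>" "\<delta> \<le> e\<^sup>2"
    and s: "N x (y - x) \<le> e"
  shows "eps_solution Z F A \<epsilon> y"
proof -
  define s where "s = N x (y - x)"
  have s: "0 \<le> s" "s \<le> e" using N_nonneg[OF x] s by (auto simp: s_def)
  define B where "B = sqrt \<nu> + e + 2 * e\<^sup>2 / (1 - e)"
  have B: "0 < B" using e parameter_pos by (simp add: B_def add_nonneg_pos add_pos_nonneg)
  have "e\<^sup>2 * 1 \<le> 2 * e\<^sup>2 / (1 - e)" using e by (simp add: le_divide_eq)
  then have "\<delta> + sqrt \<nu> + s \<le> B" using \<delta> s by (simp add: B_def)
  then have "(\<delta> + sqrt \<nu> + s) / (1 - s) \<le> B / (1 - e)"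
    using s e B by (intro frac_le) auto
  then have "t * ((\<delta> + sqrt \<nu> + s) / (1 - s)) \<le> t * (B / (1 - e))" using t by (intro mult_left_mono) auto
  also have "\<dots> = \<epsilon>"
  proof -
    have "t = (1 - e) * inverse B * \<epsilon>" by (simp add: \<nu>t t_choice_def B_def)
    then show ?thesis using e B by simp
  qed
  finally have le: "t * ((\<delta> + sqrt \<nu> + s) / (1 - s)) \<le> \<epsilon>" .
  have "N x (y - x) < 1" using s e by (simp add: s_def)
  from residual_bound[OF x y \<delta>(1) this]
  have "y \<in> U" "dist_zero F y (A y) \<le> ereal (t * ((\<delta> + sqrt \<nu> + s) / (1 - s)))" by (auto simp: s_def)
  then show ?thesis using le by (auto simp: eps_solution_def intro: order_trans)
qed

end

lemma newton_scheme_of_inclusion: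
  "self_concordant_inclusion Z F \<nu> A \<Longrightarrow> 0 < t \<Longrightarrow> newton_scheme Z F \<nu> A t"
  by unfold_locales (auto simp: self_concordant_inclusion_def)

text \<open>
  After \<open>K + j\<close> steps both the distance to the central point and \<open>\<beta>\<^sub>k\<close> are at most \<open>(1/2)^(2^j) / 9\<close>. With
  \<open>2\<^sup>j \<ge> log 2 (1 / e)\<close> the next step has length at most \<open>e\<close> and tolerance at most \<open>e\<^sup>2\<close>.
\<close>

lemma eps_solution_after_loglog_iterations:
  assumes b: "0 < \<beta>" "\<beta> \<le> 0.18858"
  shows "\<exists>K. \<forall>(Z :: (real^'p) set) F \<nu> A \<epsilon> e z.
    self_concordant_inclusion Z F \<nu> A \<and> 0 < \<epsilon> \<and> 0 < e \<and> e < \<beta> \<and>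
    z 0 \<in> neighborhood Z F A (t_choice \<nu> e \<epsilon>) \<beta> \<and>
    FGN_sequence F A (t_choice \<nu> e \<epsilon>) (delta_seq \<beta>) z \<longrightarrow>
    eps_solution Z F A \<epsilon> (z (K + loglog e))"
proof -
  obtain K where K: "1 \<le> K" and decay: "\<forall>\<rho>. \<rho> 1 \<le> 0.18 \<and> (\<forall>k\<ge>1. 0 \<le> \<rho> k \<and> (\<rho> k \<le> 0.18 \<longrightarrow>
      \<rho> (Suc k) \<le> 2 * delta_seq \<beta> k + 2 * (\<rho> k)\<^sup>2 \<and> \<rho> (Suc k) \<le> (0.18::real))) \<longrightarrow>
    (\<forall>k\<ge>1. \<rho> k \<le> 0.18) \<and>
    (\<forall>j. 9 * \<rho> (K + j) \<le> (1/2) ^ (2 ^ j) \<and> 9 * beta_seq \<beta> (K + j) \<le> (1/2) ^ (2 ^ j))"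
    using doubly_exponential_decay[OF b] by (elim exE conjE) (rule that)
  have "eps_solution Z F A \<epsilon> (z (Suc (K + loglog e)))"
    if inc: "self_concordant_inclusion Z F \<nu> A" and \<epsilon>: "0 < \<epsilon>" and e: "0 < e" "e < \<beta>"
      and z0: "z 0 \<in> neighborhood Z F A (t_choice \<nu> e \<epsilon>) \<beta>"
      and seq: "FGN_sequence F A (t_choice \<nu> e \<epsilon>) (delta_seq \<beta>) z"
    for Z :: "(real^'p) set" and F \<nu> A \<epsilon> e z
  proof -
    define t where "t = t_choice \<nu> e \<epsilon>"
    have e1: "e < 1" using e b by simp
    have "0 < \<nu>" using inc by (simp add: self_concordant_inclusion_def self_concordant_barrier_def)
    then have "0 < sqrt \<nu> + e + 2 * e\<^sup>2 / (1 - e)" using e e1 by (simp add: add_nonneg_pos add_pos_nonneg)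
    then have "0 < t" using e1 \<epsilon> by (simp add: t_def t_choice_def)
    then interpret newton_scheme Z F \<nu> A t by (rule newton_scheme_of_inclusion[OF inc])
    have step: "newton_approx F A t (delta_seq \<beta> k) (z k) (z (Suc k))" for k
      using seq by (auto simp: FGN_sequence_def t_def)
    note \<delta> = delta_seq_bounds[OF b]
    obtain c where c: "central c" "N c (z 1 - c) \<le> 0.18"
      using first_step_near_central[OF b z0[folded t_def] step[of 0] \<delta>(1,3)] by auto
    have cU: "c \<in> U" using c by (simp add: central_def)
    define \<rho> where "\<rho> k = N c (z k - c)" for k
    have r0: "0 \<le> \<rho> k" for k by (simp add: \<rho>_def N_nonneg[OF cU])
    have inU: "z k \<in> U" if "\<rho> k \<le> 0.18" for k
      using Dikin_ellipsoid[OF cU, of "z k - c"] that by (simp add: \<rho>_def)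
    have "\<rho> (Suc k) \<le> 2 * delta_seq \<beta> k + 2 * (\<rho> k)\<^sup>2 \<and> \<rho> (Suc k) \<le> 0.18" if k: "\<rho> k \<le> 0.18" for k
    proof -
      have "\<rho> (Suc k) \<le> (delta_seq \<beta> k + (\<rho> k)\<^sup>2 * (1 - 2 * \<rho> k / 3) / (1 - \<rho> k) ^ 3) / (1 - \<rho> k)"
        using newton_step_towards_central[OF c(1) inU[OF k] step \<delta>(1)] k by (simp add: \<rho>_def)
      then show ?thesis
        by (intro conjI order_trans[OF _ central_step_contraction(1)[OF r0 k \<delta>(1,3)]]
            order_trans[OF _ central_step_contraction(2)[OF r0 k \<delta>(1,3)]])
    qed
    moreover have "\<rho> 1 \<le> 0.18" using c(2) by (simp only: \<rho>_def)
    ultimately have "\<rho> 1 \<le> 0.18 \<and> (\<forall>k\<ge>1. 0 \<le> \<rho> k \<and> (\<rho> k \<le> 0.18 \<longrightarrow>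
        \<rho> (Suc k) \<le> 2 * delta_seq \<beta> k + 2 * (\<rho> k)\<^sup>2 \<and> \<rho> (Suc k) \<le> 0.18))"
      using r0 by blast
    from mp[OF spec[OF decay] this]
    have dec: "\<And>k. 1 \<le> k \<Longrightarrow> \<rho> k \<le> 0.18"
      "\<And>j. 9 * \<rho> (K + j) \<le> (1/2) ^ (2 ^ j)" "\<And>j. 9 * beta_seq \<beta> (K + j) \<le> (1/2) ^ (2 ^ j)"
      by blast+
    define j where "j = loglog e"
    define q :: real where "q = (1/2) ^ (2 ^ j)"
    have q: "0 \<le> q" "q \<le> e" using half_power_loglog[OF e(1) e1] by (auto simp: q_def j_def)
    define k where "k = K + j"
    have k: "1 \<le> k" using K by (simp add: k_def)
    have rk: "9 * \<rho> k \<le> q" "9 * beta_seq \<beta> k \<le> q" using dec(2,3)[of j] by (auto simp: k_def q_def)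
    have rS: "9 * \<rho> (Suc k) \<le> q"
    proof -
      have "9 * \<rho> (K + Suc j) \<le> (1/2) ^ (2 ^ Suc j)" by (rule dec(2))
      also have "\<dots> \<le> q" unfolding q_def by (rule power_decreasing) auto
      finally show ?thesis by (simp add: k_def)
    qed
    have xU: "z k \<in> U" by (rule inU[OF dec(1)[OF k]])
    have "(1 - \<rho> k) * N (z k) (z (Suc k) - z k) \<le> N c (z (Suc k) - z k)"
      using hessian_comparison(2)[OF cU, of "z k - c" "z (Suc k) - z k"] xU dec(1)[OF k]
      by (simp add: \<rho>_def field_simps)
    also have "\<dots> \<le> \<rho> (Suc k) + \<rho> k"
      using N_triangle_diff[OF cU, of "z (Suc k) - c" "z k - c"] by (simp add: \<rho>_def)
    finally have "(1 - \<rho> k) * N (z k) (z (Suc k) - z k) \<le> \<rho> (Suc k) + \<rho> k" .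
    moreover have "0.82 * N (z k) (z (Suc k) - z k) \<le> (1 - \<rho> k) * N (z k) (z (Suc k) - z k)"
      using dec(1)[OF k] N_nonneg[OF xU] by (intro mult_right_mono) auto
    ultimately have s: "N (z k) (z (Suc k) - z k) \<le> e" using rk rS q by simp
    have "delta_seq \<beta> k \<le> 5/2 * (beta_seq \<beta> k)\<^sup>2" by (rule \<delta>(2))
    also have "\<dots> \<le> (9 * beta_seq \<beta> k)\<^sup>2" by (simp add: power_mult_distrib)
    also have "\<dots> \<le> e\<^sup>2" using rk q beta_seq_bounds(1)[OF b, of k] by (intro power_mono) auto
    finally have d: "delta_seq \<beta> k \<le> e\<^sup>2" .
    show ?thesis
      using eps_solution_when_steps_small[OF t_def e(1) e1 \<epsilon> xU step \<delta>(1) d s] by (simp add: k_def j_def)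
  qed
  then show ?thesis by (intro exI[of _ "Suc K"]) auto
qed

lemma (in newton_scheme) full_step_convergence:
  "(\<forall>\<beta> \<delta> z.
         0 < \<beta> \<and> \<beta> < (3 - sqrt 5) / 2 \<and>
         FGN_sequence F A t \<delta> z \<and> z 0 \<in> neighborhood Z F A t \<beta> \<and>
         (\<forall>k. local_norm F (z k) (z (Suc k) - newton_point F A t (z k)) \<le> \<delta> k \<and>
              \<delta> k \<le> delta_max \<beta>)
         \<longrightarrow> (\<forall>k. z k \<in> neighborhood Z F A t \<beta>)) \<and>
      (\<forall>\<delta> z.
         let l = (\<lambda>k. newton_decrement F A t (z k)) in
         FGN_sequence F A t \<delta> z \<and> z 0 \<in> interior Z \<and>
         (\<forall>k. \<delta> k \<le> (l k)\<^sup>2 / (1 - l k))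
         \<longrightarrow>
           (\<forall>k. z k \<in> interior Z \<and> l k < 1 / 2 \<longrightarrow>
                z (Suc k) \<in> interior Z \<and>
                l (Suc k) \<le> newton_rate (l k) * (l k)\<^sup>2 \<and>
                (l k \<le> 0.287 \<longrightarrow> newton_rate (l k) * (l k)\<^sup>2 < 1)) \<and>
           (l 0 \<le> 0.18858 \<longrightarrow>
              (\<forall>k. l (Suc k) \<le> newton_rate (l k) * (l k)\<^sup>2 \<and>
                   newton_rate (l k) * (l k)\<^sup>2 < 1))) \<and>
      (\<forall>\<beta>. 0 < \<beta> \<and> \<beta> \<le> 0.18858 \<longrightarrow>
         quadratic_convergence_region
           {z. \<exists>\<delta>. FGN_sequence F A t \<delta> z \<and>
                 (\<forall>k. \<delta> k \<le> (newton_decrement F A t (z k))\<^sup>2 / (1 - newton_decrement F A t (z k)))}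
           Z F A t \<beta>)" (is "?invariant \<and> ?steps \<and> ?region")
proof (intro conjI)
  show ?invariant using inexact_newton_invariant by blast
  show ?steps
    unfolding Let_def
    by (intro allI, rule impI, elim conjE, rule inexact_newton_decrements, assumption+)
  show ?region by (intro allI impI quadratic_region) simp_all
qed

lemma loglog_complexity:
  assumes b: "0 < \<beta>" "\<beta> \<le> 0.18858"
  shows "0 < newton_rate \<beta> \<and> newton_rate \<beta> * \<beta> < 1 \<and>
      (\<exists>N e0.
         (\<lambda>e. real (N e)) \<in> O[at_right 0](\<lambda>e. ln (ln (1 / e))) \<and> 0 < e0 \<and> e0 \<le> \<beta> \<and>
         (\<forall>(Z :: (real^'p) set) F \<nu> A \<epsilon> e z.
            self_concordant_inclusion Z F \<nu> A \<and> 0 < \<epsilon> \<and> 0 < e \<and> e < e0 \<and>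
            z 0 \<in> neighborhood Z F A (t_choice \<nu> e \<epsilon>) \<beta> \<and>
            FGN_sequence F A (t_choice \<nu> e \<epsilon>) (delta_seq \<beta>) z
            \<longrightarrow> eps_solution Z F A \<epsilon> (z (N e))))"
    (is "_ \<and> _ \<and> ?complexity")
proof (intro conjI)
  show "0 < newton_rate \<beta>" using b by (intro newton_rate_pos) auto
  show "newton_rate \<beta> * \<beta> < 1" using b by (intro newton_rate_contraction) auto
  obtain K where K: "\<forall>(Z :: (real^'p) set) F \<nu> A \<epsilon> e z.
    self_concordant_inclusion Z F \<nu> A \<and> 0 < \<epsilon> \<and> 0 < e \<and> e < \<beta> \<and>
    z 0 \<in> neighborhood Z F A (t_choice \<nu> e \<epsilon>) \<beta> \<and>
    FGN_sequence F A (t_choice \<nu> e \<epsilon>) (delta_seq \<beta>) z \<longrightarrow>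
    eps_solution Z F A \<epsilon> (z (K + loglog e))"
    using eps_solution_after_loglog_iterations[OF b] by (elim exE) (rule that)
  show ?complexity
    by (rule exI[of _ "\<lambda>e. K + loglog e"], rule exI[of _ \<beta>])
      (intro conjI loglog_bigo b(1) order_refl, rule K)
qed

theorem theorem2:
  "(\<forall>(Z :: (real^'p) set) F \<nu> A t. self_concordant_inclusion Z F \<nu> A \<and> 0 < t \<longrightarrow>
      (\<forall>\<beta> \<delta> z.
         0 < \<beta> \<and> \<beta> < (3 - sqrt 5) / 2 \<and>
         FGN_sequence F A t \<delta> z \<and> z 0 \<in> neighborhood Z F A t \<beta> \<and>
         (\<forall>k. local_norm F (z k) (z (Suc k) - newton_point F A t (z k)) \<le> \<delta> k \<and>
              \<delta> k \<le> delta_max \<beta>)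
         \<longrightarrow> (\<forall>k. z k \<in> neighborhood Z F A t \<beta>)) \<and>
      (\<forall>\<delta> z.
         let l = (\<lambda>k. newton_decrement F A t (z k)) in
         FGN_sequence F A t \<delta> z \<and> z 0 \<in> interior Z \<and>
         (\<forall>k. \<delta> k \<le> (l k)\<^sup>2 / (1 - l k))
         \<longrightarrow>
           (\<forall>k. z k \<in> interior Z \<and> l k < 1 / 2 \<longrightarrow>
                z (Suc k) \<in> interior Z \<and>
                l (Suc k) \<le> newton_rate (l k) * (l k)\<^sup>2 \<and>
                (l k \<le> 0.287 \<longrightarrow> newton_rate (l k) * (l k)\<^sup>2 < 1)) \<and>
           (l 0 \<le> 0.18858 \<longrightarrow>
              (\<forall>k. l (Suc k) \<le> newton_rate (l k) * (l k)\<^sup>2 \<and>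
                   newton_rate (l k) * (l k)\<^sup>2 < 1))) \<and>
      (\<forall>\<beta>. 0 < \<beta> \<and> \<beta> \<le> 0.18858 \<longrightarrow>
         quadratic_convergence_region
           {z. \<exists>\<delta>. FGN_sequence F A t \<delta> z \<and>
                 (\<forall>k. \<delta> k \<le> (newton_decrement F A t (z k))\<^sup>2 / (1 - newton_decrement F A t (z k)))}
           Z F A t \<beta>)) \<and>
   (\<forall>\<beta>. 0 < \<beta> \<and> \<beta> \<le> 0.18858 \<longrightarrow>
      0 < newton_rate \<beta> \<and> newton_rate \<beta> * \<beta> < 1 \<and>
      (\<exists>N e0.
         (\<lambda>e. real (N e)) \<in> O[at_right 0](\<lambda>e. ln (ln (1 / e))) \<and> 0 < e0 \<and> e0 \<le> \<beta> \<and>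
         (\<forall>(Z :: (real^'p) set) F \<nu> A \<epsilon> e z.
            self_concordant_inclusion Z F \<nu> A \<and> 0 < \<epsilon> \<and> 0 < e \<and> e < e0 \<and>
            z 0 \<in> neighborhood Z F A (t_choice \<nu> e \<epsilon>) \<beta> \<and>
            FGN_sequence F A (t_choice \<nu> e \<epsilon>) (delta_seq \<beta>) z
            \<longrightarrow> eps_solution Z F A \<epsilon> (z (N e)))))"
  by (rule conjI, intro allI, rule impI, elim conjE,
      rule newton_scheme.full_step_convergence[OF newton_scheme_of_inclusion], assumption+,
      intro allI, rule impI, elim conjE, rule loglog_complexity, assumption+)

end
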